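(* Let $(\mathcal{A}_1,\rho_1,\pi_1)$ and $(\mathcal{A}_2,\rho_2,\pi_2)$ be compact quantum metric spaces. Then $(\mathcal{A}_1\check{\otimes}\mathcal{A}_2,\rho,\pi_1\otimes\pi_2)$ is a compact quantum metric space, where $$\rho=\rho_1\otimes1_{\mathcal{A}_2\check{\otimes}\mathcal{A}_2}+1_{\mathcal{A}_1\check{\otimes}\mathcal{A}_1}\otimes\rho_2\in(\mathcal{A}_1\check{\otimes}\mathcal{A}_1)\check{\otimes}(\mathcal{A}_2\check{\otimes}\mathcal{A}_2)\cong(\mathcal{A}_1\check{\otimes}\mathcal{A}_2)\check{\otimes}(\mathcal{A}_1\check{\otimes}\mathcal{A}_2).$$
   Context: Notation: $\check{\otimes}$ denotes the spatial (minimal) tensor product of C*-algebras; $\bar{\otimes}$ denotes the Hilbert space tensor product (for Hilbert spaces) and the von Neumann algebra tensor product (for von Neumann algebras); $\mathbf{L}(\mathcal{H})$ is the algebra of bounded operators on the Hilbert space $\mathcal{H}$. The isomorphism $(\mathcal{A}_1\check{\otimes}\mathcal{A}_1)\check{\otimes}(\mathcal{A}_2\check{\otimes}\mathcal{A}_2)\cong(\mathcal{A}_1\check{\otimes}\mathcal{A}_2)\check{\otimes}(\mathcal{A}_1\check{\otimes}\mathcal{A}_2)$ is the one exchanging the two middle tensor factors, $(a\otimes a')\otimes(b\otimes b')\mapsto(a\otimes b)\otimes(a'\otimes b')$. The representation $\pi_1\otimes\pi_2$ acts on the Hilbert space tensor product of the spaces of $\pi_1$ and $\pi_2$. Atomic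 representation: a representation $\pi$ of a unital C*-algebra $\mathcal{A}$ on a Hilbert space $\mathcal{H}$ is called atomic if there is a family $\{\pi_i:\mathcal{A}\to\mathbf{L}(\mathcal{H}_i)\}$ of pairwise inequivalent irreducible representations of $\mathcal{A}$ with $\pi=\bigoplus_i\pi_i$ (so $\pi(\mathcal{A})''=\bigoplus_i\mathbf{L}(\mathcal{H}_i)$). Let $\pi:\mathcal{A}\to\mathbf{L}(\mathcal{H})$ be a faithful atomic representation; regard $\mathcal{A}\subseteq\mathbf{L}(\mathcal{H})$ via $\pi$, write $\mathcal{A}''=\pi(\mathcal{A})''$, and regard $\mathcal{A}\check{\otimes}\mathcal{A}\subseteq\mathcal{A}''\bar{\otimes}\mathcal{A}''\subseteq\mathbf{L}(\mathcal{H}\bar{\otimes}\mathcal{H})$. Let $P_\delta\in\mathcal{A}''\bar{\otimes}\mathcal{A}''$ be the supremum of all projections of the form $p\otimes p$ with $p\in\mathcal{A}''$ a minimal projection, and let $\mathcal{H}_\delta\subseteq\mathcal{H}\bar{\otimes}\mathcal{H}$ be the image of $P_\delta$. Compact quantum metric space: a triple $(\mathcal{A},\rho,\pi)$ where $\mathcal{A}$ is a unital C*-algebra, $\pi:\mathcal{A}\to\mathbf{L}(\mathcal{H})$ is a faithful atomic representation, and $\rho\in\mathcal{A}\check{\otimes}\mathcal{A}$ satisfies: (i)$'$ $\rho$ is a positive element of $\mathcal{A}\check{\otimes}\mathcal{A}$; (ii)$'$ $\rho P_\delta=P_\delta\rho=0$; (iii)$'$ $0$ is not an eigenvalue of the operator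 $\rho|_{\mathcal{H}_\delta^\perp}\in\mathbf{L}(\mathcal{H}_\delta^\perp)$; (iv)$'$ $\mathfrak{F}(\rho)=\rho$, where $\mathfrak{F}:\mathcal{A}\check{\otimes}\mathcal{A}\to\mathcal{A}\check{\otimes}\mathcal{A}$ is the flip $a\otimes b\mapsto b\otimes a$; (v)$'$ $\mathfrak{M}(\rho)\leq\rho\otimes1+1\otimes\rho$ in $\mathcal{A}\check{\otimes}\mathcal{A}\check{\otimes}\mathcal{A}$, where $\mathfrak{M}:\mathcal{A}\check{\otimes}\mathcal{A}\to\mathcal{A}\check{\otimes}\mathcal{A}\check{\otimes}\mathcal{A}$ is the *-morphism with $\mathfrak{M}(a\otimes b)=a\otimes1\otimes b$. *)

theory Defs
  imports "HOL-Analysis.Analysis" "HOL-Algebra.Module"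
begin

text \<open>
  Complex Hilbert spaces. The norm and the topology are those of the underlying real inner
  product space, whose inner product is the real part of \<open>cinner\<close>; the latter is
  antilinear in its first and linear in its second argument.
\<close>

class chilbert_space = banach + real_inner +
  fixes scaleC :: "complex \<Rightarrow> 'a \<Rightarrow> 'a" (infixr \<open>*\<^sub>C\<close> 75)
    and cinner :: "'a \<Rightarrow> 'a \<Rightarrow> complex"
  assumes scaleC_add_right: "c *\<^sub>C (x + y) = c *\<^sub>C x + c *\<^sub>C y"
    and scaleC_add_left: "(c + d) *\<^sub>C x = c *\<^sub>C x + d *\<^sub>C x"
    and scaleC_scaleC: "c *\<^sub>C d *\<^sub>C x = (c * d) *\<^sub>C x"
    and scaleC_of_real: "complex_of_real r *\<^sub>C x = r *\<^sub>R x"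
    and cinner_add_right: "cinner x (y + z) = cinner x y + cinner x z"
    and cinner_scaleC_right: "cinner x (c *\<^sub>C y) = c * cinner x y"
    and cinner_commute: "cinner x y = cnj (cinner y x)"
    and inner_eq_Re_cinner: "inner x y = Re (cinner x y)"

lemma cinner_add_left: "cinner (x + y) z = cinner x z + cinner y z"
  by (metis cinner_commute cinner_add_right complex_cnj_add)

lemma cinner_scaleC_left: "cinner (c *\<^sub>C x) y = cnj c * cinner x y"
  by (metis cinner_commute cinner_scaleC_right complex_cnj_mult)

lemma scaleC_one [simp]: "1 *\<^sub>C x = x"
  using scaleC_of_real[of 1 x] by simp

lemma scaleC_zero_left [simp]: "0 *\<^sub>C x = 0"
  using scaleC_of_real[of 0 x] by simp

lemma scaleC_zero_right [simp]: "c *\<^sub>C 0 = 0"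
  using scaleC_add_right[of c 0 0] by simp

lemma scaleC_minus_right: "c *\<^sub>C (- x) = - (c *\<^sub>C x)"
  using scaleC_add_right[of c x "- x"] by (simp add: eq_neg_iff_add_eq_0 add.commute)

lemma cinner_scaleR_right: "cinner x (r *\<^sub>R y) = of_real r * cinner x y"
  by (metis cinner_scaleC_right scaleC_of_real)

lemma cinner_zero_right [simp]: "cinner x 0 = 0"
  using cinner_add_right[of x 0 0] by simp

lemma cinner_zero_left [simp]: "cinner 0 x = 0"
  using cinner_add_left[of 0 0 x] by simp

lemma cinner_minus_right: "cinner x (- y) = - cinner x y"
  using cinner_add_right[of x y "- y"] by (simp add: eq_neg_iff_add_eq_0 add.commute)

lemma cinner_diff_right: "cinner x (y - z) = cinner x y - cinner x z"
  using cinner_add_right[of x y "- z"] by (simp add: cinner_minus_right)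

lemma cinner_sum_right: "cinner x (\<Sum>i\<in>I. f i) = (\<Sum>i\<in>I. cinner x (f i))"
  by (cases "finite I", induct set: finite) (simp_all add: cinner_add_right)

lemma cinner_sum_left: "cinner (\<Sum>i\<in>I. f i) x = (\<Sum>i\<in>I. cinner (f i) x)"
  by (cases "finite I", induct set: finite) (simp_all add: cinner_add_left)

lemma cinner_self: "cinner x x = complex_of_real ((norm x)\<^sup>2)"
proof (rule complex_eqI)
  show "Re (cinner x x) = Re (complex_of_real ((norm x)\<^sup>2))"
    by (simp add: inner_eq_Re_cinner[symmetric] norm_eq_sqrt_inner)
  have "Im (cinner x x) = - Im (cinner x x)"
    using cinner_commute[of x x] by (metis cnj.simps(2))
  then show "Im (cinner x x) = Im (complex_of_real ((norm x)\<^sup>2))"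
    by simp
qed

lemma norm_scaleC: "norm (c *\<^sub>C x) = cmod c * norm x"
proof -
  have "complex_of_real ((norm (c *\<^sub>C x))\<^sup>2) = (c * cnj c) * cinner x x"
    by (simp only: cinner_self[symmetric] cinner_scaleC_left cinner_scaleC_right ac_simps)
  also have "\<dots> = complex_of_real ((cmod c * norm x)\<^sup>2)"
    by (simp only: complex_norm_square[symmetric] cinner_self power_mult_distrib of_real_mult)
  finally have "(norm (c *\<^sub>C x))\<^sup>2 = (cmod c * norm x)\<^sup>2"
    using of_real_eq_iff by blast
  then show ?thesis
    by simp
qed

lemma cinner_cauchy_schwarz: "cmod (cinner x y) \<le> norm x * norm y"
proof (cases "cinner x y = 0")
  case False
  define u where "u = cnj (cinner x y) / complex_of_real (cmod (cinner x y))"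
  have u: "cmod u = 1"
    using False by (simp add: u_def norm_divide)
  have "u * cinner x y = complex_of_real (cmod (cinner x y))"
    using False by (simp add: u_def complex_norm_square[symmetric] mult.commute power2_eq_square)
  then have "cmod (cinner x y) = inner x (u *\<^sub>C y)"
    by (simp add: inner_eq_Re_cinner cinner_scaleC_right)
  also have "\<dots> \<le> norm x * norm (u *\<^sub>C y)"
    by (rule norm_cauchy_schwarz)
  finally show ?thesis
    by (simp add: norm_scaleC u)
qed simp

definition orthonormal :: "'a::chilbert_space set \<Rightarrow> bool" where
  "orthonormal B \<longleftrightarrow> (\<forall>x\<in>B. \<forall>y\<in>B. cinner x y = (if x = y then 1 else 0))"

definition is_onb :: "'a::chilbert_space set \<Rightarrow> bool" where
  "is_onb B \<longleftrightarrow> orthonormal B \<and> (\<forall>x. (\<forall>e\<in>B. cinner e x = 0) \<longrightarrow> x = 0)"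

lemma ex_onb: "\<exists>B::'a::chilbert_space set. is_onb B"
proof -
  define \<O> where "\<O> = {B::'a set. orthonormal B}"
  have "\<exists>U\<in>\<O>. \<forall>X\<in>C. X \<subseteq> U" if C: "subset.chain \<O> C" for C
  proof (intro bexI ballI)
    show "\<Union>C \<in> \<O>"
      unfolding \<O>_def mem_Collect_eq orthonormal_def
    proof (intro ballI)
      fix x y assume "x \<in> \<Union>C" "y \<in> \<Union>C"
      then obtain X Y where XY: "X \<in> C" "Y \<in> C" "x \<in> X" "y \<in> Y"
        by blast
      then have "X \<subseteq> Y \<or> Y \<subseteq> X" "X \<in> \<O>" "Y \<in> \<O>"
        using C unfolding subset_chain_def by auto
      then obtain Z where "Z \<in> \<O>" "x \<in> Z" "y \<in> Z"
        using XY by auto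
      then show "cinner x y = (if x = y then 1 else 0)"
        unfolding \<O>_def orthonormal_def by blast
    qed
  qed blast
  then obtain M where M: "M \<in> \<O>" and max: "\<forall>X\<in>\<O>. M \<subseteq> X \<longrightarrow> X = M"
    using subset_Zorn[of \<O>] by blast
  have "x = 0" if x: "\<forall>e\<in>M. cinner e x = 0" for x
  proof (rule ccontr)
    assume "x \<noteq> 0"
    define u where "u = complex_of_real (inverse (norm x)) *\<^sub>C x"
    have n: "norm u = 1"
      using \<open>x \<noteq> 0\<close> by (simp add: u_def norm_scaleC norm_inverse)
    then have uu: "cinner u u = 1"
      by (simp add: cinner_self)
    have ou: "cinner e u = 0" "cinner u e = 0" if "e \<in> M" for e
      using x that cinner_commute[of u e] by (simp_all add: u_def cinner_scaleC_right)
    have "orthonormal (insert u M)"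
      using M uu ou unfolding \<O>_def orthonormal_def by auto
    then have "u \<in> M"
      using max unfolding \<O>_def by blast
    then have "cinner u u = 0"
      by (rule ou)
    then show False
      using uu by simp
  qed
  then show ?thesis
    using M unfolding \<O>_def is_onb_def by blast
qed

definition onb :: "'a::chilbert_space set" where
  "onb = (SOME B. is_onb B)"

lemma is_onb_onb: "is_onb onb"
  unfolding onb_def by (rule someI_ex) (rule ex_onb)

lemma orthonormal_onb: "orthonormal onb"
  using is_onb_onb unfolding is_onb_def by blast

lemma cinner_onb: "e \<in> onb \<Longrightarrow> e' \<in> onb \<Longrightarrow> cinner e e' = (if e = e' then 1 else 0)"
  using orthonormal_onb unfolding orthonormal_def by blast

text \<open>
  The Hilbert space tensor product is realised as the square summable families indexed by
  the product of two orthonormal bases, with \<open>tensor_vec x y\<close> having the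
  coordinates \<open>cinner e x * cinner f y\<close>. The lemmas \<open>cinner_tensor_vec\<close> and
  \<open>closure_span_tensor_vec\<close> below are its characterisation independent of the bases.
\<close>

typedef (overloaded) ('a, 'b) htensor =
  "{f :: 'a::chilbert_space \<times> 'b::chilbert_space \<Rightarrow> complex.
     (\<forall>p. p \<notin> onb \<times> onb \<longrightarrow> f p = 0) \<and> (\<lambda>p. (cmod (f p))\<^sup>2) summable_on UNIV}"
  by (rule exI[of _ "\<lambda>_. 0"]) simp

setup_lifting type_definition_htensor

lemma sq_summable_add:
  fixes f g :: "'i \<Rightarrow> complex"
  assumes "(\<lambda>p. (cmod (f p))\<^sup>2) summable_on A" "(\<lambda>p. (cmod (g p))\<^sup>2) summable_on A"
  shows "(\<lambda>p. (cmod (f p + g p))\<^sup>2) summable_on A"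
proof (rule summable_on_comparison_test)
  show "(\<lambda>p. 2 * (cmod (f p))\<^sup>2 + 2 * (cmod (g p))\<^sup>2) summable_on A"
    by (intro summable_on_add summable_on_cmult_right assms)
  fix p
  have "(cmod (f p + g p))\<^sup>2 \<le> (cmod (f p) + cmod (g p))\<^sup>2"
    by (simp add: norm_triangle_ineq power_mono)
  also have "\<dots> \<le> 2 * (cmod (f p))\<^sup>2 + 2 * (cmod (g p))\<^sup>2"
    using zero_le_power2[of "cmod (f p) - cmod (g p)"] by (simp add: power2_eq_square algebra_simps)
  finally show "(cmod (f p + g p))\<^sup>2 \<le> 2 * (cmod (f p))\<^sup>2 + 2 * (cmod (g p))\<^sup>2" .
qed simp

lemma sq_summable_mult:
  fixes f g :: "'i \<Rightarrow> complex"
  assumes "(\<lambda>p. (cmod (f p))\<^sup>2) summable_on A" "(\<lambda>p. (cmod (g p))\<^sup>2) summable_on A"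
  shows "(\<lambda>p. cnj (f p) * g p) summable_on A"
proof -
  have "(\<lambda>p. norm (cnj (f p) * g p)) summable_on A"
  proof (rule summable_on_comparison_test)
    show "(\<lambda>p. (cmod (f p))\<^sup>2 + (cmod (g p))\<^sup>2) summable_on A"
      by (intro summable_on_add assms)
    fix p
    have "2 * (cmod (f p) * cmod (g p)) \<le> (cmod (f p))\<^sup>2 + (cmod (g p))\<^sup>2"
      using zero_le_power2[of "cmod (f p) - cmod (g p)"] by (simp add: power2_eq_square algebra_simps)
    moreover have "0 \<le> cmod (f p) * cmod (g p)"
      by simp
    ultimately have "cmod (f p) * cmod (g p) \<le> (cmod (f p))\<^sup>2 + (cmod (g p))\<^sup>2"
      by linarith
    then show "norm (cnj (f p) * g p) \<le> (cmod (f p))\<^sup>2 + (cmod (g p))\<^sup>2"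
      by (simp add: norm_mult)
  qed simp
  then show ?thesis
    by (rule abs_summable_summable)
qed

lemma sq_summable_scale:
  fixes f :: "'i \<Rightarrow> complex"
  assumes "(\<lambda>p. (cmod (f p))\<^sup>2) summable_on A"
  shows "(\<lambda>p. (cmod (c * f p))\<^sup>2) summable_on A"
  using summable_on_cmult_right[OF assms, of "(cmod c)\<^sup>2"]
  by (simp add: norm_mult power_mult_distrib)

instantiation htensor :: (chilbert_space, chilbert_space) real_inner
begin

lift_definition zero_htensor :: "('a, 'b) htensor" is "\<lambda>_. 0"
  by simp

lift_definition plus_htensor :: "('a, 'b) htensor \<Rightarrow> ('a, 'b) htensor \<Rightarrow> ('a, 'b) htensor"
  is "\<lambda>f g p. f p + g p"
  by (auto intro: sq_summable_add)

lift_definition uminus_htensor :: "('a, 'b) htensor \<Rightarrow> ('a, 'b) htensor" is "\<lambda>f p. - f p"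
  by simp

lift_definition minus_htensor :: "('a, 'b) htensor \<Rightarrow> ('a, 'b) htensor \<Rightarrow> ('a, 'b) htensor"
  is "\<lambda>f g p. f p - g p"
  subgoal for f g
    using sq_summable_add[of f UNIV "\<lambda>p. - g p"] by auto
  done

lift_definition scaleR_htensor :: "real \<Rightarrow> ('a, 'b) htensor \<Rightarrow> ('a, 'b) htensor"
  is "\<lambda>r f p. complex_of_real r * f p"
  by (auto intro: sq_summable_scale simp del: norm_mult)

lift_definition inner_htensor :: "('a, 'b) htensor \<Rightarrow> ('a, 'b) htensor \<Rightarrow> real"
  is "\<lambda>f g. Re (\<Sum>\<^sub>\<infinity>p. cnj (f p) * g p)" .

definition norm_htensor :: "('a, 'b) htensor \<Rightarrow> real" where
  "norm_htensor x = sqrt (inner x x)"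

definition sgn_htensor :: "('a, 'b) htensor \<Rightarrow> ('a, 'b) htensor" where
  "sgn_htensor x = inverse (norm x) *\<^sub>R x"

definition dist_htensor :: "('a, 'b) htensor \<Rightarrow> ('a, 'b) htensor \<Rightarrow> real" where
  "dist_htensor x y = norm (x - y)"

definition uniformity_htensor :: "(('a, 'b) htensor \<times> ('a, 'b) htensor) filter" where
  "uniformity_htensor = (INF e\<in>{0 <..}. principal {(x, y). dist x y < e})"

definition open_htensor :: "('a, 'b) htensor set \<Rightarrow> bool" where
  "open_htensor U \<longleftrightarrow> (\<forall>x\<in>U. \<forall>\<^sub>F (x', y) in uniformity. x' = x \<longrightarrow> y \<in> U)"

lemma htensor_sq_summable: "(\<lambda>p. (cmod (Rep_htensor x p))\<^sup>2) summable_on UNIV"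
  using Rep_htensor[of x] by blast

lemma htensor_inner_self: "inner x x = (\<Sum>\<^sub>\<infinity>p. (cmod (Rep_htensor x p))\<^sup>2)"
proof -
  have "(\<Sum>\<^sub>\<infinity>p. cnj (Rep_htensor x p) * Rep_htensor x p)
      = (\<Sum>\<^sub>\<infinity>p. complex_of_real ((cmod (Rep_htensor x p))\<^sup>2))"
    by (rule infsum_cong) (metis complex_norm_square mult.commute)
  also have "\<dots> = complex_of_real (\<Sum>\<^sub>\<infinity>p. (cmod (Rep_htensor x p))\<^sup>2)"
    by (intro infsumI has_sum_of_real has_sum_infsum htensor_sq_summable)
  finally show ?thesis
    by (simp add: inner_htensor.rep_eq)
qed

instance
proof
  fix x y z :: "('a, 'b) htensor" and a b :: real and U :: "('a, 'b) htensor set"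
  show "x + y + z = x + (y + z)" by transfer (simp add: add.assoc)
  show "x + y = y + x" by transfer (simp add: add.commute)
  show "0 + x = x" by transfer simp
  show "- x + x = 0" by transfer simp
  show "x - y = x + - y" by transfer simp
  show "a *\<^sub>R (x + y) = a *\<^sub>R x + a *\<^sub>R y" by transfer (simp add: distrib_left)
  show "(a + b) *\<^sub>R x = a *\<^sub>R x + b *\<^sub>R x" by transfer (simp add: distrib_right)
  show "a *\<^sub>R b *\<^sub>R x = (a * b) *\<^sub>R x" by transfer (simp add: mult.assoc)
  show "1 *\<^sub>R x = x" by transfer simp
  show "inner x y = inner y x"
  proof transfer
    fix f g :: "'a \<times> 'b \<Rightarrow> complex"
    have "(\<Sum>\<^sub>\<infinity>p. cnj (f p) * g p) = cnj (\<Sum>\<^sub>\<infinity>p. cnj (g p) * f p)"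
      by (simp add: mult.commute flip: infsum_cnj)
    then show "Re (\<Sum>\<^sub>\<infinity>p. cnj (f p) * g p) = Re (\<Sum>\<^sub>\<infinity>p. cnj (g p) * f p)"
      by simp
  qed
  show "inner (x + y) z = inner x z + inner y z"
    by transfer (simp add: distrib_right infsum_add sq_summable_mult)
  show "inner (a *\<^sub>R x) y = a * inner x y"
    by transfer (simp add: mult.assoc infsum_cmult_right')
  show "0 \<le> inner x x"
    by (simp add: htensor_inner_self infsum_nonneg)
  show "inner x x = 0 \<longleftrightarrow> x = 0"
  proof
    assume 0: "inner x x = 0"
    have "(cmod (Rep_htensor x p))\<^sup>2 = 0" for p
      using 0 htensor_sq_summable[of x] unfolding htensor_inner_self
      by (intro nonneg_infsum_le_0D[where A = UNIV and f = "\<lambda>p. (cmod (Rep_htensor x p))\<^sup>2"]) auto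
    then have "Rep_htensor x = Rep_htensor 0"
      by (simp add: zero_htensor.rep_eq fun_eq_iff)
    then show "x = 0"
      by (simp add: Rep_htensor_inject)
  next
    assume "x = 0"
    then show "inner x x = 0"
      unfolding htensor_inner_self by (simp add: zero_htensor.rep_eq)
  qed
  show "norm x = sqrt (inner x x)" by (rule norm_htensor_def)
  show "dist x y = norm (x - y)" by (rule dist_htensor_def)
  show "sgn x = inverse (norm x) *\<^sub>R x" by (rule sgn_htensor_def)
  show "(uniformity :: (('a, 'b) htensor \<times> ('a, 'b) htensor) filter)
      = (INF e\<in>{0 <..}. principal {(x, y). dist x y < e})"
    by (rule uniformity_htensor_def)
  show "open U \<longleftrightarrow> (\<forall>x\<in>U. \<forall>\<^sub>F (x', y) in uniformity. x' = x \<longrightarrow> y \<in> U)"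
    by (rule open_htensor_def)
qed

end

lemma htensor_norm_sq:
  fixes x :: "('a::chilbert_space, 'b::chilbert_space) htensor"
  shows "(norm x)\<^sup>2 = (\<Sum>\<^sub>\<infinity>p. (cmod (Rep_htensor x p))\<^sup>2)"
  using htensor_inner_self[of x] by (simp only: power2_norm_eq_inner[of x])

lemma htensor_sum_le_norm_sq:
  fixes x :: "('a::chilbert_space, 'b::chilbert_space) htensor"
  shows "finite F \<Longrightarrow> (\<Sum>p\<in>F. (cmod (Rep_htensor x p))\<^sup>2) \<le> (norm x)\<^sup>2"
  unfolding htensor_norm_sq by (rule finite_sum_le_infsum[OF htensor_sq_summable]) auto

lemma htensor_Cauchy_convergent:
  fixes X :: "nat \<Rightarrow> ('a::chilbert_space, 'b::chilbert_space) htensor"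
  assumes "Cauchy X"
  shows "convergent X"
proof -
  define f where "f n p = Rep_htensor (X n) p" for n p
  have le: "(\<Sum>p\<in>F. (cmod (f m p - f n p))\<^sup>2) \<le> (norm (X m - X n))\<^sup>2" if "finite F" for F m n
    using htensor_sum_le_norm_sq[OF that, of "X m - X n"] by (simp add: f_def minus_htensor.rep_eq)
  have coord: "cmod (f m p - f n p) \<le> norm (X m - X n)" for m n p
  proof (rule power2_le_imp_le)
    show "(cmod (f m p - f n p))\<^sup>2 \<le> (norm (X m - X n))\<^sup>2"
      using le[of "{p}" m n] by simp
  qed simp
  have "Cauchy (\<lambda>n. f n p)" for p
  proof (rule CauchyI)
    fix e :: real assume "e > 0"
    then obtain M where "\<And>m n. m \<ge> M \<Longrightarrow> n \<ge> M \<Longrightarrow> norm (X m - X n) < e"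
      using assms CauchyD by blast
    then show "\<exists>M. \<forall>m\<ge>M. \<forall>n\<ge>M. norm (f m p - f n p) < e"
      using coord by (meson le_less_trans)
  qed
  then have "\<exists>l. (\<lambda>n. f n p) \<longlonglongrightarrow> l" for p
    by (simp add: Cauchy_convergent convergentD)
  then obtain g where g: "\<And>p. (\<lambda>n. f n p) \<longlonglongrightarrow> g p"
    by metis
  have tail: "(\<Sum>p\<in>F. (cmod (g p - f n p))\<^sup>2) \<le> e\<^sup>2"
    if "finite F" "n \<ge> M" "\<And>m n. m \<ge> M \<Longrightarrow> n \<ge> M \<Longrightarrow> norm (X m - X n) < e" for F n M e
  proof (rule LIMSEQ_le_const2)
    show "(\<lambda>m. \<Sum>p\<in>F. (cmod (f m p - f n p))\<^sup>2) \<longlonglongrightarrow> (\<Sum>p\<in>F. (cmod (g p - f n p))\<^sup>2)"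
      by (intro tendsto_intros g)
    have "(\<Sum>p\<in>F. (cmod (f m p - f n p))\<^sup>2) \<le> e\<^sup>2" if "m \<ge> M" for m
      using le[OF \<open>finite F\<close>, of m n] power_mono[of "norm (X m - X n)" e 2] that \<open>n \<ge> M\<close>
        \<open>\<And>m n. m \<ge> M \<Longrightarrow> n \<ge> M \<Longrightarrow> norm (X m - X n) < e\<close>[of m n] by auto
    then show "\<exists>N. \<forall>m\<ge>N. (\<Sum>p\<in>F. (cmod (f m p - f n p))\<^sup>2) \<le> e\<^sup>2"
      by blast
  qed
  have summ: "(\<lambda>p. (cmod (g p - f n p))\<^sup>2) summable_on UNIV"
    if "n \<ge> M" "\<And>m n. m \<ge> M \<Longrightarrow> n \<ge> M \<Longrightarrow> norm (X m - X n) < e" for n M e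
    by (rule nonneg_bdd_above_summable_on) (auto intro!: bdd_aboveI2[where M = "e\<^sup>2"] tail[OF _ that])
  obtain M where M: "\<And>m n. m \<ge> M \<Longrightarrow> n \<ge> M \<Longrightarrow> norm (X m - X n) < 1"
    using CauchyD[OF assms, of 1] by auto
  have "(\<lambda>p. (cmod (f M p))\<^sup>2) summable_on UNIV"
    unfolding f_def by (rule htensor_sq_summable)
  from sq_summable_add[OF summ[of M M 1, OF order.refl M] this]
  have "(\<lambda>p. (cmod (g p))\<^sup>2) summable_on UNIV"
    by simp
  moreover have "g p = 0" if "p \<notin> onb \<times> onb" for p
  proof -
    have "f n p = 0" for n
      using Rep_htensor[of "X n"] that unfolding f_def by blast
    then show ?thesis
      using LIMSEQ_unique[OF g[of p], of 0] by simp
  qed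
  ultimately have Rep_L: "Rep_htensor (Abs_htensor g) = g"
    by (intro Abs_htensor_inverse) blast
  have "X \<longlonglongrightarrow> Abs_htensor g"
  proof (rule LIMSEQ_I)
    fix e :: real assume "e > 0"
    then obtain M where M: "\<And>m n. m \<ge> M \<Longrightarrow> n \<ge> M \<Longrightarrow> norm (X m - X n) < e / 2"
      using CauchyD[OF assms, of "e / 2"] by auto
    have "norm (X n - Abs_htensor g) < e" if "n \<ge> M" for n
    proof -
      have "(norm (Abs_htensor g - X n))\<^sup>2 = (\<Sum>\<^sub>\<infinity>p. (cmod (g p - f n p))\<^sup>2)"
        unfolding htensor_norm_sq by (simp add: minus_htensor.rep_eq Rep_L f_def)
      also have "\<dots> \<le> (e / 2)\<^sup>2"
        by (rule infsum_le_finite_sums[OF summ[OF that M] tail[OF _ that M]])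
      finally have "norm (Abs_htensor g - X n) \<le> e / 2"
        by (rule power2_le_imp_le) (use \<open>e > 0\<close> in simp)
      then show ?thesis
        using \<open>e > 0\<close> by (simp add: norm_minus_commute)
    qed
    then show "\<exists>M. \<forall>n\<ge>M. norm (X n - Abs_htensor g) < e"
      by blast
  qed
  then show ?thesis
    by (rule convergentI)
qed

instantiation htensor :: (chilbert_space, chilbert_space) chilbert_space
begin

lift_definition scaleC_htensor :: "complex \<Rightarrow> ('a, 'b) htensor \<Rightarrow> ('a, 'b) htensor"
  is "\<lambda>c f p. c * f p"
  by (auto intro: sq_summable_scale simp del: norm_mult)

lift_definition cinner_htensor :: "('a, 'b) htensor \<Rightarrow> ('a, 'b) htensor \<Rightarrow> complex"
  is "\<lambda>f g. \<Sum>\<^sub>\<infinity>p. cnj (f p) * g p" .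

instance
proof
  fix x y z :: "('a, 'b) htensor" and r :: real and c d :: complex
  show "c *\<^sub>C (x + y) = c *\<^sub>C x + c *\<^sub>C y" by transfer (simp add: distrib_left)
  show "(c + d) *\<^sub>C x = c *\<^sub>C x + d *\<^sub>C x" by transfer (simp add: distrib_right)
  show "c *\<^sub>C d *\<^sub>C x = (c * d) *\<^sub>C x" by transfer (simp add: mult.assoc)
  show "complex_of_real r *\<^sub>C x = r *\<^sub>R x" by transfer simp
  show "cinner x (y + z) = cinner x y + cinner x z"
    by transfer (simp add: distrib_left infsum_add sq_summable_mult)
  show "cinner x (c *\<^sub>C y) = c * cinner x y"
    by transfer (simp add: mult.left_commute infsum_cmult_right')
  show "cinner x y = cnj (cinner y x)"
    by transfer (simp add: mult.commute flip: infsum_cnj)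
  show "inner x y = Re (cinner x y)" by transfer simp
  show "convergent X" if "Cauchy X" for X :: "nat \<Rightarrow> ('a, 'b) htensor"
    using that by (rule htensor_Cauchy_convergent)
qed

end


lemma bounded_linear_cinner: "bounded_linear (cinner (y::'a::chilbert_space))"
  by (rule bounded_linear_intro[where K = "norm y"])
    (simp_all add: cinner_add_right cinner_scaleR_right scaleR_conv_of_real
      cinner_cauchy_schwarz mult.commute[of _ "norm y"])

lemma bounded_linear_scaleC: "bounded_linear (\<lambda>x::'a::chilbert_space. c *\<^sub>C x)"
  by (rule bounded_linear_intro[where K = "cmod c"])
    (simp_all add: scaleC_add_right norm_scaleC mult.commute scaleC_scaleC flip: scaleC_of_real)

lemma orthonormal_subset: "orthonormal B \<Longrightarrow> F \<subseteq> B \<Longrightarrow> orthonormal F"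
  unfolding orthonormal_def by blast

lemma cinner_orthonormal_sum:
  assumes "orthonormal B" "finite F" "F \<subseteq> B" "e \<in> B"
  shows "cinner e (\<Sum>e\<in>F. c e *\<^sub>C e) = (if e \<in> F then c e else 0)"
proof -
  have "cinner e (\<Sum>e\<in>F. c e *\<^sub>C e) = (\<Sum>d\<in>F. if e = d then c d else 0)"
    unfolding cinner_sum_right
    by (rule sum.cong) (use assms in \<open>auto simp: cinner_scaleC_right orthonormal_def subset_eq\<close>)
  then show ?thesis
    using assms by simp
qed

lemma norm_sq_orthonormal_sum:
  assumes "orthonormal F" "finite F"
  shows "(norm (\<Sum>e\<in>F. c e *\<^sub>C e))\<^sup>2 = (\<Sum>e\<in>F. (cmod (c e))\<^sup>2)"
proof -
  have "complex_of_real ((norm (\<Sum>e\<in>F. c e *\<^sub>C e))\<^sup>2) = (\<Sum>d\<in>F. cnj (c d) * c d)"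
    unfolding cinner_self[symmetric] cinner_sum_left
    by (rule sum.cong)
      (use assms in \<open>auto simp: cinner_scaleC_left cinner_orthonormal_sum[OF assms(1,2) subset_refl]\<close>)
  also have "\<dots> = complex_of_real (\<Sum>e\<in>F. (cmod (c e))\<^sup>2)"
    unfolding of_real_sum by (rule sum.cong) (metis complex_norm_square mult.commute)+
  finally show ?thesis
    using of_real_eq_iff by blast
qed

lemma bessel_inequality:
  assumes "orthonormal F" "finite F"
  shows "(\<Sum>e\<in>F. (cmod (cinner e x))\<^sup>2) \<le> (norm x)\<^sup>2"
proof -
  define s where "s = (\<Sum>e\<in>F. cinner e x *\<^sub>C e)"
  have s: "(norm s)\<^sup>2 = (\<Sum>e\<in>F. (cmod (cinner e x))\<^sup>2)"
    unfolding s_def by (rule norm_sq_orthonormal_sum[OF assms])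
  have "cinner s (x - s) = (\<Sum>e\<in>F. cnj (cinner e x) * (cinner e x - cinner e s))"
    unfolding s_def cinner_sum_left cinner_scaleC_left cinner_diff_right[symmetric] ..
  also have "\<dots> = 0"
    unfolding s_def by (rule sum.neutral) (simp add: cinner_orthonormal_sum[OF assms subset_refl])
  finally have "inner s (x - s) = 0"
    by (simp add: inner_eq_Re_cinner)
  then have "(norm x)\<^sup>2 = (norm s)\<^sup>2 + (norm (x - s))\<^sup>2"
    by (simp add: power2_norm_eq_inner inner_diff_left inner_diff_right inner_commute)
  then show ?thesis
    using s by simp
qed

lemma orthonormal_has_sum:
  fixes c :: "'a::chilbert_space \<Rightarrow> complex"
  assumes B: "orthonormal B" and sq: "(\<lambda>e. (cmod (c e))\<^sup>2) summable_on B"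
  shows "\<exists>w. ((\<lambda>e. c e *\<^sub>C e) has_sum w) B"
proof -
  define q where "q F = (\<Sum>e\<in>F. (cmod (c e))\<^sup>2)" for F
  define t where "t F = (\<Sum>e\<in>F. c e *\<^sub>C e)" for F
  define S where "S = (\<Sum>\<^sub>\<infinity>e\<in>B. (cmod (c e))\<^sup>2)"
  define r :: "nat \<Rightarrow> real" where "r n = inverse (real (Suc n))" for n
  have r_pos: "r n > 0" for n
    by (simp add: r_def)
  have "\<exists>F. finite F \<and> F \<subseteq> B \<and> dist (q F) S \<le> (r n)\<^sup>2" for n
    unfolding q_def S_def
    by (rule has_sum_finite_approximation[OF has_sum_infsum[OF sq]]) (use r_pos[of n] in simp)
  then obtain F where F: "\<And>n. finite (F n)" "\<And>n. F n \<subseteq> B" "\<And>n. dist (q (F n)) S \<le> (r n)\<^sup>2"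
    by metis
  define G where "G n = (\<Union>k\<le>n. F k)" for n
  have G: "finite (G n)" "G n \<subseteq> B" "F n \<subseteq> G n" for n
    using F by (auto simp: G_def)
  have G_mono: "G n \<subseteq> G m" if "n \<le> m" for n m
    unfolding G_def using that by (intro UN_mono) auto
  have near: "norm (t E - t (G n)) \<le> r n" if "finite E" "G n \<subseteq> E" "E \<subseteq> B" for E n
  proof -
    have "t E - t (G n) = t (E - G n)"
      unfolding t_def using that by (simp add: sum_diff)
    then have "(norm (t E - t (G n)))\<^sup>2 = q (E - G n)"
      unfolding t_def q_def using that B
      by (simp add: norm_sq_orthonormal_sum orthonormal_subset[OF B] subset_eq)
    also have "\<dots> = q E - q (G n)"
      unfolding q_def using that by (simp add: sum_diff)
    also have "\<dots> \<le> S - q (F n)"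
    proof (rule diff_mono)
      show "q E \<le> S"
        unfolding q_def S_def using that by (intro finite_sum_le_infsum[OF sq]) auto
      show "q (F n) \<le> q (G n)"
        unfolding q_def using G by (intro sum_mono2) auto
    qed
    also have "\<dots> \<le> (r n)\<^sup>2"
      using F(3)[of n] by (simp add: dist_real_def)
    finally show ?thesis
      by (rule power2_le_imp_le) (simp add: r_pos less_imp_le)
  qed
  have r0: "r \<longlonglongrightarrow> 0"
    unfolding r_def by (rule LIMSEQ_inverse_real_of_nat)
  have "Cauchy (\<lambda>n. t (G n))"
  proof (rule CauchyI')
    fix e :: real assume "e > 0"
    then obtain M where M: "r M < e / 2"
      using reals_Archimedean[of "e / 2"] unfolding r_def by auto
    have "dist (t (G m)) (t (G n)) < e" if "m \<ge> M" "n > m" for m n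
    proof -
      have "norm (t (G m) - t (G M)) \<le> r M" "norm (t (G n) - t (G M)) \<le> r M"
        using near[OF G(1) G_mono G(2)] that by auto
      then show ?thesis
        using M norm_triangle_ineq4[of "t (G m) - t (G M)" "t (G n) - t (G M)"]
        by (simp add: dist_norm)
    qed
    then show "\<exists>M. \<forall>m\<ge>M. \<forall>n>m. dist (t (G m)) (t (G n)) < e"
      by blast
  qed
  then obtain w where w: "(\<lambda>n. t (G n)) \<longlonglongrightarrow> w"
    using Cauchy_convergent convergent_def by blast
  have "(t \<longlongrightarrow> w) (finite_subsets_at_top B)"
  proof (rule tendstoI)
    fix e :: real assume "e > 0"
    then obtain M where M: "\<And>n. n \<ge> M \<Longrightarrow> norm (t (G n) - w) < e / 2"
      using LIMSEQ_D[OF w, of "e / 2"] by auto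
    obtain N where N: "r n < e / 2" if "n \<ge> N" for n
      using LIMSEQ_D[OF r0, of "e / 2"] \<open>e > 0\<close> r_pos by fastforce
    define n where "n = max M N"
    have "dist (t E) w < e" if "finite E" "G n \<subseteq> E" "E \<subseteq> B" for E
      using near[OF that] M[of n] N[of n] norm_triangle_ineq[of "t E - t (G n)" "t (G n) - w"]
      by (simp add: n_def dist_norm)
    then show "\<forall>\<^sub>F E in finite_subsets_at_top B. dist (t E) w < e"
      unfolding eventually_finite_subsets_at_top using G[of n] by blast
  qed
  then show ?thesis
    unfolding has_sum_def t_def by blast
qed

lemma cinner_has_sum:
  assumes B: "orthonormal B" and w: "((\<lambda>e. c e *\<^sub>C e) has_sum w) B" and e: "e \<in> B"
  shows "cinner e w = c e"
proof -
  have 1: "((\<lambda>d. cinner e (c d *\<^sub>C d)) has_sum cinner e w) B"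
    by (rule has_sum_bounded_linear[OF bounded_linear_cinner w])
  have "((\<lambda>d. cinner e (c d *\<^sub>C d)) has_sum cinner e w) B
      \<longleftrightarrow> ((\<lambda>d. c d) has_sum cinner e w) {e}"
    by (rule has_sum_cong_neutral) (use B e in \<open>auto simp: cinner_scaleC_right orthonormal_def\<close>)
  with 1 have "((\<lambda>d. c d) has_sum cinner e w) {e}"
    by blast
  then show ?thesis
    using has_sum_unique has_sum_finite[of "{e}" c] by fastforce
qed

lemma bessel_summable:
  assumes "orthonormal B"
  shows "(\<lambda>e. (cmod (cinner e x))\<^sup>2) summable_on B"
proof (rule nonneg_bdd_above_summable_on)
  show "bdd_above (sum (\<lambda>e. (cmod (cinner e x))\<^sup>2) ` {F. F \<subseteq> B \<and> finite F})"
    by (rule bdd_aboveI2[where M = "(norm x)\<^sup>2"])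
      (use assms in \<open>auto intro: bessel_inequality orthonormal_subset\<close>)
qed simp

lemma onb_expansion:
  assumes B: "is_onb B"
  shows "((\<lambda>e. cinner e x *\<^sub>C e) has_sum x) B"
proof -
  have ON: "orthonormal B"
    using B unfolding is_onb_def by blast
  obtain w where w: "((\<lambda>e. cinner e x *\<^sub>C e) has_sum w) B"
    using orthonormal_has_sum[OF ON bessel_summable[OF ON]] by blast
  have "cinner e (x - w) = 0" if "e \<in> B" for e
    using cinner_has_sum[OF ON w that] by (simp add: cinner_diff_right)
  then have "x - w = 0"
    using B unfolding is_onb_def by blast
  then show ?thesis
    using w by simp
qed

lemma parseval:
  assumes "is_onb B"
  shows "((\<lambda>e. cnj (cinner e x) * cinner e y) has_sum cinner x y) B"
proof -
  have "((\<lambda>e. cinner x (cinner e y *\<^sub>C e)) has_sum cinner x y) B"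
    by (rule has_sum_bounded_linear[OF bounded_linear_cinner onb_expansion[OF assms]])
  moreover have "cinner x (cinner e y *\<^sub>C e) = cnj (cinner e x) * cinner e y" for e
    using cinner_commute[of x e] by (simp add: cinner_scaleC_right)
  ultimately show ?thesis
    by simp
qed

lemma closure_span_onb:
  assumes "is_onb B"
  shows "closure (span {c *\<^sub>C e |c e. e \<in> B}) = UNIV"
proof -
  have "x \<in> closure (span {c *\<^sub>C e |c e. e \<in> B})" for x
  proof (rule Lim_in_closed_set[OF closed_closure])
    show "(sum (\<lambda>e. cinner e x *\<^sub>C e) \<longlongrightarrow> x) (finite_subsets_at_top B)"
      using onb_expansion[OF assms, of x] unfolding has_sum_def .
    show "\<forall>\<^sub>F F in finite_subsets_at_top B.
        (\<Sum>e\<in>F. cinner e x *\<^sub>C e) \<in> closure (span {c *\<^sub>C e |c e. e \<in> B})"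
      by (intro eventually_finite_subsets_at_top_weakI subsetD[OF closure_subset] span_sum span_base) auto
  qed simp
  then show ?thesis
    by blast
qed

lift_definition tensor_vec :: "'a::chilbert_space \<Rightarrow> 'b::chilbert_space \<Rightarrow> ('a, 'b) htensor"
  is "\<lambda>x y (e, f). if e \<in> onb \<and> f \<in> onb then cinner e x * cinner f y else 0"
proof -
  fix x :: 'a and y :: 'b
  let ?h = "\<lambda>p. (cmod (case p of (e, f) \<Rightarrow>
      if e \<in> onb \<and> f \<in> onb then cinner e x * cinner f y else 0))\<^sup>2"
  have "?h summable_on UNIV"
  proof (rule nonneg_bdd_above_summable_on)
    show "bdd_above (sum ?h ` {F. F \<subseteq> UNIV \<and> finite F})"
    proof (rule bdd_aboveI2)
      fix F :: "('a \<times> 'b) set" assume "F \<in> {F. F \<subseteq> UNIV \<and> finite F}"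
      then have fin: "finite F"
        by simp
      let ?E = "fst ` F \<inter> onb" and ?F = "snd ` F \<inter> onb"
      have "sum ?h F = sum ?h (F \<inter> onb \<times> onb)"
        by (rule sum.mono_neutral_right) (use fin in \<open>auto split: if_splits\<close>)
      also have "\<dots> \<le> sum ?h (?E \<times> ?F)"
        by (rule sum_mono2) (use fin in \<open>auto intro: rev_image_eqI\<close>)
      also have "\<dots> = (\<Sum>e\<in>?E. \<Sum>f\<in>?F. (cmod (cinner e x))\<^sup>2 * (cmod (cinner f y))\<^sup>2)"
        unfolding sum.cartesian_product
        by (rule sum.cong) (auto simp: norm_mult power_mult_distrib)
      also have "\<dots> = (\<Sum>e\<in>?E. (cmod (cinner e x))\<^sup>2) * (\<Sum>f\<in>?F. (cmod (cinner f y))\<^sup>2)"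
        by (rule sum_product[symmetric])
      also have "\<dots> \<le> (norm x)\<^sup>2 * (norm y)\<^sup>2"
        using fin
        by (intro mult_mono bessel_inequality sum_nonneg)
          (auto intro: orthonormal_subset[OF orthonormal_onb])
      finally show "sum ?h F \<le> (norm x)\<^sup>2 * (norm y)\<^sup>2" .
    qed
  qed simp
  then show "(\<forall>p. p \<notin> onb \<times> onb \<longrightarrow>
      (case p of (e, f) \<Rightarrow> if e \<in> onb \<and> f \<in> onb then cinner e x * cinner f y else 0) = 0)
    \<and> ?h summable_on UNIV"
    by (intro conjI allI impI) (auto split: prod.splits)
qed

lemma cinner_tensor_vec:
  "cinner (tensor_vec x y) (tensor_vec x' y') = cinner x x' * cinner y y'"
proof -
  let ?r = "Rep_htensor (tensor_vec x y)" and ?s = "Rep_htensor (tensor_vec x' y')"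
  have r: "?r (e, f) = (if e \<in> onb \<and> f \<in> onb then cinner e x * cinner f y else 0)" for e f
    by (simp add: tensor_vec.rep_eq)
  have s: "?s (e, f) = (if e \<in> onb \<and> f \<in> onb then cinner e x' * cinner f y' else 0)" for e f
    by (simp add: tensor_vec.rep_eq)
  let ?g = "\<lambda>p. cnj (?r p) * ?s p"
  have summ: "?g summable_on UNIV"
    by (rule sq_summable_mult) (rule htensor_sq_summable)+
  then have summ': "?g summable_on (onb \<times> onb)"
    by (rule summable_on_subset_banach) simp
  have "cinner (tensor_vec x y) (tensor_vec x' y') = (\<Sum>\<^sub>\<infinity>p. ?g p)"
    by (rule cinner_htensor.rep_eq)
  also have "\<dots> = (\<Sum>\<^sub>\<infinity>p\<in>onb \<times> onb. ?g p)"
    by (rule infsum_cong_neutral) (auto simp: r split: if_splits)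
  also have "\<dots> = (\<Sum>\<^sub>\<infinity>e\<in>onb. \<Sum>\<^sub>\<infinity>f\<in>onb. ?g (e, f))"
    by (rule infsum_Sigma_banach[symmetric]) (rule summ')
  also have "\<dots> = (\<Sum>\<^sub>\<infinity>e\<in>onb. (cnj (cinner e x) * cinner e x') * cinner y y')"
  proof (rule infsum_cong)
    fix e :: 'a assume e: "e \<in> onb"
    have "(\<Sum>\<^sub>\<infinity>f\<in>onb. ?g (e, f))
        = (\<Sum>\<^sub>\<infinity>f\<in>onb. (cnj (cinner e x) * cinner e x') * (cnj (cinner f y) * cinner f y'))"
      by (rule infsum_cong) (simp add: r s e)
    also have "\<dots> = (cnj (cinner e x) * cinner e x') * cinner y y'"
      by (intro infsumI has_sum_cmult_right parseval is_onb_onb)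
    finally show "(\<Sum>\<^sub>\<infinity>f\<in>onb. ?g (e, f)) = (cnj (cinner e x) * cinner e x') * cinner y y'" .
  qed
  also have "\<dots> = cinner x x' * cinner y y'"
    by (intro infsumI has_sum_cmult_left parseval is_onb_onb)
  finally show ?thesis .
qed

lemma tensor_vec_add_left: "tensor_vec (x + x') y = tensor_vec x y + tensor_vec x' y"
  by transfer (auto simp: cinner_add_right distrib_right)

lemma tensor_vec_add_right: "tensor_vec x (y + y') = tensor_vec x y + tensor_vec x y'"
  by transfer (auto simp: cinner_add_right distrib_left)

lemma tensor_vec_scaleC_left: "tensor_vec (c *\<^sub>C x) y = c *\<^sub>C tensor_vec x y"
  by transfer (auto simp: cinner_scaleC_right mult.assoc)

lemma tensor_vec_scaleC_right: "tensor_vec x (c *\<^sub>C y) = c *\<^sub>C tensor_vec x y"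
  by transfer (auto simp: cinner_scaleC_right mult.left_commute)

lemma cinner_tensor_vec_onb:
  assumes "e \<in> onb" "f \<in> onb"
  shows "cinner (tensor_vec e f) z = Rep_htensor z (e, f)"
proof -
  have r: "Rep_htensor (tensor_vec e f) p = (if p = (e, f) then 1 else 0)" for p
    using assms by (cases p) (auto simp: tensor_vec.rep_eq cinner_onb)
  have "cinner (tensor_vec e f) z = (\<Sum>\<^sub>\<infinity>p. cnj (Rep_htensor (tensor_vec e f) p) * Rep_htensor z p)"
    by (rule cinner_htensor.rep_eq)
  also have "\<dots> = (\<Sum>\<^sub>\<infinity>p\<in>{(e, f)}. Rep_htensor z p)"
    by (rule infsum_cong_neutral) (auto simp: r)
  finally show ?thesis
    by simp
qed

lemma is_onb_tensor_vec: "is_onb {tensor_vec e f |e f. e \<in> onb \<and> f \<in> onb}"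
  unfolding is_onb_def orthonormal_def
proof (intro conjI allI impI ballI)
  fix z w :: "('a, 'b) htensor"
  assume "z \<in> {tensor_vec e f |e f. e \<in> onb \<and> f \<in> onb}" "w \<in> {tensor_vec e f |e f. e \<in> onb \<and> f \<in> onb}"
  then obtain e f e' f' where zw: "z = tensor_vec e f" "w = tensor_vec e' f'"
    "e \<in> onb" "f \<in> onb" "e' \<in> onb" "f' \<in> onb"
    by blast
  have "cinner z w = (if e = e' \<and> f = f' then 1 else 0)"
    using zw by (simp add: cinner_tensor_vec cinner_onb)
  moreover have "z = w \<longleftrightarrow> e = e' \<and> f = f'"
  proof
    assume "z = w"
    moreover have "cinner z z = 1"
      using zw by (simp add: cinner_tensor_vec cinner_onb)
    ultimately show "e = e' \<and> f = f'"
      using \<open>cinner z w = _\<close> by (auto split: if_splits)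
  qed (simp add: zw)
  ultimately show "cinner z w = (if z = w then 1 else 0)"
    by simp
next
  fix z :: "('a, 'b) htensor"
  assume 0: "\<forall>t\<in>{tensor_vec e f |e f. e \<in> onb \<and> f \<in> onb}. cinner t z = 0"
  have "Rep_htensor z p = Rep_htensor 0 p" for p
  proof (cases "p \<in> onb \<times> onb")
    case True
    then show ?thesis
      using 0 cinner_tensor_vec_onb[of "fst p" "snd p" z]
      by (cases p) (force simp: zero_htensor.rep_eq)
  next
    case False
    then show ?thesis
      using Rep_htensor[of z] by (cases p) (auto simp: zero_htensor.rep_eq)
  qed
  then show "z = 0"
    by (simp add: Rep_htensor_inject[symmetric] fun_eq_iff)
qed

lemma closure_span_tensor_vec: "closure (span {tensor_vec x y |x y. True}) = UNIV"
proof -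
  have "{c *\<^sub>C t |c t. t \<in> {tensor_vec e f |e f. e \<in> onb \<and> f \<in> onb}} \<subseteq> {tensor_vec x y |x y. True}"
    by (auto simp flip: tensor_vec_scaleC_left) blast
  from closure_mono[OF span_mono[OF this]] show ?thesis
    unfolding closure_span_onb[OF is_onb_tensor_vec] by blast
qed


type_synonym 'h op = "'h \<Rightarrow>\<^sub>L 'h"

text \<open>
  The library's bounded linear functions are only real linear; \<open>bounded_ops\<close> is
  \<open>L(H)\<close>, the algebra of the complex linear ones.
\<close>

definition bounded_ops :: "'h::chilbert_space op set" where
  "bounded_ops = {T. \<forall>c x. blinfun_apply T (c *\<^sub>C x) = c *\<^sub>C blinfun_apply T x}"

definition scale_op :: "complex \<Rightarrow> 'h::chilbert_space op \<Rightarrow> 'h op" where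
  "scale_op c T = Blinfun (\<lambda>x. c *\<^sub>C blinfun_apply T x)"

lemma scale_op_apply: "blinfun_apply (scale_op c T) x = c *\<^sub>C blinfun_apply T x"
  unfolding scale_op_def
  by (simp add: bounded_linear_Blinfun_apply
      bounded_linear_compose[OF bounded_linear_scaleC blinfun.bounded_linear_right])

definition adjoint_op :: "'h::chilbert_space op \<Rightarrow> 'h op" where
  "adjoint_op T = (THE S. \<forall>x y. cinner (blinfun_apply S x) y = cinner x (blinfun_apply T y))"

definition tensor_op ::
  "'h::chilbert_space op \<Rightarrow> 'k::chilbert_space op \<Rightarrow> ('h, 'k) htensor op" where
  "tensor_op S T = (THE R. R \<in> bounded_ops \<and>
     (\<forall>x y. blinfun_apply R (tensor_vec x y) = tensor_vec (blinfun_apply S x) (blinfun_apply T y)))"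

definition is_projection :: "'h::chilbert_space op \<Rightarrow> bool" where
  "is_projection P \<longleftrightarrow> P \<in> bounded_ops \<and> P o\<^sub>L P = P \<and> adjoint_op P = P"

definition projection_le :: "'h::chilbert_space op \<Rightarrow> 'h op \<Rightarrow> bool" where
  "projection_le P Q \<longleftrightarrow> Q o\<^sub>L P = P"

definition commutant :: "'h::chilbert_space op set \<Rightarrow> 'h op set" where
  "commutant X = {T \<in> bounded_ops. \<forall>S\<in>X. T o\<^sub>L S = S o\<^sub>L T}"

definition bicommutant :: "'h::chilbert_space op set \<Rightarrow> 'h op set" where
  "bicommutant X = commutant (commutant X)"

text \<open>
  The von Neumann algebra generated by the elementary tensors, by the bicommutant theorem.
\<close>

definition vn_tensor ::
  "'h::chilbert_space op set \<Rightarrow> 'k::chilbert_space op set \<Rightarrow> ('h, 'k) htensor op set" where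
  "vn_tensor M N = bicommutant {tensor_op S T |S T. S \<in> M \<and> T \<in> N}"

definition minimal_projection :: "'h::chilbert_space op set \<Rightarrow> 'h op \<Rightarrow> bool" where
  "minimal_projection M p \<longleftrightarrow> p \<in> M \<and> is_projection p \<and> p \<noteq> 0 \<and>
     (\<forall>q\<in>M. is_projection q \<and> projection_le q p \<longrightarrow> q = 0 \<or> q = p)"

text \<open>
  The supremum is taken in the lattice of projections of the von Neumann algebra \<open>M\<close>.
\<close>

definition projection_Sup :: "'h::chilbert_space op set \<Rightarrow> 'h op set \<Rightarrow> 'h op" where
  "projection_Sup M Q = (THE P.
     (P \<in> M \<and> is_projection P \<and> (\<forall>q\<in>Q. projection_le q P)) \<and>
     (\<forall>P'. P' \<in> M \<and> is_projection P' \<and> (\<forall>q\<in>Q. projection_le q P') \<longrightarrow> projection_le P P'))"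

record 'a cstar = "(complex, 'a) module" +
  star :: "'a \<Rightarrow> 'a"
  cnorm :: "'a \<Rightarrow> real"

definition complex_field :: "complex ring" where
  "complex_field = \<lparr>carrier = UNIV, mult = (*), one = 1, zero = 0, add = (+)\<rparr>"

locale unital_cstar_algebra = ring A + scalars: module complex_field A
  for A :: "'a cstar" (structure) +
  assumes smult_mult_left:
      "x \<in> carrier A \<Longrightarrow> y \<in> carrier A \<Longrightarrow> (c \<odot> x) \<otimes> y = c \<odot> (x \<otimes> y)"
    and smult_mult_right:
      "x \<in> carrier A \<Longrightarrow> y \<in> carrier A \<Longrightarrow> x \<otimes> (c \<odot> y) = c \<odot> (x \<otimes> y)"
    and star_closed: "x \<in> carrier A \<Longrightarrow> star A x \<in> carrier A"
    and star_star: "x \<in> carrier A \<Longrightarrow> star A (star A x) = x"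
    and star_add:
      "x \<in> carrier A \<Longrightarrow> y \<in> carrier A \<Longrightarrow> star A (x \<oplus> y) = star A x \<oplus> star A y"
    and star_smult: "x \<in> carrier A \<Longrightarrow> star A (c \<odot> x) = cnj c \<odot> star A x"
    and star_mult:
      "x \<in> carrier A \<Longrightarrow> y \<in> carrier A \<Longrightarrow> star A (x \<otimes> y) = star A y \<otimes> star A x"
    and cnorm_eq_zero: "x \<in> carrier A \<Longrightarrow> cnorm A x = 0 \<longleftrightarrow> x = \<zero>"
    and cnorm_triangle:
      "x \<in> carrier A \<Longrightarrow> y \<in> carrier A \<Longrightarrow> cnorm A (x \<oplus> y) \<le> cnorm A x + cnorm A y"
    and cnorm_smult: "x \<in> carrier A \<Longrightarrow> cnorm A (c \<odot> x) = cmod c * cnorm A x"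
    and cnorm_mult:
      "x \<in> carrier A \<Longrightarrow> y \<in> carrier A \<Longrightarrow> cnorm A (x \<otimes> y) \<le> cnorm A x * cnorm A y"
    and cstar_identity: "x \<in> carrier A \<Longrightarrow> cnorm A (star A x \<otimes> x) = (cnorm A x)\<^sup>2"
    and cnorm_complete:
      "(\<And>n. X n \<in> carrier A) \<Longrightarrow>
       (\<And>e. e > 0 \<Longrightarrow> \<exists>N. \<forall>m\<ge>N. \<forall>n\<ge>N. cnorm A (X m \<ominus> X n) < e) \<Longrightarrow>
       \<exists>x\<in>carrier A. (\<lambda>n. cnorm A (X n \<ominus> x)) \<longlonglongrightarrow> 0"

definition spectrum :: "'a cstar \<Rightarrow> 'a \<Rightarrow> complex set" where
  "spectrum A a = {l. l \<odot>\<^bsub>A\<^esub> \<one>\<^bsub>A\<^esub> \<ominus>\<^bsub>A\<^esub> a \<notin> Units A}"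

definition positive_in :: "'a cstar \<Rightarrow> 'a \<Rightarrow> bool" where
  "positive_in A a \<longleftrightarrow> a \<in> carrier A \<and> star A a = a \<and> spectrum A a \<subseteq> \<real>\<^sub>\<ge>\<^sub>0"

definition le_in :: "'a cstar \<Rightarrow> 'a \<Rightarrow> 'a \<Rightarrow> bool" where
  "le_in A a b \<longleftrightarrow> a \<in> carrier A \<and> b \<in> carrier A \<and> positive_in A (b \<ominus>\<^bsub>A\<^esub> a)"

definition star_hom :: "'a cstar \<Rightarrow> 'b cstar \<Rightarrow> ('a \<Rightarrow> 'b) set" where
  "star_hom A B = {f \<in> ring_hom A B.
     (\<forall>c. \<forall>a\<in>carrier A. f (c \<odot>\<^bsub>A\<^esub> a) = c \<odot>\<^bsub>B\<^esub> f a) \<and>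
     (\<forall>a\<in>carrier A. f (star A a) = star B (f a))}"

text \<open>
  The *-homomorphism with prescribed values on a set of generators, made unique as a function by
  being \<open>undefined\<close> outside the carrier. Boundedness holds for every *-homomorphism of
  C*-algebras; it is demanded so that uniqueness reduces to density of the generated subspace.
\<close>

definition star_hom_extending :: "'a cstar \<Rightarrow> 'b cstar \<Rightarrow> ('a \<times> 'b) set \<Rightarrow> 'a \<Rightarrow> 'b" where
  "star_hom_extending A B R = (THE f. f \<in> star_hom A B \<and> f \<in> extensional (carrier A) \<and>
     (\<exists>K. \<forall>a\<in>carrier A. cnorm B (f a) \<le> K * cnorm A a) \<and> (\<forall>(a, b)\<in>R. f a = b))"

definition operator_algebra :: "'h::chilbert_space op set \<Rightarrow> 'h op cstar" where
  "operator_algebra S = \<lparr>carrier = S, mult = (o\<^sub>L), one = id_blinfun, zero = 0, add = (+),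
     smult = scale_op, star = adjoint_op, cnorm = norm\<rparr>"

definition representation :: "'a cstar \<Rightarrow> ('a \<Rightarrow> 'h::chilbert_space op) \<Rightarrow> bool" where
  "representation A \<pi> \<longleftrightarrow> \<pi> \<in> star_hom A (operator_algebra bounded_ops)"

definition closed_csubspace :: "'h::chilbert_space set \<Rightarrow> bool" where
  "closed_csubspace V \<longleftrightarrow> subspace V \<and> (\<forall>c. \<forall>x\<in>V. c *\<^sub>C x \<in> V) \<and> closed V"

definition invariant_subspace ::
  "'a cstar \<Rightarrow> ('a \<Rightarrow> 'h::chilbert_space op) \<Rightarrow> 'h set \<Rightarrow> bool" where
  "invariant_subspace A \<pi> V \<longleftrightarrow> closed_csubspace V \<and>
     (\<forall>a\<in>carrier A. \<forall>x\<in>V. blinfun_apply (\<pi> a) x \<in> V)"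

definition irreducible_subrep ::
  "'a cstar \<Rightarrow> ('a \<Rightarrow> 'h::chilbert_space op) \<Rightarrow> 'h set \<Rightarrow> bool" where
  "irreducible_subrep A \<pi> V \<longleftrightarrow> invariant_subspace A \<pi> V \<and> V \<noteq> {0} \<and>
     (\<forall>W. invariant_subspace A \<pi> W \<and> W \<subseteq> V \<longrightarrow> W = {0} \<or> W = V)"

definition equivalent_subreps ::
  "'a cstar \<Rightarrow> ('a \<Rightarrow> 'h::chilbert_space op) \<Rightarrow> 'h set \<Rightarrow> 'h set \<Rightarrow> bool" where
  "equivalent_subreps A \<pi> V W \<longleftrightarrow> (\<exists>U. U ` V = W \<and>
     (\<forall>x\<in>V. \<forall>y\<in>V. U (x + y) = U x + U y) \<and>
     (\<forall>c. \<forall>x\<in>V. U (c *\<^sub>C x) = c *\<^sub>C U x) \<and>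
     (\<forall>x\<in>V. norm (U x) = norm x) \<and>
     (\<forall>a\<in>carrier A. \<forall>x\<in>V. U (blinfun_apply (\<pi> a) x) = blinfun_apply (\<pi> a) (U x)))"

text \<open>
  The Hilbert space direct sum is taken internally: the summands of the representation are its
  restrictions to the members of a family of pairwise orthogonal closed invariant subspaces
  with dense span. \<open>span\<close> is the real span, which here (and in
  \<open>spatial_tensor\<close> below) is a complex subspace because the spanning set is closed
  under complex multiples.
\<close>

definition atomic_representation :: "'a cstar \<Rightarrow> ('a \<Rightarrow> 'h::chilbert_space op) \<Rightarrow> bool" where
  "atomic_representation A \<pi> \<longleftrightarrow> representation A \<pi> \<and>
     (\<exists>\<V>. (\<forall>V\<in>\<V>. irreducible_subrep A \<pi> V) \<and>
       (\<forall>V\<in>\<V>. \<forall>W\<in>\<V>. V \<noteq> W \<longrightarrow>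
          (\<forall>x\<in>V. \<forall>y\<in>W. cinner x y = 0) \<and> \<not> equivalent_subreps A \<pi> V W) \<and>
       closure (span (\<Union>\<V>)) = UNIV)"

text \<open>
  The spatial tensor product is realised by the given representations \<open>\<pi>\<close> and
  \<open>\<sigma>\<close>, which are meant to be faithful: the elementary tensor of \<open>a\<close> and
  \<open>b\<close> is the operator \<open>tensor_op (\<pi> a) (\<sigma> b)\<close>. Accordingly the
  tensor product of the representations fixes the elementary tensors.
\<close>

definition spatial_tensor ::
  "'a cstar \<Rightarrow> ('a \<Rightarrow> 'h::chilbert_space op) \<Rightarrow> 'b cstar \<Rightarrow> ('b \<Rightarrow> 'k::chilbert_space op)
     \<Rightarrow> ('h, 'k) htensor op cstar" where
  "spatial_tensor A \<pi> B \<sigma> = operator_algebra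
     (closure (span {tensor_op (\<pi> a) (\<sigma> b) |a b. a \<in> carrier A \<and> b \<in> carrier B}))"

definition tensor_rep ::
  "'a cstar \<Rightarrow> ('a \<Rightarrow> 'h::chilbert_space op) \<Rightarrow> 'b cstar \<Rightarrow> ('b \<Rightarrow> 'k::chilbert_space op)
     \<Rightarrow> ('h, 'k) htensor op \<Rightarrow> ('h, 'k) htensor op" where
  "tensor_rep A \<pi> B \<sigma> =
     star_hom_extending (spatial_tensor A \<pi> B \<sigma>) (operator_algebra bounded_ops)
       {(tensor_op (\<pi> a) (\<sigma> b), tensor_op (\<pi> a) (\<sigma> b)) |a b. a \<in> carrier A \<and> b \<in> carrier B}"

definition tensor_square ::
  "'a cstar \<Rightarrow> ('a \<Rightarrow> 'h::chilbert_space op) \<Rightarrow> ('h, 'h) htensor op cstar" where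
  "tensor_square A \<pi> = spatial_tensor A \<pi> A \<pi>"

definition tensor_cube ::
  "'a cstar \<Rightarrow> ('a \<Rightarrow> 'h::chilbert_space op) \<Rightarrow> (('h, 'h) htensor, 'h) htensor op cstar" where
  "tensor_cube A \<pi> = spatial_tensor (tensor_square A \<pi>) (tensor_rep A \<pi> A \<pi>) A \<pi>"

definition tensor_flip ::
  "'a cstar \<Rightarrow> ('a \<Rightarrow> 'h::chilbert_space op) \<Rightarrow> ('h, 'h) htensor op \<Rightarrow> ('h, 'h) htensor op" where
  "tensor_flip A \<pi> = star_hom_extending (tensor_square A \<pi>) (tensor_square A \<pi>)
     {(tensor_op (\<pi> a) (\<pi> b), tensor_op (\<pi> b) (\<pi> a)) |a b. a \<in> carrier A \<and> b \<in> carrier A}"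

definition middle_unit ::
  "'a cstar \<Rightarrow> ('a \<Rightarrow> 'h::chilbert_space op)
     \<Rightarrow> ('h, 'h) htensor op \<Rightarrow> (('h, 'h) htensor, 'h) htensor op" where
  "middle_unit A \<pi> = star_hom_extending (tensor_square A \<pi>) (tensor_cube A \<pi>)
     {(tensor_op (\<pi> a) (\<pi> b), tensor_op (tensor_op (\<pi> a) (\<pi> \<one>\<^bsub>A\<^esub>)) (\<pi> b)) |a b.
        a \<in> carrier A \<and> b \<in> carrier A}"

text \<open>
  The embedding sending \<open>a \<otimes> b\<close> to \<open>1 \<otimes> a \<otimes> b\<close>; it is not of the
  form \<open>tensor_op 1 T\<close> because the tensor cube is bracketed to the left.
\<close>

definition left_unit ::
  "'a cstar \<Rightarrow> ('a \<Rightarrow> 'h::chilbert_space op)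
     \<Rightarrow> ('h, 'h) htensor op \<Rightarrow> (('h, 'h) htensor, 'h) htensor op" where
  "left_unit A \<pi> = star_hom_extending (tensor_square A \<pi>) (tensor_cube A \<pi>)
     {(tensor_op (\<pi> a) (\<pi> b), tensor_op (tensor_op (\<pi> \<one>\<^bsub>A\<^esub>) (\<pi> a)) (\<pi> b)) |a b.
        a \<in> carrier A \<and> b \<in> carrier A}"

definition right_unit ::
  "'a cstar \<Rightarrow> ('a \<Rightarrow> 'h::chilbert_space op)
     \<Rightarrow> ('h, 'h) htensor op \<Rightarrow> (('h, 'h) htensor, 'h) htensor op" where
  "right_unit A \<pi> T = tensor_op T (\<pi> \<one>\<^bsub>A\<^esub>)"

definition middle_swap ::
  "'a cstar \<Rightarrow> ('a \<Rightarrow> 'h::chilbert_space op) \<Rightarrow> 'b cstar \<Rightarrow> ('b \<Rightarrow> 'k::chilbert_space op)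
     \<Rightarrow> (('h, 'h) htensor, ('k, 'k) htensor) htensor op
     \<Rightarrow> (('h, 'k) htensor, ('h, 'k) htensor) htensor op" where
  "middle_swap A \<pi> B \<sigma> = star_hom_extending
     (spatial_tensor (tensor_square A \<pi>) (tensor_rep A \<pi> A \<pi>)
        (tensor_square B \<sigma>) (tensor_rep B \<sigma> B \<sigma>))
     (tensor_square (spatial_tensor A \<pi> B \<sigma>) (tensor_rep A \<pi> B \<sigma>))
     {(tensor_op (tensor_op (\<pi> a) (\<pi> a')) (tensor_op (\<sigma> b) (\<sigma> b')),
       tensor_op (tensor_op (\<pi> a) (\<sigma> b)) (tensor_op (\<pi> a') (\<sigma> b'))) |a a' b b'.
        a \<in> carrier A \<and> a' \<in> carrier A \<and> b \<in> carrier B \<and> b' \<in> carrier B}"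

definition diagonal_projection ::
  "'a cstar \<Rightarrow> ('a \<Rightarrow> 'h::chilbert_space op) \<Rightarrow> ('h, 'h) htensor op" where
  "diagonal_projection A \<pi> =
     (let M = bicommutant (\<pi> ` carrier A)
      in projection_Sup (vn_tensor M M) {tensor_op p p |p. minimal_projection M p})"

definition diagonal_complement ::
  "'a cstar \<Rightarrow> ('a \<Rightarrow> 'h::chilbert_space op) \<Rightarrow> ('h, 'h) htensor set" where
  "diagonal_complement A \<pi> =
     {x. \<forall>y\<in>range (blinfun_apply (diagonal_projection A \<pi>)). cinner y x = 0}"

definition compact_quantum_metric_space ::
  "'a cstar \<Rightarrow> ('h, 'h) htensor op \<Rightarrow> ('a \<Rightarrow> 'h::chilbert_space op) \<Rightarrow> bool" where
  "compact_quantum_metric_space A \<rho> \<pi> \<longleftrightarrow>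
     unital_cstar_algebra A \<and> atomic_representation A \<pi> \<and> inj_on \<pi> (carrier A) \<and>
     positive_in (tensor_square A \<pi>) \<rho> \<and>
     \<rho> o\<^sub>L diagonal_projection A \<pi> = 0 \<and> diagonal_projection A \<pi> o\<^sub>L \<rho> = 0 \<and>
     \<not> (\<exists>x\<in>diagonal_complement A \<pi>. x \<noteq> 0 \<and> blinfun_apply \<rho> x = 0) \<and>
     tensor_flip A \<pi> \<rho> = \<rho> \<and>
     le_in (tensor_cube A \<pi>) (middle_unit A \<pi> \<rho>) (right_unit A \<pi> \<rho> \<oplus>\<^bsub>tensor_cube A \<pi>\<^esub> left_unit A \<pi> \<rho>)"

end

theory Submission
  imports Defs
begin

text \<open>
  The axioms force a compact quantum metric space to be an ordinary one. Let \<open>V\<close> be one of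
  the irreducible subspaces of \<open>\<pi>\<close>. The minimal projections of the von Neumann algebra are
  the projections onto the lines inside such subspaces (\<open>minimal_projection_iff_rank_one\<close>, from
  Schur's lemma), so \<open>\<rho>\<close> kills \<open>v \<otimes> v\<close> for \<open>v \<in> V\<close>, hence all
  symmetric tensors over \<open>V\<close>, and it is strictly positive on the antisymmetric ones. Over
  the span of two orthonormal vectors of \<open>V\<close> the quadratic form of \<open>\<rho>\<close> is therefore a
  positive multiple of that of the projection onto the antisymmetric line, and for such a form
  the triangle inequality fails (\<open>no_orthonormal_pair\<close>). So all \<open>V\<close> are lines.

  It follows that the Hilbert space has an orthonormal basis \<open>E\<close> of joint eigenvectors with
  pairwise different characters, and that \<open>\<rho>\<close>, being a limit of combinations of the
  diagonal operators \<open>\<pi> a \<otimes> \<pi> b\<close>, is diagonal: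
  \<open>\<rho> (e \<otimes> f) = d e f *\<^sub>C (e \<otimes> f)\<close>. The axioms say that \<open>d\<close> is a metric on
  \<open>E\<close> (\<open>compact_quantum_metric_space_imp_diagonal\<close>), and conversely a faithful representation
  with such a basis, together with such a \<open>\<rho>\<close> in the tensor square, is a compact quantum
  metric space (\<open>diagonal_imp_compact_quantum_metric_space\<close>). For the product one takes the basis \<open>e \<otimes> f\<close>; after the middle factors have been exchanged, \<open>\<rho>\<close> is
  diagonal with entries \<open>d\<^sub>1 + d\<^sub>2\<close>, which is again a metric.

  What has to be supplied for this argument is of two kinds. One is operator theory on Hilbert
  spaces that need not be finite-dimensional: adjoints, projections, tensor products of operators,
  square roots, and the fact that positivity in a concrete C*-algebra, defined through the
  spectrum, is positivity of the quadratic form (\<open>positive_in_operator_algebra_iff\<close>), which turns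
  the triangle inequality into a statement about vectors. The other is the evaluation of the
  homomorphisms that are specified by their values on elementary tensors: each of them is
  composed of amplifications \<open>T \<mapsto> T \<otimes> 1\<close> and conjugations with unitaries that permute
  tensor factors, and such a map is determined on a closed span by its values on the spanning
  set (\<open>star_hom_extending_spatial\<close>).
\<close>

section \<open>Complex linear operators and their adjoints\<close>

notation blinfun_apply (infixr "\<cdot>" 100)

definition clinear_op :: "('h::chilbert_space \<Rightarrow>\<^sub>L 'k::chilbert_space) \<Rightarrow> bool" where
  "clinear_op T \<longleftrightarrow> (\<forall>c x. T \<cdot> (c *\<^sub>C x) = c *\<^sub>C T \<cdot> x)"

lemma clinear_opD: "clinear_op T \<Longrightarrow> T \<cdot> (c *\<^sub>C x) = c *\<^sub>C T \<cdot> x"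
  unfolding clinear_op_def by blast

lemma bounded_ops_iff: "T \<in> bounded_ops \<longleftrightarrow> clinear_op T"
  unfolding bounded_ops_def clinear_op_def by simp

lemma clinear_op_compose: "clinear_op S \<Longrightarrow> clinear_op T \<Longrightarrow> clinear_op (S o\<^sub>L T)"
  unfolding clinear_op_def by simp

lemma clinear_op_id: "clinear_op id_blinfun"
  unfolding clinear_op_def by simp

lemma clinear_op_add: "clinear_op S \<Longrightarrow> clinear_op T \<Longrightarrow> clinear_op (S + T)"
  unfolding clinear_op_def by (simp add: blinfun.add_left scaleC_add_right)

lemma cinner_diff_left: "cinner (x - y) z = cinner x z - cinner y z"
  by (metis cinner_commute cinner_diff_right complex_cnj_diff)

lemma scaleC_diff_right: "c *\<^sub>C (x - y) = c *\<^sub>C x - c *\<^sub>C (y::'a::chilbert_space)"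
  using scaleC_add_right[of c x "- y"] by (simp add: scaleC_minus_right)

lemma scaleC_minus_left: "(- c) *\<^sub>C x = - (c *\<^sub>C (x::'a::chilbert_space))"
  using scaleC_add_left[of c "- c" x] by (simp add: eq_neg_iff_add_eq_0 add.commute)

lemma cinner_self_eq_0: "cinner x x = 0 \<longleftrightarrow> (x::'a::chilbert_space) = 0"
  by (simp add: cinner_self)

lemma cinner_zero_commute: "cinner x y = 0 \<longleftrightarrow> cinner y x = 0"
  by (metis cinner_commute complex_cnj_zero)

lemma cinner_ext:
  assumes "\<And>y. cinner y x = cinner y (z::'a::chilbert_space)"
  shows "x = z"
proof -
  have "cinner (x - z) (x - z) = 0"
    by (simp add: cinner_diff_right assms)
  then show ?thesis
    by (simp add: cinner_self_eq_0)
qed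

lemma clinear_op_diff: "clinear_op S \<Longrightarrow> clinear_op T \<Longrightarrow> clinear_op (S - T)"
  unfolding clinear_op_def by (simp add: blinfun.diff_left scaleC_diff_right)

lemma clinear_op_scale: "clinear_op T \<Longrightarrow> clinear_op (scale_op c T)"
  unfolding clinear_op_def by (simp add: scale_op_apply scaleC_scaleC mult.commute)

lemma scaleR_scaleC: "r *\<^sub>R x = complex_of_real r *\<^sub>C (x::'a::chilbert_space)"
  by (rule scaleC_of_real[symmetric])

lemma clinear_op_scaleR: "clinear_op T \<Longrightarrow> clinear_op (r *\<^sub>R T)"
  unfolding clinear_op_def by (simp add: blinfun.scaleR_left scaleR_scaleC scaleC_scaleC mult.commute)

lemma is_onb_ext:
  assumes "is_onb B" "\<And>b. b \<in> B \<Longrightarrow> cinner b x = cinner b y"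
  shows "x = y"
proof -
  have "\<forall>b\<in>B. cinner b (x - y) = 0"
    using assms(2) by (simp add: cinner_diff_right)
  then have "x - y = 0"
    using assms(1) unfolding is_onb_def by blast
  then show ?thesis by simp
qed

lemma clinear_op_eq_on_onb:
  fixes S T :: "'h::chilbert_space \<Rightarrow>\<^sub>L 'k::chilbert_space"
  assumes "clinear_op S" "clinear_op T" "is_onb B"
    and eq: "\<And>b. b \<in> B \<Longrightarrow> S \<cdot> b = T \<cdot> b"
  shows "S = T"
proof (rule blinfun_eqI)
  fix x
  have "((\<lambda>b. R \<cdot> (cinner b x *\<^sub>C b)) has_sum R \<cdot> x) B"
    for R :: "'h \<Rightarrow>\<^sub>L 'k"
    by (rule has_sum_bounded_linear[OF blinfun.bounded_linear_right onb_expansion[OF assms(3)]])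
  moreover have "S \<cdot> (cinner b x *\<^sub>C b) = T \<cdot> (cinner b x *\<^sub>C b)" if "b \<in> B" for b
    using eq[OF that] assms(1,2) by (simp add: clinear_opD)
  ultimately have "((\<lambda>b. S \<cdot> (cinner b x *\<^sub>C b)) has_sum T \<cdot> x) B"
    by (smt (verit, ccfv_SIG) has_sum_cong)
  then show "S \<cdot> x = T \<cdot> x"
    using \<open>\<And>R. ((\<lambda>b. R \<cdot> (cinner b x *\<^sub>C b)) has_sum R \<cdot> x) B\<close>[of S]
      has_sum_unique by blast
qed

lemma clinear_op_of_fun:
  fixes f :: "'h::chilbert_space \<Rightarrow> 'k::chilbert_space"
  assumes "\<And>x y. f (x + y) = f x + f y" "\<And>c x. f (c *\<^sub>C x) = c *\<^sub>C f x"
    "\<And>x. norm (f x) \<le> K * norm x" "K \<ge> 0"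
  shows "\<exists>T. clinear_op T \<and> (\<forall>x. T \<cdot> x = f x) \<and> norm T \<le> K"
proof -
  have "bounded_linear f"
    by (rule bounded_linear_intro[where K = K]) (simp_all add: assms scaleR_scaleC mult.commute[of _ K])
  then have f: "blinfun_apply (Blinfun f) = f"
    by (rule bounded_linear_Blinfun_apply)
  have "norm (Blinfun f) \<le> K"
    by (rule norm_blinfun_bound) (simp_all add: f assms)
  then show ?thesis
    by (intro exI[of _ "Blinfun f"]) (simp add: f clinear_op_def assms)
qed

text \<open>
  The representing vector is \<open>\<Sum> cnj (\<phi> e) e\<close> over an orthonormal basis. Its
  coefficients are square summable because evaluating \<open>\<phi>\<close> at a finite partial sum
  returns the squared norm of that partial sum.
\<close>

lemma riesz:
  fixes \<phi> :: "'h::chilbert_space \<Rightarrow> complex"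
  assumes add: "\<And>x y. \<phi> (x + y) = \<phi> x + \<phi> y" and scale: "\<And>c x. \<phi> (c *\<^sub>C x) = c * \<phi> x"
    and bound: "\<And>x. cmod (\<phi> x) \<le> K * norm x"
  shows "\<exists>w. \<forall>y. \<phi> y = cinner w y"
proof -
  have lin: "bounded_linear \<phi>"
    by (rule bounded_linear_intro[where K = K])
      (simp_all add: add scale bound scaleR_scaleC scaleR_conv_of_real mult.commute[of _ K])
  have fin: "(\<Sum>e\<in>F. (cmod (cnj (\<phi> e)))\<^sup>2) \<le> K\<^sup>2" if "finite F" "F \<subseteq> onb" for F
  proof -
    define s where "s = (\<Sum>e\<in>F. cnj (\<phi> e) *\<^sub>C e)"
    have n: "(norm s)\<^sup>2 = (\<Sum>e\<in>F. (cmod (cnj (\<phi> e)))\<^sup>2)"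
      unfolding s_def by (rule norm_sq_orthonormal_sum[OF orthonormal_subset[OF orthonormal_onb that(2)] that(1)])
    have "\<phi> s = (\<Sum>e\<in>F. cnj (\<phi> e) * \<phi> e)"
      unfolding s_def linear_sum[OF bounded_linear.linear[OF lin]] by (simp add: scale)
    also have "\<dots> = complex_of_real (\<Sum>e\<in>F. (cmod (cnj (\<phi> e)))\<^sup>2)"
      unfolding of_real_sum by (rule sum.cong) (simp_all add: complex_norm_square[symmetric] mult.commute)
    finally have "\<phi> s = complex_of_real ((norm s)\<^sup>2)"
      using n by simp
    then have "(norm s)\<^sup>2 \<le> K * norm s"
      using bound[of s] by (simp add: norm_power)
    then have "norm s \<le> K \<or> norm s = 0"
      by (auto simp: power2_eq_square mult_le_cancel_right)
    then have "(norm s)\<^sup>2 \<le> K\<^sup>2"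
    proof
      assume "norm s \<le> K" then show ?thesis by (simp add: power_mono)
    qed simp
    then show ?thesis using n by simp
  qed
  have sq: "(\<lambda>e. (cmod (cnj (\<phi> e)))\<^sup>2) summable_on onb"
    by (rule nonneg_bdd_above_summable_on) (auto intro!: bdd_aboveI2[where M = "K\<^sup>2"] fin[unfolded complex_mod_cnj])
  obtain w where w: "((\<lambda>e. cnj (\<phi> e) *\<^sub>C e) has_sum w) onb"
    using orthonormal_has_sum[OF orthonormal_onb sq] by blast
  have "\<phi> y = cinner w y" for y
  proof -
    have "((\<lambda>e. \<phi> (cinner e y *\<^sub>C e)) has_sum \<phi> y) onb"
      by (rule has_sum_bounded_linear[OF lin onb_expansion[OF is_onb_onb]])
    moreover have "((\<lambda>e. \<phi> (cinner e y *\<^sub>C e)) has_sum cinner w y) onb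
        \<longleftrightarrow> ((\<lambda>e. cnj (cinner e w) * cinner e y) has_sum cinner w y) onb"
      by (rule has_sum_cong) (simp add: scale cinner_has_sum[OF orthonormal_onb w])
    ultimately show ?thesis
      using parseval[OF is_onb_onb, of w y] has_sum_unique by blast
  qed
  then show ?thesis by blast
qed

text \<open>
  The adjoint of an operator between two possibly different Hilbert spaces; on a single space it
  is \<open>adjoint_op\<close>.
\<close>

definition hadj :: "('h::chilbert_space \<Rightarrow>\<^sub>L 'k::chilbert_space) \<Rightarrow> ('k \<Rightarrow>\<^sub>L 'h)" where
  "hadj T = (THE S. \<forall>x y. cinner (S \<cdot> x) y = cinner x (T \<cdot> y))"

lemma adjoint_op_eq_hadj: "adjoint_op = hadj"
  by (rule ext) (simp add: adjoint_op_def hadj_def)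

lemma hadj_exists:
  fixes T :: "'h::chilbert_space \<Rightarrow>\<^sub>L 'k::chilbert_space"
  assumes T: "clinear_op T"
  shows "\<exists>S. clinear_op S \<and> (\<forall>x y. cinner (S \<cdot> x) y = cinner x (T \<cdot> y)) \<and> norm S \<le> norm T"
proof -
  have "\<exists>w. \<forall>y. cinner x (T \<cdot> y) = cinner w y" for x
  proof (rule riesz[where K = "norm x * norm T"])
    fix y
    show "cmod (cinner x (T \<cdot> y)) \<le> norm x * norm T * norm y"
      using cinner_cauchy_schwarz[of x "T \<cdot> y"] norm_blinfun[of T y]
      by (smt (verit, best) mult.assoc mult_left_mono norm_ge_zero)
  qed (simp_all add: blinfun.add_right cinner_add_right clinear_opD[OF T] cinner_scaleC_right)
  then obtain s where s: "\<And>x y. cinner x (T \<cdot> y) = cinner (s x) y"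
    by metis
  have s': "cinner y (s x) = cinner (T \<cdot> y) x" for x y
    using s[of x y] cinner_commute by metis
  have "norm (s x) \<le> norm T * norm x" for x
  proof -
    have "(norm (s x))\<^sup>2 = cmod (cinner (s x) (s x))"
      by (simp add: cinner_self norm_power)
    also have "\<dots> = cmod (cinner x (T \<cdot> (s x)))"
      by (simp add: s)
    also have "\<dots> \<le> norm x * (norm T * norm (s x))"
      by (rule order_trans[OF cinner_cauchy_schwarz]) (simp add: norm_blinfun mult_left_mono)
    finally have "norm (s x) * norm (s x) \<le> (norm T * norm x) * norm (s x)"
      by (simp add: power2_eq_square ac_simps)
    then show ?thesis
      by (cases "norm (s x) = 0") (simp_all add: mult_le_cancel_right)
  qed
  then have "\<exists>S. clinear_op S \<and> (\<forall>x. S \<cdot> x = s x) \<and> norm S \<le> norm T"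
    by (intro clinear_op_of_fun cinner_ext)
      (simp_all add: s' cinner_add_right cinner_scaleC_right)
  then show ?thesis
    using s by auto
qed

lemma hadj_eqI:
  assumes "\<And>x y. cinner (S \<cdot> x) y = cinner x (T \<cdot> y)"
  shows "hadj T = S"
  unfolding hadj_def
proof (rule the_equality)
  fix R assume R: "\<forall>x y. cinner (R \<cdot> x) y = cinner x (T \<cdot> y)"
  show "R = S"
  proof (intro blinfun_eqI cinner_ext)
    fix x y
    show "cinner y (R \<cdot> x) = cinner y (S \<cdot> x)"
      using R assms cinner_commute by metis
  qed
qed (use assms in blast)

lemma
  assumes "clinear_op T"
  shows clinear_op_hadj: "clinear_op (hadj T)"
    and cinner_hadj_left: "cinner (hadj T \<cdot> x) y = cinner x (T \<cdot> y)"
    and norm_hadj_le: "norm (hadj T) \<le> norm T"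
  using hadj_exists[OF assms] hadj_eqI[of _ T] by auto

lemma cinner_hadj_right:
  assumes "clinear_op T"
  shows "cinner x (hadj T \<cdot> y) = cinner (T \<cdot> x) y"
  using cinner_hadj_left[OF assms, of y x] cinner_commute by metis

lemma hadj_hadj: "clinear_op T \<Longrightarrow> hadj (hadj T) = T"
  by (rule hadj_eqI) (simp add: cinner_hadj_right)

lemma norm_hadj: "clinear_op T \<Longrightarrow> norm (hadj T) = norm T"
  using norm_hadj_le[of T] norm_hadj_le[of "hadj T"] by (simp add: hadj_hadj clinear_op_hadj)

lemma hadj_compose: "clinear_op S \<Longrightarrow> clinear_op T \<Longrightarrow> hadj (S o\<^sub>L T) = hadj T o\<^sub>L hadj S"
  by (rule hadj_eqI) (simp add: cinner_hadj_left)

lemma hadj_add: "clinear_op S \<Longrightarrow> clinear_op T \<Longrightarrow> hadj (S + T) = hadj S + hadj T"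
  by (rule hadj_eqI) (simp add: cinner_hadj_left blinfun.add_left cinner_add_left cinner_add_right)

lemma hadj_diff: "clinear_op S \<Longrightarrow> clinear_op T \<Longrightarrow> hadj (S - T) = hadj S - hadj T"
  by (rule hadj_eqI) (simp add: cinner_hadj_left blinfun.diff_left cinner_diff_left cinner_diff_right)

lemma hadj_scale: "clinear_op T \<Longrightarrow> hadj (scale_op c T) = scale_op (cnj c) (hadj T)"
  by (rule hadj_eqI) (simp add: cinner_hadj_left scale_op_apply cinner_scaleC_left cinner_scaleC_right)

lemma scaleR_eq_scale_op: "r *\<^sub>R (T::'h::chilbert_space op) = scale_op (complex_of_real r) T"
  by (rule blinfun_eqI) (simp add: scale_op_apply blinfun.scaleR_left scaleR_scaleC)

lemma hadj_scaleR: "clinear_op (T::'h::chilbert_space op) \<Longrightarrow> hadj (r *\<^sub>R T) = r *\<^sub>R hadj T"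
  by (simp add: scaleR_eq_scale_op hadj_scale)

lemma hadj_id: "hadj id_blinfun = id_blinfun"
  by (rule hadj_eqI) simp

lemma hadj_zero: "hadj 0 = 0"
  by (rule hadj_eqI) simp

lemma norm_scale_op: "norm (scale_op c (T::'h::chilbert_space op)) = cmod c * norm T"
proof -
  have le: "norm (scale_op c T) \<le> cmod c * norm T" for c and T :: "'h op"
    by (rule norm_blinfun_bound)
      (simp_all add: scale_op_apply norm_scaleC mult.assoc mult_left_mono norm_blinfun)
  show ?thesis
  proof (cases "c = 0")
    case True then show ?thesis using le[of c T] by simp
  next
    case False
    have "scale_op (inverse c) (scale_op c T) = T"
      using False by (intro blinfun_eqI) (simp add: scale_op_apply scaleC_scaleC)
    then have "norm T \<le> inverse (cmod c) * norm (scale_op c T)"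
      using le[of "inverse c" "scale_op c T"] by (simp add: norm_inverse)
    then have "cmod c * norm T \<le> norm (scale_op c T)"
      using False by (simp add: field_simps)
    then show ?thesis
      using le[of c T] by simp
  qed
qed

lemma cstar_identity_op:
  assumes "clinear_op (T::'h::chilbert_space op)"
  shows "norm (hadj T o\<^sub>L T) = (norm T)\<^sup>2"
proof (rule antisym)
  show "norm (hadj T o\<^sub>L T) \<le> (norm T)\<^sup>2"
    using norm_blinfun_compose[of "hadj T" T] by (simp add: norm_hadj[OF assms] power2_eq_square)
  have "norm T \<le> sqrt (norm (hadj T o\<^sub>L T))"
  proof (rule norm_blinfun_bound)
    fix x
    have "(norm (T \<cdot> x))\<^sup>2 = cmod (cinner x ((hadj T o\<^sub>L T) \<cdot> x))"
      by (simp add: cinner_hadj_right[OF assms] cinner_self norm_power)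
    also have "\<dots> \<le> norm x * (norm (hadj T o\<^sub>L T) * norm x)"
      by (rule order_trans[OF cinner_cauchy_schwarz]) (intro mult_left_mono norm_blinfun norm_ge_zero)
    finally have "(norm (T \<cdot> x))\<^sup>2 \<le> (sqrt (norm (hadj T o\<^sub>L T)) * norm x)\<^sup>2"
      by (simp add: power_mult_distrib power2_eq_square ac_simps)
    then show "norm (T \<cdot> x) \<le> sqrt (norm (hadj T o\<^sub>L T)) * norm x"
      by (rule power2_le_imp_le) simp
  qed simp
  then show "(norm T)\<^sup>2 \<le> norm (hadj T o\<^sub>L T)"
    by (metis norm_ge_zero power_mono real_sqrt_pow2)
qed

section \<open>Operators prescribed on an orthonormal basis\<close>

text \<open>
  The adjoint is what can be written down: it sends \<open>w\<close> to the vector with coefficients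
  \<open>cinner (\<phi> i) w\<close>, which the hypothesis makes square summable.
\<close>

lemma operator_from_basis:
  fixes b :: "'i \<Rightarrow> 'h::chilbert_space" and \<phi> :: "'i \<Rightarrow> 'k::chilbert_space"
  assumes B: "is_onb (b ` I)" "inj_on b I" and "C \<ge> 0"
    and bound: "\<And>w F. finite F \<Longrightarrow> F \<subseteq> I \<Longrightarrow> (\<Sum>i\<in>F. (cmod (cinner (\<phi> i) w))\<^sup>2) \<le> C\<^sup>2 * (norm w)\<^sup>2"
  shows "\<exists>U. clinear_op U \<and> norm U \<le> C \<and> (\<forall>i\<in>I. U \<cdot> (b i) = \<phi> i)"
proof -
  define \<psi> where "\<psi> = (\<lambda>e. \<phi> (inv_into I b e))"
  have \<psi>: "\<psi> (b i) = \<phi> i" if "i \<in> I" for i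
    using B that by (simp add: \<psi>_def)
  have on: "orthonormal (b ` I)"
    using B unfolding is_onb_def by blast
  have bd: "(\<Sum>e\<in>F. (cmod (cinner (\<psi> e) w))\<^sup>2) \<le> C\<^sup>2 * (norm w)\<^sup>2" if "finite F" "F \<subseteq> b ` I" for F w
  proof -
    define G where "G = inv_into I b ` F"
    have inj: "inj_on (inv_into I b) F"
      using that(2) by (meson inj_on_inv_into)
    have "(\<Sum>i\<in>G. (cmod (cinner (\<phi> i) w))\<^sup>2) = (\<Sum>e\<in>F. (cmod (cinner (\<psi> e) w))\<^sup>2)"
      unfolding G_def \<psi>_def using inj by (simp add: sum.reindex)
    moreover have "finite G" "G \<subseteq> I"
      using that by (auto simp: G_def intro: inv_into_into)
    ultimately show ?thesis
      using bound[of G w] by simp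
  qed
  have "\<exists>v. ((\<lambda>e. cinner (\<psi> e) w *\<^sub>C e) has_sum v) (b ` I)" for w
    by (rule orthonormal_has_sum[OF on], rule nonneg_bdd_above_summable_on)
      (auto intro!: bdd_aboveI2[where M = "C\<^sup>2 * (norm w)\<^sup>2"] bd)
  then obtain s where s: "\<And>w. ((\<lambda>e. cinner (\<psi> e) w *\<^sub>C e) has_sum s w) (b ` I)"
    by metis
  have co: "cinner e (s w) = cinner (\<psi> e) w" if "e \<in> b ` I" for e w
    by (rule cinner_has_sum[OF on s that])
  have "norm (s w) \<le> C * norm w" for w
  proof (rule power2_le_imp_le)
    have "((\<lambda>e. cnj (cinner e (s w)) * cinner e (s w)) has_sum cinner (s w) (s w)) (b ` I)"
      by (rule parseval[OF B(1)])
    moreover have "cnj (cinner e (s w)) * cinner e (s w) = complex_of_real ((cmod (cinner e (s w)))\<^sup>2)" for e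
      by (metis complex_norm_square mult.commute)
    ultimately have "((\<lambda>e. complex_of_real ((cmod (cinner e (s w)))\<^sup>2)) has_sum complex_of_real ((norm (s w))\<^sup>2)) (b ` I)"
      by (simp add: cinner_self)
    then have hs: "((\<lambda>e. (cmod (cinner e (s w)))\<^sup>2) has_sum (norm (s w))\<^sup>2) (b ` I)"
      by (simp only: has_sum_of_real_iff)
    have "(norm (s w))\<^sup>2 \<le> C\<^sup>2 * (norm w)\<^sup>2"
    proof (rule has_sum_le_finite_sums[OF hs])
      fix F assume "finite F" "F \<subseteq> b ` I"
      then show "(\<Sum>e\<in>F. (cmod (cinner e (s w)))\<^sup>2) \<le> C\<^sup>2 * (norm w)\<^sup>2"
        using bd[of F w] co by (simp add: subset_iff)
    qed
    then show "(norm (s w))\<^sup>2 \<le> (C * norm w)\<^sup>2"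
      by (simp add: power_mult_distrib)
  qed (simp add: \<open>C \<ge> 0\<close>)
  then have "\<exists>S. clinear_op S \<and> (\<forall>w. S \<cdot> w = s w) \<and> norm S \<le> C"
    by (intro clinear_op_of_fun is_onb_ext[OF B(1)])
      (simp_all add: co cinner_add_right cinner_scaleC_right \<open>C \<ge> 0\<close>)
  then obtain S where S: "clinear_op S" "\<And>w. S \<cdot> w = s w" "norm S \<le> C"
    by blast
  have "hadj S \<cdot> (b i) = \<phi> i" if "i \<in> I" for i
    by (rule cinner_ext, subst cinner_hadj_right[OF S(1)])
      (metis (no_types, lifting) S(2) \<psi> cinner_commute co imageI that)
  then show ?thesis
    using clinear_op_hadj[OF S(1)] norm_hadj[OF S(1)] S(3) by auto
qed

definition unitary_op :: "('h::chilbert_space \<Rightarrow>\<^sub>L 'k::chilbert_space) \<Rightarrow> bool" where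
  "unitary_op U \<longleftrightarrow> clinear_op U \<and> hadj U o\<^sub>L U = id_blinfun \<and> U o\<^sub>L hadj U = id_blinfun"

lemma unitary_opD:
  assumes "unitary_op U"
  shows "clinear_op U" "clinear_op (hadj U)" "hadj U o\<^sub>L U = id_blinfun" "U o\<^sub>L hadj U = id_blinfun"
    "hadj U \<cdot> (U \<cdot> x) = x" "U \<cdot> (hadj U \<cdot> y) = y"
  using assms clinear_op_hadj unfolding unitary_op_def
  by (auto simp: blinfun_apply_blinfun_compose[symmetric] simp del: blinfun_apply_blinfun_compose)

text \<open>
  All the unitaries that permute tensor factors come from this lemma: \<open>g\<close> and
  \<open>g'\<close> enumerate elementary tensors with their factors in two orders, and
  \<open>I0\<close> picks out those with factors in an orthonormal basis.
\<close>

lemma unitary_from_gram: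
  fixes g :: "'i \<Rightarrow> 'h::chilbert_space" and g' :: "'i \<Rightarrow> 'k::chilbert_space"
  assumes gram: "\<And>i j. cinner (g i) (g j) = cinner (g' i) (g' j)"
    and onb_g: "is_onb (g ` I0)" and onb_g': "is_onb (g' ` I0)"
  shows "\<exists>U. unitary_op U \<and> (\<forall>i. U \<cdot> (g i) = g' i)"
proof -
  have same: "g' i = g' j" if "g i = g j" for i j
  proof -
    have "cinner (g' i - g' j) (g' i - g' j) = cinner (g i - g j) (g i - g j)"
      by (simp add: cinner_diff_left cinner_diff_right gram)
    then show ?thesis
      using that by (simp add: cinner_self_eq_0)
  qed
  obtain I where I: "I \<subseteq> I0" and inj: "inj_on g I" and gI: "g ` I0 = g ` I"
    using subset_image_inj[of "g ` I0" g I0] by blast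
  have "g' i \<in> g' ` I" if i: "i \<in> I0" for i
  proof -
    obtain j where "j \<in> I" "g i = g j"
      using gI i by blast
    then show ?thesis
      using same[of i j] by simp
  qed
  then have "g' ` I0 = g' ` I"
    using I by blast
  then have g: "is_onb (g ` I)" and g': "is_onb (g' ` I)"
    using onb_g onb_g' gI by simp_all
  have on': "orthonormal (g' ` I)" and on: "orthonormal (g ` I)"
    using g g' unfolding is_onb_def by blast+
  have inj': "inj_on g' I"
  proof (rule inj_onI)
    fix i j assume ij: "i \<in> I" "j \<in> I" "g' i = g' j"
    then have "cinner (g i) (g j) = 1"
      using on' gram[of i j] unfolding orthonormal_def by simp
    then show "i = j"
      using on ij inj unfolding orthonormal_def inj_on_def by (metis imageI zero_neq_one)
  qed
  have "(\<Sum>i\<in>F. (cmod (cinner (g' i) w))\<^sup>2) \<le> 1\<^sup>2 * (norm w)\<^sup>2" if "finite F" "F \<subseteq> I" for F w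
    using bessel_inequality[OF orthonormal_subset[OF on' image_mono[OF that(2)]], of w]
      inj_on_subset[OF inj' that(2)] that(1) by (simp add: sum.reindex)
  then obtain U where U: "clinear_op U" "\<And>i. i \<in> I \<Longrightarrow> U \<cdot> (g i) = g' i"
    using operator_from_basis[OF g inj, of 1 g'] by auto
  have 1: "hadj U o\<^sub>L U = id_blinfun"
  proof (rule clinear_op_eq_on_onb[OF _ _ g])
    fix b assume "b \<in> g ` I"
    then obtain j where j: "j \<in> I" "b = g j" by blast
    show "(hadj U o\<^sub>L U) \<cdot> b = id_blinfun \<cdot> b"
      by (rule is_onb_ext[OF g]) (auto simp: cinner_hadj_right[OF U(1)] U(2) j gram)
  qed (simp_all add: U clinear_op_compose clinear_op_hadj clinear_op_id)
  have all: "U \<cdot> (g i) = g' i" for i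
  proof (rule is_onb_ext[OF g'])
    fix b assume "b \<in> g' ` I"
    then obtain j where j: "j \<in> I" "b = g' j" by blast
    have "cinner b (U \<cdot> (g i)) = cinner (g j) ((hadj U o\<^sub>L U) \<cdot> (g i))"
      by (simp add: j U(2) cinner_hadj_right[OF U(1)])
    then show "cinner b (U \<cdot> (g i)) = cinner b (g' i)"
      by (simp add: 1 j gram)
  qed
  have "U o\<^sub>L hadj U = id_blinfun"
  proof (rule clinear_op_eq_on_onb[OF _ _ g'])
    fix b assume "b \<in> g' ` I"
    then obtain j where j: "j \<in> I" "b = g' j" by blast
    have "hadj U \<cdot> b = g j"
      using arg_cong[OF 1, of "\<lambda>T. T \<cdot> (g j)"] by (simp add: all j)
    then show "(U o\<^sub>L hadj U) \<cdot> b = id_blinfun \<cdot> b"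
      by (simp add: all j)
  qed (simp_all add: U clinear_op_compose clinear_op_hadj clinear_op_id)
  then show ?thesis
    using U(1) 1 all unfolding unitary_op_def by blast
qed

section \<open>Orthogonal projections\<close>

definition selfadjoint :: "'h::chilbert_space op \<Rightarrow> bool" where
  "selfadjoint T \<longleftrightarrow> clinear_op T \<and> hadj T = T"

lemma selfadjointD:
  assumes "selfadjoint T"
  shows "clinear_op T" "hadj T = T" "cinner (T \<cdot> x) y = cinner x (T \<cdot> y)"
  using assms cinner_hadj_left[of T x y] unfolding selfadjoint_def by auto

lemma selfadjointI:
  assumes "clinear_op T" "\<And>x y. cinner (T \<cdot> x) y = cinner x (T \<cdot> y)"
  shows "selfadjoint T"
  unfolding selfadjoint_def using assms hadj_eqI by blast

lemma is_projection_iff: "is_projection P \<longleftrightarrow> selfadjoint P \<and> P o\<^sub>L P = P"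
  unfolding is_projection_def selfadjoint_def by (auto simp: bounded_ops_iff adjoint_op_eq_hadj)

text \<open>
  A maximal orthonormal subset of \<open>V\<close> spans \<open>V\<close>, and the projection is the
  corresponding partial expansion.
\<close>

lemma orthogonal_projection_exists:
  fixes V :: "'h::chilbert_space set"
  assumes V: "closed_csubspace V"
  shows "\<exists>P. is_projection P \<and> range (blinfun_apply P) = V"
proof -
  have sub: "subspace V" and sc: "\<And>c x. x \<in> V \<Longrightarrow> c *\<^sub>C x \<in> V" and cl: "closed V"
    using V unfolding closed_csubspace_def by auto
  define \<O> where "\<O> = {B. orthonormal B \<and> B \<subseteq> V}"
  have "\<Union>C \<in> \<O>" if C: "subset.chain \<O> C" for C
  proof -
    have "cinner x y = (if x = y then 1 else 0)" if "x \<in> X" "y \<in> Y" "X \<in> C" "Y \<in> C" for x y X Y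
    proof -
      have "X \<subseteq> Y \<or> Y \<subseteq> X" "orthonormal X" "orthonormal Y"
        using C that unfolding subset_chain_def \<O>_def by auto
      then show ?thesis
        using that unfolding orthonormal_def by (metis subsetD)
    qed
    then show ?thesis
      using C unfolding \<O>_def subset_chain_def orthonormal_def by blast
  qed
  then obtain M where M: "M \<in> \<O>" and max: "\<forall>X\<in>\<O>. M \<subseteq> X \<longrightarrow> X = M"
    using subset_Zorn'[of \<O>] by blast
  have on: "orthonormal M" and MV: "M \<subseteq> V"
    using M by (auto simp: \<O>_def)
  have zero: "x = 0" if x: "x \<in> V" "\<And>e. e \<in> M \<Longrightarrow> cinner e x = 0" for x
  proof (rule ccontr)
    assume "x \<noteq> 0"
    define u where "u = complex_of_real (inverse (norm x)) *\<^sub>C x"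
    have uu: "cinner u u = 1"
      using \<open>x \<noteq> 0\<close> by (simp add: cinner_self u_def norm_scaleC norm_inverse)
    have ou: "cinner e u = 0" "cinner u e = 0" if "e \<in> M" for e
      using x(2)[OF that] cinner_zero_commute[of u e] by (simp_all add: u_def cinner_scaleC_right)
    have "insert u M \<in> \<O>"
      using on uu ou MV sc[OF x(1)] unfolding \<O>_def orthonormal_def by (auto simp: u_def)
    then have "u \<in> M"
      using max by blast
    then show False
      using ou(1) uu by force
  qed
  obtain s where s: "\<And>x. ((\<lambda>e. cinner e x *\<^sub>C e) has_sum s x) M"
    using orthonormal_has_sum[OF on bessel_summable[OF on]] by metis
  have co: "cinner e (s x) = cinner e x" if "e \<in> M" for e x
    by (rule cinner_has_sum[OF on s that])
  have sV: "s x \<in> V" for x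
  proof (rule Lim_in_closed_set[OF cl])
    show "(sum (\<lambda>e. cinner e x *\<^sub>C e) \<longlongrightarrow> s x) (finite_subsets_at_top M)"
      using s[of x] unfolding has_sum_def .
    show "\<forall>\<^sub>F F in finite_subsets_at_top M. (\<Sum>e\<in>F. cinner e x *\<^sub>C e) \<in> V"
      by (rule eventually_finite_subsets_at_top_weakI) (use MV sc in \<open>auto intro!: subspace_sum[OF sub]\<close>)
  qed simp
  have id: "s x = x" if "x \<in> V" for x
  proof -
    have "x - s x = 0"
      by (rule zero) (use that sV sub in \<open>auto simp: subspace_diff cinner_diff_right co\<close>)
    then show ?thesis by simp
  qed
  have ext: "s x = z" if "z \<in> V" "\<And>e. e \<in> M \<Longrightarrow> cinner e x = cinner e z" for x z
  proof -
    have "s x - z = 0"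
      by (rule zero) (use that sV sub in \<open>auto simp: subspace_diff cinner_diff_right co\<close>)
    then show ?thesis by simp
  qed
  have orth: "cinner v (s x) = cinner v x" if "v \<in> V" for v x
  proof -
    have "((\<lambda>e. cinner y (cinner e v *\<^sub>C e)) has_sum cinner y v) M" for y
      using has_sum_bounded_linear[OF bounded_linear_cinner s[of v]] id[OF that] by simp
    note h = this
    have "((\<lambda>e. cinner e v * cinner (s x) e) has_sum cinner (s x) v) M"
      "((\<lambda>e. cinner e v * cinner x e) has_sum cinner x v) M"
      using h[of "s x"] h[of x] by (simp_all add: cinner_scaleC_right)
    moreover have "cinner (s x) e = cinner x e" if "e \<in> M" for e
      using co[OF that, of x] cinner_commute by metis
    ultimately have "cinner (s x) v = cinner x v"
      by (metis (no_types, lifting) has_sum_cong has_sum_unique)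
    then show ?thesis
      using cinner_commute by metis
  qed
  have "norm (s x) \<le> 1 * norm x" for x
  proof -
    have "(norm (s x))\<^sup>2 = cmod (cinner (s x) x)"
      using orth[OF sV, of x x] by (simp add: cinner_self norm_power flip: orth[OF sV])
    also have "\<dots> \<le> norm (s x) * norm x"
      by (rule cinner_cauchy_schwarz)
    finally show ?thesis
      by (cases "norm (s x) = 0") (simp_all add: power2_eq_square)
  qed
  then have "\<exists>P. clinear_op P \<and> (\<forall>x. P \<cdot> x = s x) \<and> norm P \<le> 1"
    by (intro clinear_op_of_fun ext)
      (use sV sc sub in \<open>auto simp: subspace_add cinner_add_right cinner_scaleC_right co\<close>)
  then obtain P where P: "clinear_op P" "\<And>x. P \<cdot> x = s x"
    by blast
  have "selfadjoint P"
  proof (rule selfadjointI[OF P(1)])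
    fix x y
    have "cinner (s x) y = cinner (s x) (s y)" by (simp add: orth[OF sV])
    also have "\<dots> = cinner x (s y)" using orth[OF sV, of y x] cinner_commute by metis
    finally show "cinner (P \<cdot> x) y = cinner x (P \<cdot> y)" by (simp add: P)
  qed
  moreover have "P o\<^sub>L P = P"
    by (rule blinfun_eqI) (simp add: P id[OF sV])
  moreover have "range (blinfun_apply P) = V"
    unfolding P(2) using sV id by (metis image_subsetI rangeI subsetI subset_antisym)
  ultimately show ?thesis
    unfolding is_projection_iff by blast
qed

lemma projection_range_iff: "is_projection P \<Longrightarrow> x \<in> range (blinfun_apply P) \<longleftrightarrow> P \<cdot> x = x"
  unfolding is_projection_iff
  by (metis blinfun_apply_blinfun_compose rangeE rangeI)

text \<open>
  The hypotheses say that \<open>T\<close> and \<open>T\<^sup>*\<close> preserve the range of \<open>P\<close>, that is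
  \<open>P T P = T P\<close> and \<open>P T\<^sup>* P = T\<^sup>* P\<close>; the adjoint of the second equation is
  \<open>P T P = P T\<close>.
\<close>

lemma commute_with_projection:
  fixes T P :: "'h::chilbert_space op"
  assumes P: "is_projection P" and T: "clinear_op T"
    and inv: "\<And>x. P \<cdot> x = x \<Longrightarrow> P \<cdot> (T \<cdot> x) = T \<cdot> x"
      "\<And>x. P \<cdot> x = x \<Longrightarrow> P \<cdot> (hadj T \<cdot> x) = hadj T \<cdot> x"
  shows "T o\<^sub>L P = P o\<^sub>L T"
proof -
  have sa: "selfadjoint P" and PP: "P \<cdot> (P \<cdot> x) = P \<cdot> x" for x
    using P unfolding is_projection_iff by (auto simp flip: blinfun_apply_blinfun_compose)
  have cP: "clinear_op P" "hadj P = P"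
    using selfadjointD[OF sa] by auto
  have 1: "P o\<^sub>L (T o\<^sub>L P) = T o\<^sub>L P" "P o\<^sub>L (hadj T o\<^sub>L P) = hadj T o\<^sub>L P"
    by (rule blinfun_eqI, simp add: inv PP)+
  have "hadj (P o\<^sub>L (hadj T o\<^sub>L P)) = hadj (hadj T o\<^sub>L P)"
    using 1 by simp
  then have "(P o\<^sub>L T) o\<^sub>L P = P o\<^sub>L T"
    by (simp add: hadj_compose cP T clinear_op_hadj clinear_op_compose hadj_hadj)
  then show ?thesis
    using 1(1) by (metis blinfun_apply_blinfun_compose blinfun_eqI)
qed

section \<open>Tensor products of operators\<close>

lemma norm_tensor_vec: "norm (tensor_vec x y) = norm x * norm y"
proof -
  have "complex_of_real ((norm (tensor_vec x y))\<^sup>2) = complex_of_real ((norm x * norm y)\<^sup>2)"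
    unfolding cinner_self[symmetric] cinner_tensor_vec power_mult_distrib of_real_mult ..
  then have "(norm (tensor_vec x y))\<^sup>2 = (norm x * norm y)\<^sup>2"
    using of_real_eq_iff by blast
  then show ?thesis
    by simp
qed

lemma tensor_vec_right_exists:
  "\<exists>J. clinear_op J \<and> (\<forall>x. J \<cdot> x = tensor_vec x y) \<and> norm J \<le> norm y"
  by (rule clinear_op_of_fun)
    (simp_all add: tensor_vec_add_left tensor_vec_scaleC_left norm_tensor_vec mult.commute)

lemma tensor_vec_left_exists:
  "\<exists>J. clinear_op J \<and> (\<forall>y. J \<cdot> y = tensor_vec x y) \<and> norm J \<le> norm x"
  by (rule clinear_op_of_fun)
    (simp_all add: tensor_vec_add_right tensor_vec_scaleC_right norm_tensor_vec)

definition tensor_right :: "'k::chilbert_space \<Rightarrow> ('h::chilbert_space \<Rightarrow>\<^sub>L ('h, 'k) htensor)" where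
  "tensor_right y = (SOME J. clinear_op J \<and> (\<forall>x. J \<cdot> x = tensor_vec x y))"

definition tensor_left :: "'h::chilbert_space \<Rightarrow> ('k::chilbert_space \<Rightarrow>\<^sub>L ('h, 'k) htensor)" where
  "tensor_left x = (SOME J. clinear_op J \<and> (\<forall>y. J \<cdot> y = tensor_vec x y))"

lemma tensor_right: "clinear_op (tensor_right y)" "tensor_right y \<cdot> x = tensor_vec x y"
  using someI_ex[of "\<lambda>J. clinear_op J \<and> (\<forall>x. J \<cdot> x = tensor_vec x y)"]
    tensor_vec_right_exists[of y] unfolding tensor_right_def by blast+

lemma tensor_left: "clinear_op (tensor_left x)" "tensor_left x \<cdot> y = tensor_vec x y"
  using someI_ex[of "\<lambda>J. clinear_op J \<and> (\<forall>y. J \<cdot> y = tensor_vec x y)"]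
    tensor_vec_left_exists[of x] unfolding tensor_left_def by blast+

lemma tensor_vec_diff_left: "tensor_vec (x - x') y = tensor_vec x y - tensor_vec x' y"
  using blinfun.diff_right[of "tensor_right y" x x'] by (simp only: tensor_right)

lemma tensor_vec_zero_left [simp]: "tensor_vec 0 y = 0"
  using blinfun.zero_right[of "tensor_right y"] by (simp only: tensor_right)

text \<open>
  Totality: if \<open>z\<close> is orthogonal to all \<open>b \<otimes> c\<close>, then its slices along the vectors of
  \<open>C\<close> are orthogonal to \<open>B\<close> and hence zero, so that \<open>z\<close> is orthogonal to all
  \<open>x \<otimes> c\<close>; the same step in the second factor leaves \<open>z = 0\<close>.
\<close>

lemma
  assumes B: "is_onb B" and C: "is_onb C"
  shows is_onb_tensor_image: "is_onb ((\<lambda>(b, c). tensor_vec b c) ` (B \<times> C))"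
    and inj_on_tensor_vec: "inj_on (\<lambda>(b, c). tensor_vec b c) (B \<times> C)"
proof -
  have oB: "cinner x y = (if x = y then 1 else 0)" if "x \<in> B" "y \<in> B" for x y
    using B that unfolding is_onb_def orthonormal_def by blast
  have oC: "cinner x y = (if x = y then 1 else 0)" if "x \<in> C" "y \<in> C" for x y
    using C that unfolding is_onb_def orthonormal_def by blast
  have ip: "cinner (tensor_vec b c) (tensor_vec b' c') = (if b = b' \<and> c = c' then 1 else 0)"
    if "b \<in> B" "c \<in> C" "b' \<in> B" "c' \<in> C" for b c b' c'
    by (simp add: cinner_tensor_vec oB oC that)
  have eq: "b = b' \<and> c = c'"
    if "b \<in> B" "c \<in> C" "b' \<in> B" "c' \<in> C" "tensor_vec b c = tensor_vec b' c'" for b c b' c'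
    using ip[OF that(1-4)] ip[OF that(1,2,1,2)] unfolding that(5) by (simp split: if_splits)
  show "inj_on (\<lambda>(b, c). tensor_vec b c) (B \<times> C)"
    unfolding inj_on_def using eq by (simp add: split_paired_all)
  have total: "z = 0" if z: "\<And>b c. b \<in> B \<Longrightarrow> c \<in> C \<Longrightarrow> cinner (tensor_vec b c) z = 0" for z
  proof -
    have "hadj (tensor_right c) \<cdot> z = 0" if c: "c \<in> C" for c
      by (rule is_onb_ext[OF B]) (simp add: cinner_hadj_right tensor_right z c)
    then have 1: "cinner (tensor_vec x c) z = 0" if "c \<in> C" for x c
      using that cinner_hadj_right[OF tensor_right(1), of x c z] by (simp add: tensor_right)
    have "hadj (tensor_left x) \<cdot> z = 0" for x
      by (rule is_onb_ext[OF C]) (simp add: cinner_hadj_right tensor_left 1)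
    then have "cinner (tensor_vec x y) z = 0" for x y
      using cinner_hadj_right[OF tensor_left(1), of y x z] by (simp add: tensor_left)
    then show "z = 0"
      by (intro is_onb_ext[OF is_onb_tensor_vec]) auto
  qed
  then show "is_onb ((\<lambda>(b, c). tensor_vec b c) ` (B \<times> C))"
    unfolding is_onb_def orthonormal_def
  proof (intro conjI ballI allI impI)
    fix u v assume "u \<in> (\<lambda>(b, c). tensor_vec b c) ` (B \<times> C)" "v \<in> (\<lambda>(b, c). tensor_vec b c) ` (B \<times> C)"
    then obtain b c b' c' where uv: "u = tensor_vec b c" "v = tensor_vec b' c'"
      and mem: "b \<in> B" "c \<in> C" "b' \<in> B" "c' \<in> C"
      by (elim imageE SigmaE) simp
    have "u = v \<longleftrightarrow> b = b' \<and> c = c'"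
      unfolding uv using eq[OF mem] by blast
    then show "cinner u v = (if u = v then 1 else 0)"
      unfolding uv ip[OF mem] by simp
  next
    fix z assume "\<forall>e\<in>(\<lambda>(b, c). tensor_vec b c) ` (B \<times> C). cinner e z = 0"
    then have "cinner (tensor_vec b c) z = 0" if "b \<in> B" "c \<in> C" for b c
      using that by blast
    then show "z = 0"
      by (rule total)
  qed
qed

lemma is_onb_tensor:
  assumes "is_onb B" "is_onb C"
  shows "is_onb {tensor_vec b c |b c. b \<in> B \<and> c \<in> C}"
proof -
  have "(\<lambda>(b, c). tensor_vec b c) ` (B \<times> C) = {tensor_vec b c |b c. b \<in> B \<and> c \<in> C}"
    by auto
  then show ?thesis
    using is_onb_tensor_image[OF assms] by metis
qed

lemma clinear_op_eq_on_tensors: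
  assumes "clinear_op S" "clinear_op T"
    and "\<And>x y. S \<cdot> (tensor_vec x y) = T \<cdot> (tensor_vec x y)"
  shows "S = T"
  by (rule clinear_op_eq_on_onb[OF assms(1,2) is_onb_tensor_vec]) (auto simp: assms(3))

lemma tensor_ext:
  assumes "\<And>x y. cinner (tensor_vec x y) z = cinner (tensor_vec x y) w"
  shows "z = w"
  by (rule is_onb_ext[OF is_onb_tensor_vec]) (auto simp: assms)

lemma norm_unitary_le: "unitary_op U \<Longrightarrow> norm U \<le> 1"
proof (rule norm_blinfun_bound)
  fix x assume U: "unitary_op U"
  have "(norm (U \<cdot> x))\<^sup>2 = cmod (cinner x (hadj U \<cdot> (U \<cdot> x)))"
    by (simp add: cinner_hadj_right[OF unitary_opD(1)[OF U]] cinner_self norm_power)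
  also have "\<dots> = (norm x)\<^sup>2"
    by (simp add: unitary_opD[OF U] cinner_self norm_power)
  finally show "norm (U \<cdot> x) \<le> 1 * norm x"
    by simp
qed simp

lemma tensor_flip_unitary_exists:
  "\<exists>W :: ('h::chilbert_space, 'k::chilbert_space) htensor \<Rightarrow>\<^sub>L ('k, 'h) htensor.
     unitary_op W \<and> (\<forall>x y. W \<cdot> (tensor_vec x y) = tensor_vec y x)"
proof -
  let ?g = "\<lambda>(x::'h, y::'k). tensor_vec x y" and ?g' = "\<lambda>(x::'h, y::'k). tensor_vec y x"
  have im: "?g ` (onb \<times> onb) = {tensor_vec b c |b c. b \<in> onb \<and> c \<in> onb}"
    "?g' ` (onb \<times> onb) = {tensor_vec b c |b c. b \<in> onb \<and> c \<in> onb}"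
    by auto
  have "\<exists>U. unitary_op U \<and> (\<forall>i. U \<cdot> (?g i) = ?g' i)"
    by (rule unitary_from_gram[where ?I0.0 = "onb \<times> onb"], unfold im)
      (auto simp: cinner_tensor_vec is_onb_tensor is_onb_onb)
  then show ?thesis
    by auto
qed

text \<open>
  For \<open>f\<close> in the orthonormal basis of the second factor, the adjoint of
  \<open>tensor_right f\<close> extracts the slice of a vector along \<open>f\<close>. The squared norms
  of the slices sum up to the squared norm of the vector, and an operator on the first factor
  acts slicewise.
\<close>

lemma amplification_exists:
  fixes S :: "'h::chilbert_space op"
  assumes S: "clinear_op S"
  shows "\<exists>R :: ('h, 'k::chilbert_space) htensor op. clinear_op R \<and> norm R \<le> norm S \<and>
    (\<forall>x y. R \<cdot> (tensor_vec x y) = tensor_vec (S \<cdot> x) y)"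
proof -
  define sl where "sl f w = hadj (tensor_right f) \<cdot> w" for f :: 'k and w :: "('h, 'k) htensor"
  have sl: "cinner x (sl f w) = cinner (tensor_vec x f) w" for x f w
    unfolding sl_def by (simp add: cinner_hadj_right tensor_right)
  have slices: "(\<Sum>f\<in>F. (norm (sl f w))\<^sup>2) \<le> (norm w)\<^sup>2" if F: "finite F" "F \<subseteq> onb" for F w
  proof -
    define s where "s = (\<Sum>f\<in>F. tensor_vec (sl f w) f)"
    have sw: "cinner s w = complex_of_real (\<Sum>f\<in>F. (norm (sl f w))\<^sup>2)"
      by (simp add: s_def cinner_sum_left sl[symmetric] cinner_self)
    have "cinner s s = (\<Sum>g\<in>F. \<Sum>f\<in>F. cinner (sl g w) (sl f w) * (if g = f then 1 else 0))"
      using F by (auto simp: s_def cinner_sum_left cinner_sum_right cinner_tensor_vec cinner_onb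
          subset_iff intro!: sum.cong)
    also have "\<dots> = complex_of_real (\<Sum>f\<in>F. (norm (sl f w))\<^sup>2)"
      using F by (simp add: if_distrib sum.delta cinner_self cong: if_cong)
    finally have ss: "(norm s)\<^sup>2 = (\<Sum>f\<in>F. (norm (sl f w))\<^sup>2)"
      unfolding cinner_self using of_real_eq_iff by blast
    have "(norm s)\<^sup>2 = cmod (cinner s w)"
      unfolding sw ss[symmetric] norm_of_real by simp
    also have "\<dots> \<le> norm s * norm w"
      by (rule cinner_cauchy_schwarz)
    finally have "norm s \<le> norm w"
      by (cases "norm s = 0") (simp_all add: power2_eq_square)
    then show ?thesis
      using ss power_mono[of "norm s" "norm w" 2] by simp
  qed
  have bound: "(\<Sum>i\<in>F. (cmod (cinner (tensor_vec (S \<cdot> (fst i)) (snd i)) w))\<^sup>2) \<le> (norm S)\<^sup>2 * (norm w)\<^sup>2"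
    if F: "finite F" "F \<subseteq> onb \<times> onb" for F and w :: "('h, 'k) htensor"
  proof -
    let ?t = "\<lambda>e f. (cmod (cinner (tensor_vec (S \<cdot> e) f) w))\<^sup>2"
    have "(\<Sum>i\<in>F. ?t (fst i) (snd i)) \<le> (\<Sum>i\<in>fst ` F \<times> snd ` F. ?t (fst i) (snd i))"
      by (rule sum_mono2) (use F in \<open>auto intro: rev_image_eqI\<close>)
    also have "\<dots> = (\<Sum>e\<in>fst ` F. \<Sum>f\<in>snd ` F. ?t e f)"
      by (simp add: sum.cartesian_product case_prod_beta)
    also have "\<dots> = (\<Sum>f\<in>snd ` F. \<Sum>e\<in>fst ` F. ?t e f)"
      by (rule sum.swap)
    also have "\<dots> \<le> (\<Sum>f\<in>snd ` F. (norm S)\<^sup>2 * (norm (sl f w))\<^sup>2)"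
    proof (rule sum_mono)
      fix f
      have "(\<Sum>e\<in>fst ` F. ?t e f) = (\<Sum>e\<in>fst ` F. (cmod (cinner e (hadj S \<cdot> (sl f w))))\<^sup>2)"
        by (simp add: cinner_hadj_right[OF S] sl)
      also have "\<dots> \<le> (norm (hadj S \<cdot> (sl f w)))\<^sup>2"
        by (rule bessel_inequality) (use F in \<open>auto intro!: orthonormal_subset[OF orthonormal_onb]\<close>)
      also have "\<dots> \<le> (norm S * norm (sl f w))\<^sup>2"
        using norm_blinfun[of "hadj S" "sl f w"] by (simp add: norm_hadj[OF S])
      finally show "(\<Sum>e\<in>fst ` F. ?t e f) \<le> (norm S)\<^sup>2 * (norm (sl f w))\<^sup>2"
        by (simp add: power_mult_distrib)
    qed
    also have "\<dots> \<le> (norm S)\<^sup>2 * (norm w)\<^sup>2"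
      unfolding sum_distrib_left[symmetric]
      by (intro mult_left_mono slices) (use F in auto)
    finally show ?thesis .
  qed
  have "\<exists>R :: ('h, 'k) htensor op. clinear_op R \<and> norm R \<le> norm S \<and> (\<forall>i\<in>onb \<times> onb.
      R \<cdot> ((\<lambda>(b, c). tensor_vec b c) i) = tensor_vec (S \<cdot> (fst i)) (snd i))"
    by (rule operator_from_basis[OF is_onb_tensor_image[OF is_onb_onb is_onb_onb]
          inj_on_tensor_vec[OF is_onb_onb is_onb_onb] norm_ge_zero]) (rule bound)
  then obtain R :: "('h, 'k) htensor op" where R: "clinear_op R" "norm R \<le> norm S"
    "\<forall>i\<in>onb \<times> onb. R \<cdot> ((\<lambda>(b, c). tensor_vec b c) i) = tensor_vec (S \<cdot> (fst i)) (snd i)"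
    by blast
  have "R o\<^sub>L tensor_right f = tensor_right f o\<^sub>L S" if "f \<in> onb" for f
    by (rule clinear_op_eq_on_onb[OF _ _ is_onb_onb])
      (use R that S in \<open>auto simp: tensor_right intro!: clinear_op_compose\<close>)
  then have 1: "R \<cdot> (tensor_vec x f) = tensor_vec (S \<cdot> x) f" if "f \<in> onb" for x f
    using that by (metis blinfun_apply_blinfun_compose tensor_right(2))
  have "R o\<^sub>L tensor_left x = tensor_left (S \<cdot> x)" for x
    by (rule clinear_op_eq_on_onb[OF _ _ is_onb_onb])
      (use R 1 in \<open>auto simp: tensor_left intro!: clinear_op_compose\<close>)
  then have "R \<cdot> (tensor_vec x y) = tensor_vec (S \<cdot> x) y" for x y
    by (metis blinfun_apply_blinfun_compose tensor_left(2))
  then show ?thesis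
    using R by blast
qed

text \<open>
  \<open>S \<otimes> T = (S \<otimes> 1) (1 \<otimes> T)\<close>, where \<open>1 \<otimes> T\<close> is the amplification of \<open>T\<close>
  conjugated with the flip.
\<close>

lemma tensor_op_exists:
  fixes S :: "'h::chilbert_space op" and T :: "'k::chilbert_space op"
  assumes S: "clinear_op S" and T: "clinear_op T"
  shows "\<exists>R. clinear_op R \<and> norm R \<le> norm S * norm T \<and>
    (\<forall>x y. R \<cdot> (tensor_vec x y) = tensor_vec (S \<cdot> x) (T \<cdot> y))"
proof -
  obtain R :: "('h, 'k) htensor op" where R: "clinear_op R" "norm R \<le> norm S"
    "\<And>x y. R \<cdot> (tensor_vec x y) = tensor_vec (S \<cdot> x) y"
    using amplification_exists[OF S] by blast
  obtain Q :: "('k, 'h) htensor op" where Q: "clinear_op Q" "norm Q \<le> norm T"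
    "\<And>x y. Q \<cdot> (tensor_vec x y) = tensor_vec (T \<cdot> x) y"
    using amplification_exists[OF T] by blast
  obtain W :: "('h, 'k) htensor \<Rightarrow>\<^sub>L ('k, 'h) htensor" where
    W: "unitary_op W" "\<And>x y. W \<cdot> (tensor_vec x y) = tensor_vec y x"
    using tensor_flip_unitary_exists by blast
  have W': "hadj W \<cdot> (tensor_vec y x) = tensor_vec x y" for x y
    using unitary_opD(5)[OF W(1), of "tensor_vec x y"] by (simp add: W)
  let ?P = "R o\<^sub>L (hadj W o\<^sub>L (Q o\<^sub>L W))"
  have n: "norm W \<le> 1" "norm (hadj W) \<le> 1"
    using norm_unitary_le[OF W(1)] norm_hadj[OF unitary_opD(1)[OF W(1)]] by simp_all
  have "norm ?P \<le> norm R * (norm (hadj W) * (norm Q * norm W))"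
    by (meson mult_left_mono norm_blinfun_compose norm_ge_zero order_trans)
  also have "\<dots> \<le> norm S * (1 * (norm T * 1))"
    by (intro mult_mono R Q n mult_nonneg_nonneg) simp_all
  finally show ?thesis
    by (intro exI[of _ ?P])
      (use R Q W W' unitary_opD[OF W(1)] in \<open>auto intro!: clinear_op_compose\<close>)
qed

lemma tensor_op_unique:
  assumes "clinear_op R"
    and "\<And>x y. R \<cdot> (tensor_vec x y) = tensor_vec (S \<cdot> x) (T \<cdot> y)"
  shows "tensor_op S T = R"
  unfolding tensor_op_def bounded_ops_iff
  by (rule the_equality) (use assms in \<open>auto intro: clinear_op_eq_on_tensors\<close>)

lemma
  assumes "clinear_op S" "clinear_op T"
  shows clinear_op_tensor_op: "clinear_op (tensor_op S T)"
    and tensor_op_apply: "tensor_op S T \<cdot> (tensor_vec x y)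
      = tensor_vec (S \<cdot> x) (T \<cdot> y)"
    and norm_tensor_op_le: "norm (tensor_op S T) \<le> norm S * norm T"
  using tensor_op_exists[OF assms] tensor_op_unique[of _ S T] by auto

lemma tensor_op_compose:
  assumes "clinear_op S" "clinear_op T" "clinear_op S'" "clinear_op T'"
  shows "tensor_op S T o\<^sub>L tensor_op S' T' = tensor_op (S o\<^sub>L S') (T o\<^sub>L T')"
  by (rule tensor_op_unique[symmetric])
    (simp_all add: assms clinear_op_compose clinear_op_tensor_op tensor_op_apply)

lemma hadj_tensor_op:
  assumes "clinear_op S" "clinear_op T"
  shows "hadj (tensor_op S T) = tensor_op (hadj S) (hadj T)"
  by (rule tensor_op_unique[symmetric], (intro clinear_op_hadj clinear_op_tensor_op assms),
      rule tensor_ext)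
    (simp add: assms clinear_op_tensor_op tensor_op_apply cinner_hadj_right cinner_tensor_vec)

lemma tensor_op_id: "tensor_op id_blinfun id_blinfun = id_blinfun"
  by (rule tensor_op_unique) (simp_all add: clinear_op_id)

lemma tensor_op_add_left:
  assumes "clinear_op S" "clinear_op S'" "clinear_op T"
  shows "tensor_op (S + S') T = tensor_op S T + tensor_op S' T"
  by (rule tensor_op_unique)
    (simp_all add: assms clinear_op_add clinear_op_tensor_op tensor_op_apply blinfun.add_left tensor_vec_add_left)

lemma tensor_op_add_right:
  assumes "clinear_op S" "clinear_op T" "clinear_op T'"
  shows "tensor_op S (T + T') = tensor_op S T + tensor_op S T'"
  by (rule tensor_op_unique)
    (simp_all add: assms clinear_op_add clinear_op_tensor_op tensor_op_apply blinfun.add_left tensor_vec_add_right)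

lemma tensor_op_scale_left:
  assumes "clinear_op S" "clinear_op T"
  shows "tensor_op (scale_op c S) T = scale_op c (tensor_op S T)"
  by (rule tensor_op_unique)
    (simp_all add: assms clinear_op_scale clinear_op_tensor_op tensor_op_apply scale_op_apply tensor_vec_scaleC_left)

lemma tensor_op_scale_right:
  assumes "clinear_op S" "clinear_op T"
  shows "tensor_op S (scale_op c T) = scale_op c (tensor_op S T)"
  by (rule tensor_op_unique)
    (simp_all add: assms clinear_op_scale clinear_op_tensor_op tensor_op_apply scale_op_apply tensor_vec_scaleC_right)

lemma clinear_op_eq_on_tensor_triples:
  assumes "clinear_op S" "clinear_op T"
    and eq: "\<And>x y z. S \<cdot> (tensor_vec (tensor_vec x y) z) = T \<cdot> (tensor_vec (tensor_vec x y) z)"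
  shows "S = T"
proof (rule clinear_op_eq_on_tensors[OF assms(1,2)])
  fix u z
  have "S o\<^sub>L tensor_right z = T o\<^sub>L tensor_right z"
    by (rule clinear_op_eq_on_tensors)
      (simp_all add: assms clinear_op_compose tensor_right)
  from arg_cong[OF this, of "\<lambda>R. R \<cdot> u"]
  show "S \<cdot> (tensor_vec u z) = T \<cdot> (tensor_vec u z)"
    by (simp add: tensor_right)
qed

lemma clinear_op_eq_on_tensor_quadruples:
  assumes "clinear_op S" "clinear_op T"
    and eq: "\<And>x y z w. S \<cdot> (tensor_vec (tensor_vec x y) (tensor_vec z w))
      = T \<cdot> (tensor_vec (tensor_vec x y) (tensor_vec z w))"
  shows "S = T"
proof (rule clinear_op_eq_on_tensor_triples[OF assms(1,2)])
  fix x y u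
  have "S o\<^sub>L tensor_left (tensor_vec x y) = T o\<^sub>L tensor_left (tensor_vec x y)"
    by (rule clinear_op_eq_on_tensors)
      (simp_all add: assms clinear_op_compose tensor_left)
  from arg_cong[OF this, of "\<lambda>R. R \<cdot> u"]
  show "S \<cdot> (tensor_vec (tensor_vec x y) u) = T \<cdot> (tensor_vec (tensor_vec x y) u)"
    by (simp add: tensor_left)
qed

text \<open>
  The unitaries behind the embeddings \<open>a \<otimes> b \<mapsto> a \<otimes> 1 \<otimes> b\<close> and
  \<open>a \<otimes> b \<mapsto> 1 \<otimes> a \<otimes> b\<close>, both of which are amplifications
  \<open>a \<otimes> b \<otimes> 1\<close> followed by a permutation of the factors.
\<close>

lemma tensor_swap_last_exists:
  "\<exists>W :: (('h::chilbert_space, 'k::chilbert_space) htensor, 'l::chilbert_space) htensor \<Rightarrow>\<^sub>L (('h, 'l) htensor, 'k) htensor.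
     unitary_op W \<and> (\<forall>x y z. W \<cdot> (tensor_vec (tensor_vec x y) z) = tensor_vec (tensor_vec x z) y)"
proof -
  let ?g = "\<lambda>((x::'h, y::'k), z::'l). tensor_vec (tensor_vec x y) z"
  let ?g' = "\<lambda>((x::'h, y::'k), z::'l). tensor_vec (tensor_vec x z) y"
  let ?I = "(onb \<times> onb) \<times> onb"
  have im: "?g ` ?I = {tensor_vec b c |b c. b \<in> {tensor_vec b c |b c. b \<in> onb \<and> c \<in> onb} \<and> c \<in> onb}"
    "?g' ` ?I = {tensor_vec b c |b c. b \<in> {tensor_vec b c |b c. b \<in> onb \<and> c \<in> onb} \<and> c \<in> onb}"
    unfolding image_def Bex_def split_paired_Ex by (simp_all, blast+)
  have onb: "is_onb (?g ` ?I)" "is_onb (?g' ` ?I)"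
    unfolding im by (intro is_onb_tensor is_onb_onb)+
  have "\<exists>U. unitary_op U \<and> (\<forall>i. U \<cdot> (?g i) = ?g' i)"
    by (rule unitary_from_gram[OF _ onb]) (auto simp: cinner_tensor_vec)
  then show ?thesis
    by auto
qed

lemma tensor_rotate_exists:
  "\<exists>W :: (('h::chilbert_space, 'k::chilbert_space) htensor, 'l::chilbert_space) htensor \<Rightarrow>\<^sub>L (('l, 'h) htensor, 'k) htensor.
     unitary_op W \<and> (\<forall>x y z. W \<cdot> (tensor_vec (tensor_vec x y) z) = tensor_vec (tensor_vec z x) y)"
proof -
  let ?g = "\<lambda>((x::'h, y::'k), z::'l). tensor_vec (tensor_vec x y) z"
  let ?g' = "\<lambda>((x::'h, y::'k), z::'l). tensor_vec (tensor_vec z x) y"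
  let ?I = "(onb \<times> onb) \<times> onb"
  have im: "?g ` ?I = {tensor_vec b c |b c. b \<in> {tensor_vec b c |b c. b \<in> onb \<and> c \<in> onb} \<and> c \<in> onb}"
    "?g' ` ?I = {tensor_vec b c |b c. b \<in> {tensor_vec b c |b c. b \<in> onb \<and> c \<in> onb} \<and> c \<in> onb}"
    unfolding image_def Bex_def split_paired_Ex by (simp_all, blast+)
  have onb: "is_onb (?g ` ?I)" "is_onb (?g' ` ?I)"
    unfolding im by (intro is_onb_tensor is_onb_onb)+
  have "\<exists>U. unitary_op U \<and> (\<forall>i. U \<cdot> (?g i) = ?g' i)"
    by (rule unitary_from_gram[OF _ onb]) (auto simp: cinner_tensor_vec)
  then show ?thesis
    by auto
qed

lemma tensor_middle_swap_exists:
  "\<exists>W :: (('h::chilbert_space, 'h) htensor, ('k::chilbert_space, 'k) htensor) htensor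
      \<Rightarrow>\<^sub>L (('h, 'k) htensor, ('h, 'k) htensor) htensor.
     unitary_op W \<and> (\<forall>x x' y y'. W \<cdot> (tensor_vec (tensor_vec x x') (tensor_vec y y'))
       = tensor_vec (tensor_vec x y) (tensor_vec x' y'))"
proof -
  let ?B = "\<lambda>B C. {tensor_vec b c |b c. b \<in> B \<and> c \<in> C}"
  let ?g = "\<lambda>((x::'h, x'::'h), (y::'k, y'::'k)). tensor_vec (tensor_vec x x') (tensor_vec y y')"
  let ?g' = "\<lambda>((x::'h, x'::'h), (y::'k, y'::'k)). tensor_vec (tensor_vec x y) (tensor_vec x' y')"
  let ?I = "(onb \<times> onb) \<times> (onb \<times> onb)"
  have im: "?g ` ?I = ?B (?B onb onb) (?B onb onb)" "?g' ` ?I = ?B (?B onb onb) (?B onb onb)"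
    unfolding image_def Bex_def split_paired_Ex by (simp_all, blast+)
  have onb: "is_onb (?g ` ?I)" "is_onb (?g' ` ?I)"
    unfolding im by (intro is_onb_tensor is_onb_onb)+
  have "\<exists>U. unitary_op U \<and> (\<forall>i. U \<cdot> (?g i) = ?g' i)"
    by (rule unitary_from_gram[OF _ onb]) (auto simp: cinner_tensor_vec)
  then show ?thesis
    by auto
qed

section \<open>Concrete C*-algebras\<close>

definition star_subalgebra :: "'h::chilbert_space op set \<Rightarrow> bool" where
  "star_subalgebra S \<longleftrightarrow> (\<forall>T\<in>S. clinear_op T) \<and> subspace S \<and> closed S \<and> id_blinfun \<in> S \<and>
     (\<forall>c. \<forall>T\<in>S. scale_op c T \<in> S) \<and> (\<forall>T\<in>S. \<forall>R\<in>S. T o\<^sub>L R \<in> S) \<and> (\<forall>T\<in>S. hadj T \<in> S)"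

lemma star_subalgebraD:
  assumes "star_subalgebra S"
  shows "T \<in> S \<Longrightarrow> clinear_op T" "subspace S" "closed S" "id_blinfun \<in> S"
    "T \<in> S \<Longrightarrow> scale_op c T \<in> S" "T \<in> S \<Longrightarrow> R \<in> S \<Longrightarrow> T o\<^sub>L R \<in> S" "T \<in> S \<Longrightarrow> hadj T \<in> S"
    "0 \<in> S" "T \<in> S \<Longrightarrow> R \<in> S \<Longrightarrow> T + R \<in> S" "T \<in> S \<Longrightarrow> R \<in> S \<Longrightarrow> T - R \<in> S" "T \<in> S \<Longrightarrow> - T \<in> S"
    "T \<in> S \<Longrightarrow> r *\<^sub>R T \<in> S"
  using assms unfolding star_subalgebra_def
  by (auto intro: subspace_0 subspace_add subspace_diff subspace_neg subspace_scale)

lemma operator_algebra_simps [simp]: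
  "carrier (operator_algebra S) = S" "mult (operator_algebra S) = (o\<^sub>L)"
  "one (operator_algebra S) = id_blinfun" "zero (operator_algebra S) = 0"
  "add (operator_algebra S) = (+)" "smult (operator_algebra S) = scale_op"
  "star (operator_algebra S) = hadj" "cnorm (operator_algebra S) = norm"
  by (simp_all add: operator_algebra_def adjoint_op_eq_hadj)

lemma cring_complex_field: "cring complex_field"
proof (rule cringI)
  show "abelian_group complex_field"
    by (rule abelian_groupI) (auto simp: complex_field_def intro: exI[of _ "- x" for x] left_minus)
  show "comm_monoid complex_field"
    by (rule comm_monoidI) (auto simp: complex_field_def)
qed (simp add: complex_field_def distrib_right)

lemma scale_op_compose: "scale_op c S o\<^sub>L T = scale_op c (S o\<^sub>L T)"
  by (rule blinfun_eqI) (simp add: scale_op_apply)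

lemma compose_scale_op: "clinear_op S \<Longrightarrow> S o\<^sub>L scale_op c T = scale_op c (S o\<^sub>L T)"
  by (rule blinfun_eqI) (simp add: scale_op_apply clinear_opD)

lemma unital_cstar_algebra_operator_algebra:
  assumes S: "star_subalgebra S"
  shows "unital_cstar_algebra (operator_algebra S)"
proof -
  note SD = star_subalgebraD[OF S]
  have ag: "abelian_group (operator_algebra S)"
  proof (rule abelian_groupI)
    fix x assume "x \<in> carrier (operator_algebra S)"
    then show "\<exists>y\<in>carrier (operator_algebra S). y \<oplus>\<^bsub>operator_algebra S\<^esub> x = \<zero>\<^bsub>operator_algebra S\<^esub>"
      by (intro bexI[of _ "- x"]) (simp_all add: SD)
  qed (simp_all add: SD)
  have ring: "ring (operator_algebra S)"
  proof (rule ringI[OF ag])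
    show "monoid (operator_algebra S)"
      by (rule monoidI) (simp_all add: SD blinfun_eqI)
  qed (auto simp: blinfun.add_left blinfun.add_right intro!: blinfun_eqI)
  interpret abelian_group "operator_algebra S" by (rule ag)
  have minus: "a \<ominus>\<^bsub>operator_algebra S\<^esub> b = a - b" if "a \<in> S" "b \<in> S" for a b
    using minus_equality[of "- b" b] that by (simp add: a_minus_def SD)
  have module: "module complex_field (operator_algebra S)"
    by (rule moduleI[OF cring_complex_field ag])
      (auto simp: complex_field_def SD intro!: blinfun_eqI
        simp: scale_op_apply blinfun.add_left scaleC_add_left scaleC_add_right scaleC_scaleC)
  show ?thesis
    unfolding unital_cstar_algebra_def unital_cstar_algebra_axioms_def
  proof (intro conjI ring module allI impI; (unfold operator_algebra_simps)?)
    fix X :: "nat \<Rightarrow> 'a op"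
    assume X: "\<forall>n. X n \<in> S"
      and C: "\<forall>e>0. \<exists>N. \<forall>m\<ge>N. \<forall>n\<ge>N. norm (X m \<ominus>\<^bsub>operator_algebra S\<^esub> X n) < e"
    have "Cauchy X"
      unfolding Cauchy_def using C X by (simp add: minus dist_norm)
    then obtain x where x: "X \<longlonglongrightarrow> x"
      using Cauchy_convergent convergent_def by blast
    have "x \<in> S"
      using closed_sequentially[OF SD(3) _ x] X by simp
    moreover have "(\<lambda>n. norm (X n - x)) \<longlonglongrightarrow> 0"
      using x by (simp add: LIM_zero tendsto_norm_zero)
    ultimately show "\<exists>x\<in>S. (\<lambda>n. norm (X n \<ominus>\<^bsub>operator_algebra S\<^esub> x)) \<longlonglongrightarrow> 0"
      using X by (auto simp: minus)
  next
    fix x assume "x \<in> S"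
    then show "norm (hadj x o\<^sub>L x) = (norm x)\<^sup>2"
      by (simp add: cstar_identity_op SD(1))
  qed (simp_all add: SD(1,7) scale_op_compose compose_scale_op hadj_hadj hadj_add hadj_scale hadj_compose
      norm_scale_op norm_triangle_ineq norm_blinfun_compose)
qed

lemma operator_algebra_minus:
  assumes S: "star_subalgebra S" and ab: "a \<in> S" "b \<in> S"
  shows "a \<ominus>\<^bsub>operator_algebra S\<^esub> b = a - b"
proof -
  interpret unital_cstar_algebra "operator_algebra S"
    by (rule unital_cstar_algebra_operator_algebra[OF S])
  show ?thesis
    using minus_equality[of "- b" b] ab by (simp add: a_minus_def star_subalgebraD[OF S])
qed

text \<open>
  A bounded map that is linear on a closed subspace \<open>D\<close> is controlled on the closed
  span of a set \<open>G\<close> by its values on \<open>G\<close>. The map is not assumed to behave well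
  off \<open>D\<close>, since adjoints and tensor products of operators have no meaning for operators
  that are only real linear.
\<close>

lemma closure_span_map:
  fixes \<Phi> :: "'a::real_normed_vector \<Rightarrow> 'b::real_normed_vector"
  assumes D: "subspace D" "closed D" and X: "subspace X" "closed X"
    and add: "\<And>S T. S \<in> D \<Longrightarrow> T \<in> D \<Longrightarrow> \<Phi> (S + T) = \<Phi> S + \<Phi> T"
    and scale: "\<And>r T. T \<in> D \<Longrightarrow> \<Phi> (r *\<^sub>R T) = r *\<^sub>R \<Phi> T"
    and bound: "\<And>T. T \<in> D \<Longrightarrow> norm (\<Phi> T) \<le> K * norm T"
    and G: "G \<subseteq> D" "\<And>g. g \<in> G \<Longrightarrow> \<Phi> g \<in> X" and T: "T \<in> closure (span G)"
  shows "T \<in> D" "\<Phi> T \<in> X"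
proof -
  let ?P = "{T \<in> D. \<Phi> T \<in> X}"
  have zero: "\<Phi> 0 = 0"
    using scale[of 0 0] subspace_0[OF D(1)] by simp
  have "subspace ?P"
  proof (rule subspaceI)
    show "0 \<in> ?P"
      using subspace_0[OF D(1)] subspace_0[OF X(1)] by (simp add: zero)
    show "S + T \<in> ?P" if "S \<in> ?P" "T \<in> ?P" for S T
      using that subspace_add[OF D(1)] subspace_add[OF X(1)] by (simp add: add)
    show "r *\<^sub>R T \<in> ?P" if "T \<in> ?P" for r T
      using that subspace_scale[OF D(1)] subspace_scale[OF X(1)] by (simp add: scale)
  qed
  have "closed ?P"
    unfolding closed_sequential_limits
  proof (intro allI impI)
    fix f l assume "(\<forall>n. f n \<in> ?P) \<and> f \<longlonglongrightarrow> l"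
    then have f: "\<And>n. f n \<in> D" "\<And>n. \<Phi> (f n) \<in> X" and lim: "f \<longlonglongrightarrow> l"
      by auto
    have l: "l \<in> D"
      using closed_sequentially[OF D(2) _ lim] f by simp
    have le: "norm (\<Phi> (f n) - \<Phi> l) \<le> K * norm (f n - l)" for n
    proof -
      have mem: "f n - l \<in> D"
        by (rule subspace_diff[OF D(1) f(1) l])
      have "\<Phi> (f n - l + l) = \<Phi> (f n - l) + \<Phi> l"
        by (rule add[OF mem l])
      then have "\<Phi> (f n) - \<Phi> l = \<Phi> (f n - l)"
        by (simp only: diff_add_cancel add_diff_cancel_right')
      then show ?thesis
        using bound[OF mem] by (simp only:)
    qed
    have "(\<lambda>n. K * norm (f n - l)) \<longlonglongrightarrow> 0"
      by (rule tendsto_mult_right_zero[OF tendsto_norm_zero[OF LIM_zero[OF lim]]])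
    then have "(\<lambda>n. \<Phi> (f n) - \<Phi> l) \<longlonglongrightarrow> 0"
      by (rule Lim_null_comparison[OF always_eventually, rotated]) (use le in blast)
    then have "(\<lambda>n. \<Phi> (f n)) \<longlonglongrightarrow> \<Phi> l"
      by (rule LIM_zero_cancel)
    then have "\<Phi> l \<in> X"
      by (rule closed_sequentially[OF X(2), rotated]) (rule f(2))
    then show "l \<in> ?P"
      using l by simp
  qed
  moreover have "span G \<subseteq> ?P"
    using G \<open>subspace ?P\<close> by (intro span_minimal) auto
  ultimately have "closure (span G) \<subseteq> ?P"
    by (intro closure_minimal)
  then show "T \<in> D" "\<Phi> T \<in> X"
    using T by auto
qed

lemma closure_span_linear_map:
  assumes "bounded_linear \<Phi>" "subspace X" "closed X" "\<And>g. g \<in> G \<Longrightarrow> \<Phi> g \<in> X" "T \<in> closure (span G)"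
  shows "\<Phi> T \<in> X"
proof -
  interpret bounded_linear \<Phi> by fact
  obtain K where K: "\<And>x. norm (\<Phi> x) \<le> norm x * K"
    using bounded by blast
  show ?thesis
  proof (rule closure_span_map(2)[where D = UNIV and K = K, OF subspace_UNIV closed_UNIV assms(2,3) _ _ _ subset_UNIV _ assms(5)])
    show "norm (\<Phi> T) \<le> K * norm T" for T
      using K[of T] by (simp only: mult.commute)
  qed (simp_all only: add scaleR assms(4))
qed

lemma clinear_ops_closed_subspace:
  "subspace (Collect (clinear_op :: ('h::chilbert_space \<Rightarrow>\<^sub>L 'k::chilbert_space) \<Rightarrow> bool))"
  "closed (Collect (clinear_op :: ('h \<Rightarrow>\<^sub>L 'k) \<Rightarrow> bool))"
proof -
  show "subspace (Collect (clinear_op :: ('h \<Rightarrow>\<^sub>L 'k) \<Rightarrow> bool))"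
    unfolding subspace_def by (simp add: clinear_op_add clinear_op_scaleR) (simp add: clinear_op_def)
  let ?Z = "\<lambda>c x. (\<lambda>T :: 'h \<Rightarrow>\<^sub>L 'k. T \<cdot> (c *\<^sub>C x) - c *\<^sub>C T \<cdot> x) -` {0}"
  have "closed (?Z c x)" for c x
  proof -
    have "bounded_linear (\<lambda>T :: 'h \<Rightarrow>\<^sub>L 'k. T \<cdot> (c *\<^sub>C x) - c *\<^sub>C T \<cdot> x)"
      by (intro bounded_linear_sub blinfun.bounded_linear_left
          bounded_linear_compose[OF bounded_linear_scaleC blinfun.bounded_linear_left])
    then show ?thesis
      by (intro continuous_closed_vimage linear_continuous_at closed_singleton)
  qed
  then have "closed (\<Inter>c. \<Inter>x. ?Z c x)"
    by (intro closed_INT ballI)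
  moreover have "(\<Inter>c. \<Inter>x. ?Z c x) = Collect clinear_op"
    unfolding clinear_op_def by auto
  ultimately show "closed (Collect (clinear_op :: ('h \<Rightarrow>\<^sub>L 'k) \<Rightarrow> bool))"
    by simp
qed

lemma star_subalgebra_bounded_ops: "star_subalgebra bounded_ops"
proof -
  have eq: "bounded_ops = Collect (clinear_op :: 'h::chilbert_space op \<Rightarrow> bool)"
    by (auto simp: bounded_ops_iff)
  show ?thesis
    unfolding star_subalgebra_def eq using clinear_ops_closed_subspace
    by (simp add: clinear_op_id clinear_op_scale clinear_op_compose clinear_op_hadj)
qed

lemma bounded_linear_scale_op: "bounded_linear (scale_op c)"
proof (rule bounded_linear_intro[where K = "cmod c"])
  show "scale_op c (S + T) = scale_op c S + scale_op c T" for S T :: "'a op"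
    by (rule blinfun_eqI) (simp add: scale_op_apply blinfun.add_left scaleC_add_right)
  show "scale_op c (r *\<^sub>R T) = r *\<^sub>R scale_op c T" for r and T :: "'a op"
    by (rule blinfun_eqI)
      (simp add: scale_op_apply blinfun.scaleR_left scaleR_scaleC scaleC_scaleC mult.commute)
qed (simp add: norm_scale_op mult.commute)

lemma subspace_closure:
  fixes S :: "'a::real_normed_vector set"
  assumes S: "subspace S"
  shows "subspace (closure S)"
proof (rule subspaceI)
  show "0 \<in> closure S"
    using subspace_0[OF S] closure_subset by blast
next
  fix x y assume "x \<in> closure S" "y \<in> closure S"
  then obtain f g where "\<And>n. f n \<in> S" "f \<longlonglongrightarrow> x" "\<And>n. g n \<in> S" "g \<longlonglongrightarrow> y"
    unfolding closure_sequential by blast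
  then show "x + y \<in> closure S"
    unfolding closure_sequential
    by (intro exI[of _ "\<lambda>n. f n + g n"]) (simp add: subspace_add[OF S] tendsto_add)
next
  fix r x assume "x \<in> closure S"
  then obtain f where "\<And>n. f n \<in> S" "f \<longlonglongrightarrow> x"
    unfolding closure_sequential by blast
  then show "r *\<^sub>R x \<in> closure S"
    unfolding closure_sequential
    by (intro exI[of _ "\<lambda>n. r *\<^sub>R f n"]) (simp add: subspace_scale[OF S] tendsto_scaleR)
qed

text \<open>
  Stability under composition passes to the closed span one factor at a time, the other one being
  kept in \<open>G\<close> at first and then in the closed span.
\<close>

lemma star_subalgebra_generated:
  fixes G :: "'h::chilbert_space op set"
  assumes cl: "\<And>T. T \<in> G \<Longrightarrow> clinear_op T" and id: "id_blinfun \<in> G"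
    and scale: "\<And>c T. T \<in> G \<Longrightarrow> scale_op c T \<in> G"
    and comp: "\<And>S T. S \<in> G \<Longrightarrow> T \<in> G \<Longrightarrow> S o\<^sub>L T \<in> G"
    and adj: "\<And>T. T \<in> G \<Longrightarrow> hadj T \<in> G"
  shows "star_subalgebra (closure (span G))"
proof -
  let ?X = "closure (span G)"
  have X: "subspace ?X" "closed ?X" and GX: "\<And>T. T \<in> G \<Longrightarrow> T \<in> ?X"
    using closure_subset[of "span G"] span_superset[of G] by (simp_all add: subspace_closure subset_iff)
  have D: "subspace (Collect (clinear_op :: 'h op \<Rightarrow> bool))" "closed (Collect (clinear_op :: 'h op \<Rightarrow> bool))"
    by (rule clinear_ops_closed_subspace)+
  have clX: "clinear_op T" if "T \<in> ?X" for T
    using closure_span_map(1)[where \<Phi> = "\<lambda>T. T" and K = 1, OF D X _ _ _ _ _ that] cl GX by auto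
  have 1: "S o\<^sub>L T \<in> ?X" if "S \<in> G" "T \<in> ?X" for S T
    by (rule closure_span_linear_map[OF _ X _ that(2)])
      (auto intro: bounded_bilinear.bounded_linear_right[OF bounded_bilinear_blinfun_compose] GX comp that)
  have 2: "S o\<^sub>L T \<in> ?X" if "S \<in> ?X" "T \<in> ?X" for S T
    by (rule closure_span_linear_map[OF _ X _ that(1)])
      (auto intro: bounded_bilinear.bounded_linear_left[OF bounded_bilinear_blinfun_compose] 1 that)
  have 3: "scale_op c T \<in> ?X" if "T \<in> ?X" for c T
    by (rule closure_span_linear_map[OF bounded_linear_scale_op X _ that]) (intro GX scale)
  have 4: "hadj T \<in> ?X" if "T \<in> ?X" for T
    by (rule closure_span_map(2)[where \<Phi> = hadj and K = 1, OF D X _ _ _ _ _ that])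
      (auto simp: hadj_add hadj_scaleR norm_hadj cl GX adj)
  show ?thesis
    unfolding star_subalgebra_def using X clX 2 3 4 GX id by blast
qed

section \<open>Star homomorphisms that are implemented spatially\<close>

text \<open>
  All homomorphisms in the definition of a compact quantum metric space are restrictions of maps
  of this kind: they are composed of amplifications \<open>T \<mapsto> T \<otimes> 1\<close> and conjugations with
  unitaries that permute tensor factors. The conditions are confined to complex linear operators,
  since \<open>hadj\<close> and \<open>tensor_op\<close> are meaningful only for those.
\<close>

definition spatial_hom :: "('h::chilbert_space op \<Rightarrow> 'k::chilbert_space op) \<Rightarrow> bool" where
  "spatial_hom \<Phi> \<longleftrightarrow> \<Phi> id_blinfun = id_blinfun \<and>
     (\<forall>T. clinear_op T \<longrightarrow> clinear_op (\<Phi> T) \<and> norm (\<Phi> T) \<le> norm T \<and> \<Phi> (hadj T) = hadj (\<Phi> T) \<and>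
        (\<forall>c. \<Phi> (scale_op c T) = scale_op c (\<Phi> T)) \<and>
        (\<forall>S. clinear_op S \<longrightarrow> \<Phi> (S + T) = \<Phi> S + \<Phi> T \<and> \<Phi> (S o\<^sub>L T) = \<Phi> S o\<^sub>L \<Phi> T))"

lemma spatial_homD:
  assumes "spatial_hom \<Phi>"
  shows "\<Phi> id_blinfun = id_blinfun" "clinear_op T \<Longrightarrow> clinear_op (\<Phi> T)"
    "clinear_op T \<Longrightarrow> norm (\<Phi> T) \<le> norm T" "clinear_op T \<Longrightarrow> \<Phi> (hadj T) = hadj (\<Phi> T)"
    "clinear_op T \<Longrightarrow> \<Phi> (scale_op c T) = scale_op c (\<Phi> T)"
    "clinear_op S \<Longrightarrow> clinear_op T \<Longrightarrow> \<Phi> (S + T) = \<Phi> S + \<Phi> T"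
    "clinear_op S \<Longrightarrow> clinear_op T \<Longrightarrow> \<Phi> (S o\<^sub>L T) = \<Phi> S o\<^sub>L \<Phi> T"
  using assms unfolding spatial_hom_def by blast+

lemma spatial_hom_id: "spatial_hom (\<lambda>T. T)"
  unfolding spatial_hom_def by simp

lemma spatial_hom_conjugation:
  fixes U :: "'h::chilbert_space \<Rightarrow>\<^sub>L 'k::chilbert_space"
  assumes U: "unitary_op U"
  shows "spatial_hom (\<lambda>T. U o\<^sub>L (T o\<^sub>L hadj U))"
proof -
  note UD = unitary_opD[OF U]
  have n: "norm U \<le> 1" "norm (hadj U) \<le> 1"
    using norm_unitary_le[OF U] norm_hadj[OF UD(1)] by simp_all
  have nn: "norm (U o\<^sub>L (T o\<^sub>L hadj U)) \<le> norm T" for T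
  proof -
    have "norm (U o\<^sub>L (T o\<^sub>L hadj U)) \<le> norm U * (norm T * norm (hadj U))"
      by (meson mult_left_mono norm_blinfun_compose norm_ge_zero order_trans)
    also have "\<dots> \<le> 1 * (norm T * 1)"
      by (intro mult_mono n mult_nonneg_nonneg) simp_all
    finally show ?thesis by simp
  qed
  show ?thesis
    unfolding spatial_hom_def
  proof (intro conjI allI impI)
    fix T :: "'h op" assume T: "clinear_op T"
    show "U o\<^sub>L (hadj T o\<^sub>L hadj U) = hadj (U o\<^sub>L (T o\<^sub>L hadj U))"
      by (simp add: hadj_compose hadj_hadj clinear_op_compose UD T)
        (simp add: blinfun_eqI)
  qed (auto simp: UD nn clinear_opD scale_op_apply blinfun.add_right blinfun.add_left
      intro!: clinear_op_compose blinfun_eqI)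
qed

lemma spatial_hom_amplification:
  "spatial_hom (\<lambda>T :: 'h::chilbert_space op. tensor_op T (id_blinfun :: 'k::chilbert_space op))"
  unfolding spatial_hom_def
proof (intro conjI allI impI)
  have id: "id_blinfun o\<^sub>L id_blinfun = (id_blinfun :: 'k op)"
    by (rule blinfun_eqI) simp
  show "tensor_op (S o\<^sub>L T) (id_blinfun :: 'k op) = tensor_op S id_blinfun o\<^sub>L tensor_op T id_blinfun"
    if "clinear_op S" "clinear_op T" for S T :: "'h op"
    by (simp add: tensor_op_compose that clinear_op_id id)
  fix T :: "'h op" assume T: "clinear_op T"
  have "norm (tensor_op T (id_blinfun :: 'k op)) \<le> norm T * norm (id_blinfun :: 'k op)"
    by (rule norm_tensor_op_le[OF T clinear_op_id])
  also have "\<dots> \<le> norm T * 1"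
    by (intro mult_left_mono norm_blinfun_bound) simp_all
  finally show "norm (tensor_op T (id_blinfun :: 'k op)) \<le> norm T"
    by simp
qed (simp_all add: tensor_op_id clinear_op_tensor_op clinear_op_id hadj_tensor_op hadj_id
    tensor_op_scale_left tensor_op_add_left)

lemma spatial_hom_compose:
  assumes "spatial_hom \<Phi>" "spatial_hom \<Psi>"
  shows "spatial_hom (\<lambda>T. \<Phi> (\<Psi> T))"
  unfolding spatial_hom_def
  by (auto simp: spatial_homD[OF assms(1)] spatial_homD[OF assms(2)]
      intro: order_trans[OF spatial_homD(3)[OF assms(1)] spatial_homD(3)[OF assms(2)]])

lemma spatial_hom_scaleR: "spatial_hom \<Phi> \<Longrightarrow> clinear_op T \<Longrightarrow> \<Phi> (r *\<^sub>R T) = r *\<^sub>R \<Phi> T"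
  by (simp add: scaleR_eq_scale_op spatial_homD(5))

lemma spatial_hom_closure_span:
  assumes \<Phi>: "spatial_hom \<Phi>" and X: "subspace X" "closed X"
    and G: "\<And>g. g \<in> G \<Longrightarrow> clinear_op g" "\<And>g. g \<in> G \<Longrightarrow> \<Phi> g \<in> X" and T: "T \<in> closure (span G)"
  shows "\<Phi> T \<in> X"
  by (rule closure_span_map(2)[where \<Phi> = \<Phi> and K = 1, OF clinear_ops_closed_subspace X _ _ _ _ _ T])
    (auto simp: spatial_homD[OF \<Phi>] spatial_hom_scaleR[OF \<Phi>] G)

text \<open>
  The uniqueness that makes the description well defined: a bounded *-homomorphism with the
  prescribed values differs from \<open>\<Phi>\<close> by a bounded linear map that vanishes on the
  spanning set.
\<close>

lemma star_hom_extending_spatial: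
  assumes \<Phi>: "spatial_hom \<Phi>" and S: "star_subalgebra S" "S = closure (span G)"
    and S': "star_subalgebra S'"
    and im: "\<And>g. g \<in> G \<Longrightarrow> \<Phi> g \<in> S'"
    and R: "\<And>a b. (a, b) \<in> R \<Longrightarrow> a \<in> S \<and> b = \<Phi> a" "\<And>g. g \<in> G \<Longrightarrow> (g, \<Phi> g) \<in> R"
    and T: "T \<in> S"
  shows "star_hom_extending (operator_algebra S) (operator_algebra S') R T = \<Phi> T" "\<Phi> T \<in> S'"
proof -
  note SD = star_subalgebraD[OF S(1)] and SD' = star_subalgebraD[OF S']
  have GS: "\<And>g. g \<in> G \<Longrightarrow> g \<in> S"
    using R by blast
  have im': "\<Phi> T \<in> S'" if "T \<in> S" for T
    by (rule spatial_hom_closure_span[OF \<Phi> SD'(2,3) _ im]) (use GS SD S(2) that in auto)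
  then show "\<Phi> T \<in> S'"
    using T by blast
  let ?P = "\<lambda>f. f \<in> star_hom (operator_algebra S) (operator_algebra S') \<and>
     f \<in> extensional (carrier (operator_algebra S)) \<and>
     (\<exists>K. \<forall>a\<in>carrier (operator_algebra S). cnorm (operator_algebra S') (f a) \<le> K * cnorm (operator_algebra S) a) \<and>
     (\<forall>(a, b)\<in>R. f a = b)"
  have "star_hom_extending (operator_algebra S) (operator_algebra S') R = restrict \<Phi> S"
    unfolding star_hom_extending_def
  proof (rule the_equality)
    have "restrict \<Phi> S \<in> star_hom (operator_algebra S) (operator_algebra S')"
      unfolding star_hom_def ring_hom_def by (auto simp: spatial_homD[OF \<Phi>] SD im')
    moreover have "norm (\<Phi> a) \<le> 1 * norm a" if "a \<in> S" for a
      using spatial_homD(3)[OF \<Phi> SD(1)[OF that]] by simp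
    ultimately show "?P (restrict \<Phi> S)"
      using R(1) by (auto intro!: exI[of _ 1])
  next
    fix f assume "?P f"
    then have f: "f \<in> star_hom (operator_algebra S) (operator_algebra S')" "f \<in> extensional S"
      and fR: "\<And>a b. (a, b) \<in> R \<Longrightarrow> f a = b" and "\<exists>K. \<forall>a\<in>S. norm (f a) \<le> K * norm a"
      by auto
    then obtain K where K: "\<And>a. a \<in> S \<Longrightarrow> norm (f a) \<le> K * norm a"
      by blast
    have fa: "f (x + y) = f x + f y" "f (scale_op c x) = scale_op c (f x)" if "x \<in> S" "y \<in> S" for x y c
      using f(1) that unfolding star_hom_def ring_hom_def by auto
    show "f = restrict \<Phi> S"
    proof (rule extensionalityI[OF f(2)])
      fix T assume "T \<in> S"
      then have T: "T \<in> closure (span G)"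
        using S(2) by simp
      have "f T - \<Phi> T \<in> {0}"
      proof (rule closure_span_map(2)[where \<Phi> = "\<lambda>T. f T - \<Phi> T" and K = "K + 1", OF SD(2,3) _ _ _ _ _ _ _ T])
        fix T assume T: "T \<in> S"
        have "norm (f T - \<Phi> T) \<le> norm (f T) + norm (\<Phi> T)"
          by (rule norm_triangle_ineq4)
        also have "\<dots> \<le> (K + 1) * norm T"
          using K[OF T] spatial_homD(3)[OF \<Phi> SD(1)[OF T]] by (simp add: distrib_right)
        finally show "norm (f T - \<Phi> T) \<le> (K + 1) * norm T" .
        show "f (r *\<^sub>R T) - \<Phi> (r *\<^sub>R T) = r *\<^sub>R (f T - \<Phi> T)" for r
          using fa(2)[OF T T] spatial_hom_scaleR[OF \<Phi> SD(1)[OF T]]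
          by (simp add: scaleR_eq_scale_op[of r T] scale_op_apply scaleR_diff_right)
            (simp add: scaleR_eq_scale_op)
        fix T' assume "T' \<in> S"
        then show "f (T + T') - \<Phi> (T + T') = f T - \<Phi> T + (f T' - \<Phi> T')"
          using T by (simp add: fa spatial_homD(6)[OF \<Phi>] SD(1))
      qed (use GS fR R in auto)
      then show "f T = restrict \<Phi> S T"
        using \<open>T \<in> S\<close> by simp
    qed simp
  qed
  then show "star_hom_extending (operator_algebra S) (operator_algebra S') R T = \<Phi> T"
    using T by simp
qed

section \<open>Positive operators\<close>

definition positive_op :: "'h::chilbert_space op \<Rightarrow> bool" where
  "positive_op T \<longleftrightarrow> selfadjoint T \<and> (\<forall>x. 0 \<le> inner x (T \<cdot> x))"

lemma inner_selfadjoint: "selfadjoint T \<Longrightarrow> inner (T \<cdot> x) y = inner x (T \<cdot> y)"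
  by (simp add: inner_eq_Re_cinner selfadjointD(3))

lemma cinner_selfadjoint_self:
  assumes "selfadjoint T"
  shows "cinner x (T \<cdot> x) = complex_of_real (inner x (T \<cdot> x))"
proof (rule complex_eqI)
  have "cinner x (T \<cdot> x) = cnj (cinner x (T \<cdot> x))"
    using selfadjointD(3)[OF assms, of x x] cinner_commute by metis
  then have "Im (cinner x (T \<cdot> x)) = - Im (cinner x (T \<cdot> x))"
    by (metis cnj.simps(2))
  then show "Im (cinner x (T \<cdot> x)) = Im (complex_of_real (inner x (T \<cdot> x)))"
    by simp
qed (simp add: inner_eq_Re_cinner)

lemma
  assumes "selfadjoint S" "selfadjoint T"
  shows selfadjoint_add: "selfadjoint (S + T)" and selfadjoint_diff: "selfadjoint (S - T)"
    and selfadjoint_scaleR: "selfadjoint (r *\<^sub>R S)"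
  using assms unfolding selfadjoint_def
  by (simp_all add: clinear_op_add clinear_op_diff clinear_op_scaleR hadj_add hadj_diff hadj_scaleR)

lemma selfadjoint_id: "selfadjoint id_blinfun"
  by (simp add: selfadjoint_def clinear_op_id hadj_id)

lemma selfadjoint_square: "selfadjoint T \<Longrightarrow> selfadjoint (T o\<^sub>L T)"
  unfolding selfadjoint_def by (simp add: clinear_op_compose hadj_compose)

lemma positive_op_hadj_compose:
  assumes "clinear_op (T :: 'h::chilbert_space op)"
  shows "positive_op (hadj T o\<^sub>L T)" "inner x ((hadj T o\<^sub>L T) \<cdot> x) = (norm (T \<cdot> x))\<^sup>2"
proof -
  have eq: "inner z ((hadj T o\<^sub>L T) \<cdot> z) = (norm (T \<cdot> z))\<^sup>2" for z
    by (simp add: inner_eq_Re_cinner cinner_hadj_right[OF assms] cinner_self)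
  then show "inner x ((hadj T o\<^sub>L T) \<cdot> x) = (norm (T \<cdot> x))\<^sup>2" .
  show "positive_op (hadj T o\<^sub>L T)"
    unfolding positive_op_def selfadjoint_def eq
    by (simp add: assms clinear_op_compose clinear_op_hadj hadj_compose hadj_hadj)
qed

text \<open>The Cauchy--Schwarz inequality for the positive semidefinite form given by \<open>T\<close>.\<close>

lemma positive_op_cauchy_schwarz:
  assumes T: "positive_op T"
  shows "(inner x (T \<cdot> y))\<^sup>2 \<le> inner x (T \<cdot> x) * inner y (T \<cdot> y)"
proof -
  let ?a = "inner x (T \<cdot> x)" and ?b = "inner x (T \<cdot> y)" and ?c = "inner y (T \<cdot> y)"
  have sa: "selfadjoint T" and pos: "\<And>x. 0 \<le> inner x (T \<cdot> x)"
    using T unfolding positive_op_def by auto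
  have sym: "inner y (T \<cdot> x) = ?b"
    using inner_selfadjoint[OF sa, of y x] by (simp add: inner_commute)
  have q: "0 \<le> ?a + 2 * t * ?b + t\<^sup>2 * ?c" for t
    using pos[of "x + t *\<^sub>R y"] sym
    by (simp add: blinfun.add_right blinfun.scaleR_right inner_add_left inner_add_right power2_eq_square algebra_simps)
  show ?thesis
  proof (cases "?c = 0")
    case True
    have "?b = 0"
    proof (rule ccontr)
      assume b: "?b \<noteq> 0"
      have "0 \<le> ?a + 2 * (- (?a + 1) / (2 * ?b)) * ?b"
        using q[of "- (?a + 1) / (2 * ?b)"] True by simp
      then show False
        using b by (simp add: field_simps)
    qed
    then show ?thesis
      using True by simp
  next
    case False
    then have c: "?c > 0"
      using pos[of y] by simp
    have "0 \<le> ?a + 2 * (- ?b / ?c) * ?b + (- ?b / ?c)\<^sup>2 * ?c"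
      by (rule q)
    also have "\<dots> = ?a - ?b\<^sup>2 / ?c"
      using c by (simp add: field_simps power2_eq_square)
    finally show ?thesis
      using c by (simp add: field_simps)
  qed
qed

text \<open>
  This and the next lemma apply the Cauchy--Schwarz inequality to \<open>T x\<close> and \<open>x\<close>.
\<close>

lemma positive_op_norm_sq_le:
  assumes T: "positive_op T"
  shows "(norm (T \<cdot> x))\<^sup>2 \<le> norm T * inner x (T \<cdot> x)"
proof -
  let ?y = "T \<cdot> x"
  have sa: "selfadjoint T" and pos: "\<And>x. 0 \<le> inner x (T \<cdot> x)"
    using T unfolding positive_op_def by auto
  have "((norm ?y)\<^sup>2)\<^sup>2 = (inner ?y (T \<cdot> x))\<^sup>2"
    by (simp add: power2_norm_eq_inner)
  also have "\<dots> \<le> inner ?y (T \<cdot> ?y) * inner x ?y"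
    by (rule positive_op_cauchy_schwarz[OF T])
  also have "\<dots> \<le> (norm T * (norm ?y)\<^sup>2) * inner x ?y"
  proof (rule mult_right_mono[OF _ pos])
    have "inner ?y (T \<cdot> ?y) \<le> norm ?y * (norm T * norm ?y)"
      by (rule order_trans[OF norm_cauchy_schwarz]) (intro mult_left_mono norm_blinfun norm_ge_zero)
    then show "inner ?y (T \<cdot> ?y) \<le> norm T * (norm ?y)\<^sup>2"
      by (simp add: power2_eq_square mult.left_commute)
  qed
  finally have le: "(norm ?y)\<^sup>2 * (norm ?y)\<^sup>2 \<le> (norm T * inner x ?y) * (norm ?y)\<^sup>2"
    by (simp add: power2_eq_square ac_simps)
  show ?thesis
  proof (cases "?y = 0")
    case False
    then have "0 < (norm ?y)\<^sup>2"
      by simp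
    then show ?thesis
      by (rule mult_right_le_imp_le[OF le])
  qed simp
qed

lemma positive_op_norm_le:
  assumes T: "positive_op T" and q: "q \<ge> 0" and le: "\<And>x. inner x (T \<cdot> x) \<le> q * (norm x)\<^sup>2"
  shows "norm T \<le> q"
proof (rule norm_blinfun_bound[OF q])
  fix x
  let ?y = "T \<cdot> x"
  have pos: "\<And>x. 0 \<le> inner x (T \<cdot> x)"
    using T unfolding positive_op_def by auto
  have "((norm ?y)\<^sup>2)\<^sup>2 = (inner ?y (T \<cdot> x))\<^sup>2"
    by (simp add: power2_norm_eq_inner)
  also have "\<dots> \<le> inner ?y (T \<cdot> ?y) * inner x ?y"
    by (rule positive_op_cauchy_schwarz[OF T])
  also have "\<dots> \<le> (q * (norm ?y)\<^sup>2) * (q * (norm x)\<^sup>2)"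
    by (intro mult_mono le pos) (simp add: q)
  finally have le: "(norm ?y)\<^sup>2 * (norm ?y)\<^sup>2 \<le> (q * norm x)\<^sup>2 * (norm ?y)\<^sup>2"
    by (simp add: power2_eq_square ac_simps)
  have "(norm ?y)\<^sup>2 \<le> (q * norm x)\<^sup>2"
  proof (cases "?y = 0")
    case False
    then have "0 < (norm ?y)\<^sup>2"
      by simp
    then show ?thesis
      by (rule mult_right_le_imp_le[OF le])
  qed simp
  then show "norm ?y \<le> q * norm x"
    by (rule power2_le_imp_le) (simp add: q)
qed

section \<open>Positivity in a concrete C*-algebra is positivity of the quadratic form\<close>

lemma compose_diff_right: "(R o\<^sub>L S) - (R o\<^sub>L T) = R o\<^sub>L (S - T)"
  by (rule blinfun_eqI) (simp add: blinfun.diff_left blinfun.diff_right)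

lemma compose_diff_left: "(R o\<^sub>L T) - (S o\<^sub>L T) = (R - S) o\<^sub>L T"
  by (rule blinfun_eqI) (simp add: blinfun.diff_left)

text \<open>
  The fixed point of \<open>X \<mapsto> 1 + (1 - B) X\<close> is the sum of the Neumann series; running the
  iteration inside the closed subalgebra keeps the inverse there.
\<close>

lemma neumann_inverse:
  assumes S: "star_subalgebra S" and B: "B \<in> S" and small: "norm (id_blinfun - B) < 1"
  shows "\<exists>X\<in>S. B o\<^sub>L X = id_blinfun \<and> X o\<^sub>L B = id_blinfun"
proof -
  note SD = star_subalgebraD[OF S]
  let ?M = "id_blinfun - B"
  have M: "?M \<in> S"
    by (rule SD(10)[OF SD(4) B])
  have complete: "complete S"
    using SD(3) by (simp add: complete_eq_closed)
  have "\<exists>!X. X \<in> S \<and> id_blinfun + (?M o\<^sub>L X) = X"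
  proof (rule Banach_fix[OF complete, where c = "norm ?M" and f = "\<lambda>X. id_blinfun + (?M o\<^sub>L X)"])
    show "dist (id_blinfun + (?M o\<^sub>L X)) (id_blinfun + (?M o\<^sub>L Y)) \<le> norm ?M * dist X Y" for X Y
      using norm_blinfun_compose[of ?M "X - Y"] by (simp add: dist_norm compose_diff_right)
    have "id_blinfun + (?M o\<^sub>L X) \<in> S" if "X \<in> S" for X
      by (intro SD(9,4,6) M that)
    then show "(\<lambda>X. id_blinfun + (?M o\<^sub>L X)) ` S \<subseteq> S"
      by blast
    show "S \<noteq> {}"
      using SD(4) by blast
  qed (simp_all add: small)
  then obtain X where X: "X \<in> S" "id_blinfun + (?M o\<^sub>L X) = X"
    by blast
  have "\<exists>!Y. Y \<in> S \<and> id_blinfun + (Y o\<^sub>L ?M) = Y"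
  proof (rule Banach_fix[OF complete, where c = "norm ?M" and f = "\<lambda>X. id_blinfun + (X o\<^sub>L ?M)"])
    show "dist (id_blinfun + (X o\<^sub>L ?M)) (id_blinfun + (Y o\<^sub>L ?M)) \<le> norm ?M * dist X Y" for X Y
      using norm_blinfun_compose[of "X - Y" ?M] by (simp add: dist_norm compose_diff_left mult.commute)
    have "id_blinfun + (X o\<^sub>L ?M) \<in> S" if "X \<in> S" for X
      by (intro SD(9,4,6) M that)
    then show "(\<lambda>X. id_blinfun + (X o\<^sub>L ?M)) ` S \<subseteq> S"
      by blast
    show "S \<noteq> {}"
      using SD(4) by blast
  qed (simp_all add: small)
  then obtain Y where Y: "Y \<in> S" "id_blinfun + (Y o\<^sub>L ?M) = Y"
    by blast
  have BX: "B o\<^sub>L X = id_blinfun"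
  proof (rule blinfun_eqI)
    fix x
    show "(B o\<^sub>L X) \<cdot> x = id_blinfun \<cdot> x"
      using arg_cong[OF X(2), of "\<lambda>T. T \<cdot> x"] by (simp add: blinfun.add_left blinfun.diff_left)
  qed
  have YB: "Y o\<^sub>L B = id_blinfun"
  proof (rule blinfun_eqI)
    fix x
    show "(Y o\<^sub>L B) \<cdot> x = id_blinfun \<cdot> x"
      using arg_cong[OF Y(2), of "\<lambda>T. T \<cdot> x"] by (simp add: blinfun.add_left blinfun.diff_left blinfun.diff_right)
  qed
  have "Y = Y o\<^sub>L (B o\<^sub>L X)"
    unfolding BX by (rule blinfun_eqI) simp
  also have "\<dots> = (Y o\<^sub>L B) o\<^sub>L X"
    by (rule blinfun_eqI) simp
  also have "\<dots> = X"
    unfolding YB by (rule blinfun_eqI) simp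
  finally show ?thesis
    using X BX YB by blast
qed

text \<open>
  For a suitable scalar \<open>C\<close> the operator \<open>1 - N / C\<close> is positive with a form bounded by
  \<open>1 - d / C < 1\<close>, so its norm is less than \<open>1\<close>.
\<close>

lemma positive_op_inverse:
  assumes S: "star_subalgebra S" and N: "N \<in> S" "positive_op N"
    and d: "d > 0" "\<And>x. d * (norm x)\<^sup>2 \<le> inner x (N \<cdot> x)"
  shows "\<exists>X\<in>S. N o\<^sub>L X = id_blinfun \<and> X o\<^sub>L N = id_blinfun"
proof -
  note SD = star_subalgebraD[OF S]
  have sa: "selfadjoint N"
    using N unfolding positive_op_def by auto
  \<comment> \<open>The summand \<open>d\<close> keeps \<open>1 - d / C\<close> nonnegative even on the zero space.\<close>
  define C where "C = norm N + d + 1"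
  have C: "C > 0" "norm N \<le> C" "d < C"
    using d(1) norm_ge_zero[of N] unfolding C_def by linarith+
  let ?B = "(1 / C) *\<^sub>R N"
  have val: "inner x ((id_blinfun - ?B) \<cdot> x) = (norm x)\<^sup>2 - inner x (N \<cdot> x) / C" for x
    by (simp add: blinfun.diff_left blinfun.scaleR_left inner_diff_right power2_norm_eq_inner)
  have up: "inner x (N \<cdot> x) \<le> C * (norm x)\<^sup>2" for x
  proof -
    have "inner x (N \<cdot> x) \<le> norm x * (norm N * norm x)"
      by (rule order_trans[OF norm_cauchy_schwarz]) (intro mult_left_mono norm_blinfun norm_ge_zero)
    also have "\<dots> \<le> C * (norm x)\<^sup>2"
      using mult_right_mono[OF C(2), of "norm x * norm x"] by (simp add: power2_eq_square ac_simps)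
    finally show ?thesis .
  qed
  have "norm (id_blinfun - ?B) \<le> 1 - d / C"
  proof (rule positive_op_norm_le)
    show "positive_op (id_blinfun - ?B)"
      unfolding positive_op_def val
      using selfadjoint_diff[OF selfadjoint_id selfadjoint_scaleR[OF sa sa]] up C(1)
      by (simp add: field_simps)
    show "inner x ((id_blinfun - ?B) \<cdot> x) \<le> (1 - d / C) * (norm x)\<^sup>2" for x
      unfolding val using d(2)[of x] C(1) by (simp add: field_simps)
    show "0 \<le> 1 - d / C"
      using C by (simp add: field_simps)
  qed
  also have "\<dots> < 1"
    using C(1) d(1) by simp
  finally have "norm (id_blinfun - ?B) < 1" .
  then obtain X where X: "X \<in> S" "?B o\<^sub>L X = id_blinfun" "X o\<^sub>L ?B = id_blinfun"
    using neumann_inverse[OF S, of ?B] SD(12)[OF N(1)] by blast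
  have "N o\<^sub>L ((1 / C) *\<^sub>R X) = ?B o\<^sub>L X" "((1 / C) *\<^sub>R X) o\<^sub>L N = X o\<^sub>L ?B"
    by (auto intro!: blinfun_eqI simp: blinfun.scaleR_left blinfun.scaleR_right)
  then show ?thesis
    using X SD(12)[OF X(1)] by (intro bexI[of _ "(1 / C) *\<^sub>R X"]) auto
qed

lemma blinfun_compose_assoc: "(R o\<^sub>L S) o\<^sub>L T = R o\<^sub>L (S o\<^sub>L T)"
  by (rule blinfun_eqI) simp

text \<open>
  Inverting \<open>T\<^sup>* T\<close> and \<open>T T\<^sup>*\<close> gives a left and a right inverse of \<open>T\<close>. All
  inverses are found inside \<open>S\<close>, which is why the spectrum does not depend on \<open>S\<close>.
\<close>

lemma bounded_below_inverse:
  assumes S: "star_subalgebra S" and T: "T \<in> S" and d: "d > 0"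
    "\<And>x. d * norm x \<le> norm (T \<cdot> x)" "\<And>x. d * norm x \<le> norm (hadj T \<cdot> x)"
  shows "\<exists>X\<in>S. T o\<^sub>L X = id_blinfun \<and> X o\<^sub>L T = id_blinfun"
proof -
  note SD = star_subalgebraD[OF S]
  have inv: "\<exists>X\<in>S. (hadj R o\<^sub>L R) o\<^sub>L X = id_blinfun \<and> X o\<^sub>L (hadj R o\<^sub>L R) = id_blinfun"
    if R: "R \<in> S" "\<And>x. d * norm x \<le> norm (R \<cdot> x)" for R
  proof (rule positive_op_inverse[OF S])
    show "hadj R o\<^sub>L R \<in> S"
      by (intro SD R)
    show "positive_op (hadj R o\<^sub>L R)"
      by (rule positive_op_hadj_compose[OF SD(1)[OF R(1)]])
    show "0 < d\<^sup>2"
      using d(1) by simp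
    show "d\<^sup>2 * (norm x)\<^sup>2 \<le> inner x ((hadj R o\<^sub>L R) \<cdot> x)" for x
      unfolding positive_op_hadj_compose(2)[OF SD(1)[OF R(1)]]
      using power_mono[OF R(2)[of x], of 2] d(1) by (simp add: power_mult_distrib)
  qed
  obtain X where X: "X \<in> S" "X o\<^sub>L (hadj T o\<^sub>L T) = id_blinfun"
    using inv[OF T d(2)] by blast
  obtain Y where Y: "Y \<in> S" "(T o\<^sub>L hadj T) o\<^sub>L Y = id_blinfun"
    using inv[OF SD(7)[OF T] d(3)] hadj_hadj[OF SD(1)[OF T]] by auto
  have l: "(X o\<^sub>L hadj T) o\<^sub>L T = id_blinfun" and r: "T o\<^sub>L (hadj T o\<^sub>L Y) = id_blinfun"
    using X(2) Y(2) by (simp_all add: blinfun_compose_assoc)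
  have "X o\<^sub>L hadj T = (X o\<^sub>L hadj T) o\<^sub>L (T o\<^sub>L (hadj T o\<^sub>L Y))"
    unfolding r by (rule blinfun_eqI) simp
  also have "\<dots> = ((X o\<^sub>L hadj T) o\<^sub>L T) o\<^sub>L (hadj T o\<^sub>L Y)"
    by (rule blinfun_eqI) simp
  also have "\<dots> = hadj T o\<^sub>L Y"
    unfolding l by (rule blinfun_eqI) simp
  finally show ?thesis
    using l r SD(6)[OF X(1) SD(7)[OF T]] by metis
qed

text \<open>
  If the form of \<open>T\<close> is nonnegative and \<open>l\<close> lies off the half line of nonnegative numbers, then
  \<open>l - T\<close> is bounded below and therefore invertible. Conversely, let \<open>m\<close> be the
  infimum of the form over the unit vectors. There are unit vectors that \<open>T - m\<close> makes
  arbitrarily short, so \<open>m\<close> belongs to the spectrum and cannot be negative.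
\<close>

lemma positive_in_operator_algebra_iff:
  assumes S: "star_subalgebra S"
  shows "positive_in (operator_algebra S) T \<longleftrightarrow> T \<in> S \<and> positive_op T"
proof (cases "T \<in> S \<and> hadj T = T")
  case False
  then show ?thesis
    by (auto simp: positive_in_def positive_op_def selfadjoint_def)
next
  case True
  note SD = star_subalgebraD[OF S]
  have T: "T \<in> S" and sa: "selfadjoint T"
    using True SD(1) by (auto simp: selfadjoint_def)
  let ?R = "\<lambda>l. scale_op l id_blinfun - T"
  have R: "?R l \<in> S" for l
    by (intro SD T)
  have spec: "spectrum (operator_algebra S) T
      = {l. \<not> (\<exists>X\<in>S. ?R l o\<^sub>L X = id_blinfun \<and> X o\<^sub>L ?R l = id_blinfun)}"
    unfolding spectrum_def Units_def
    using R by (auto simp: operator_algebra_minus[OF S SD(5)[OF SD(4)] T])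
  have "positive_op T \<longleftrightarrow> spectrum (operator_algebra S) T \<subseteq> \<real>\<^sub>\<ge>\<^sub>0"
  proof
    assume pos: "positive_op T"
    show "spectrum (operator_algebra S) T \<subseteq> \<real>\<^sub>\<ge>\<^sub>0"
    proof (rule ccontr)
      assume "\<not> spectrum (operator_algebra S) T \<subseteq> \<real>\<^sub>\<ge>\<^sub>0"
      then obtain l where l: "l \<notin> \<real>\<^sub>\<ge>\<^sub>0" and no: "\<not> (\<exists>X\<in>S. ?R l o\<^sub>L X = id_blinfun \<and> X o\<^sub>L ?R l = id_blinfun)"
        unfolding spec by blast
      define d where "d = (if Im l = 0 then - Re l else \<bar>Im l\<bar>)"
      have d: "d > 0"
        using l by (auto simp: d_def complex_nonneg_Reals_iff)
      have below: "d * norm x \<le> norm (?R l' \<cdot> x)" if l': "l' = l \<or> l' = cnj l" for l' x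
      proof -
        let ?t = "inner x (T \<cdot> x)"
        have val: "cinner x (?R l' \<cdot> x) = l' * complex_of_real ((norm x)\<^sup>2) - complex_of_real ?t"
          by (simp add: blinfun.diff_left scale_op_apply cinner_diff_right cinner_scaleC_right
              cinner_self cinner_selfadjoint_self[OF sa])
        have t: "0 \<le> ?t"
          using pos unfolding positive_op_def by blast
        have "d * (norm x)\<^sup>2 \<le> cmod (l' * complex_of_real ((norm x)\<^sup>2) - complex_of_real ?t)"
        proof (cases "Im l = 0")
          case True
          have "d * (norm x)\<^sup>2 \<le> - Re (l' * complex_of_real ((norm x)\<^sup>2) - complex_of_real ?t)"
            using True t l' by (auto simp: d_def)
          also have "\<dots> \<le> cmod (l' * complex_of_real ((norm x)\<^sup>2) - complex_of_real ?t)"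
            using abs_Re_le_cmod by (metis abs_le_D2)
          finally show ?thesis .
        next
          case False
          have "d * (norm x)\<^sup>2 = \<bar>Im (l' * complex_of_real ((norm x)\<^sup>2) - complex_of_real ?t)\<bar>"
            using False l' by (auto simp: d_def abs_mult)
          also have "\<dots> \<le> cmod (l' * complex_of_real ((norm x)\<^sup>2) - complex_of_real ?t)"
            by (rule abs_Im_le_cmod)
          finally show ?thesis .
        qed
        also have "\<dots> \<le> norm x * norm (?R l' \<cdot> x)"
          unfolding val[symmetric] by (rule cinner_cauchy_schwarz)
        finally show ?thesis
          by (cases "x = 0") (simp_all add: power2_eq_square)
      qed
      have adj: "hadj (?R l) = ?R (cnj l)"
        using sa by (simp add: hadj_diff hadj_scale clinear_op_id clinear_op_scale hadj_id selfadjoint_def)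
      show False
        using bounded_below_inverse[OF S R d, of l] below adj no by auto
    qed
  next
    assume sub: "spectrum (operator_algebra S) T \<subseteq> \<real>\<^sub>\<ge>\<^sub>0"
    show "positive_op T"
    proof (rule ccontr)
      assume "\<not> positive_op T"
      then obtain x0 where x0: "inner x0 (T \<cdot> x0) < 0"
        using sa unfolding positive_op_def by (auto simp: not_le)
      \<comment> \<open>The lower bound of the numerical range lies in the spectrum.\<close>
      define Q where "Q = {inner x (T \<cdot> x) | x. norm x = 1}"
      define m where "m = Inf Q"
      have "x0 \<noteq> 0"
        using x0 by auto
      have unit: "inner (x /\<^sub>R norm x) (T \<cdot> (x /\<^sub>R norm x)) = inner x (T \<cdot> x) / (norm x)\<^sup>2"
        for x
        by (simp add: blinfun.scaleR_right power2_eq_square divide_inverse ac_simps)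
      have inQ: "inner x (T \<cdot> x) / (norm x)\<^sup>2 \<in> Q" if "x \<noteq> 0" for x
        unfolding Q_def unit[symmetric] using that by (intro CollectI exI[of _ "x /\<^sub>R norm x"]) simp
      have bdd: "bdd_below Q"
      proof (rule bdd_belowI[of _ "- norm T"])
        fix q assume "q \<in> Q"
        then obtain x where x: "norm x = 1" "q = inner x (T \<cdot> x)"
          unfolding Q_def by blast
        have "\<bar>q\<bar> \<le> norm x * (norm T * norm x)"
          unfolding x(2) by (rule order_trans[OF Cauchy_Schwarz_ineq2]) (intro mult_left_mono norm_blinfun norm_ge_zero)
        then show "- norm T \<le> q"
          using x(1) by simp
      qed
      have m_le: "m * (norm x)\<^sup>2 \<le> inner x (T \<cdot> x)" for x
      proof (cases "x = 0")
        case False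
        have "m \<le> inner x (T \<cdot> x) / (norm x)\<^sup>2"
          unfolding m_def by (rule cInf_lower[OF inQ[OF False] bdd])
        then show ?thesis
          using False by (simp add: field_simps)
      qed simp
      have "m < 0"
      proof -
        have "m \<le> inner x0 (T \<cdot> x0) / (norm x0)\<^sup>2"
          unfolding m_def by (rule cInf_lower[OF inQ[OF \<open>x0 \<noteq> 0\<close>] bdd])
        also have "\<dots> < 0"
          using x0 \<open>x0 \<noteq> 0\<close> by (simp add: divide_neg_pos)
        finally show ?thesis .
      qed
      then have "complex_of_real m \<notin> spectrum (operator_algebra S) T"
        using sub by (auto simp: complex_nonneg_Reals_iff)
      then obtain X where X: "X o\<^sub>L ?R (complex_of_real m) = id_blinfun"
        unfolding spec by blast
      let ?P = "T - m *\<^sub>R id_blinfun"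
      have P: "positive_op ?P"
        unfolding positive_op_def using m_le
        by (simp add: selfadjoint_diff[OF sa selfadjoint_scaleR[OF selfadjoint_id selfadjoint_id]]
            blinfun.diff_left blinfun.scaleR_left inner_diff_right power2_norm_eq_inner)
      define K where "K = (norm X)\<^sup>2 * norm ?P"
      have K: "1 \<le> K * (q - m)" if q: "q \<in> Q" for q
      proof -
        obtain x where x: "norm x = 1" "q = inner x (T \<cdot> x)"
          using q unfolding Q_def by blast
        have "x = - X \<cdot> (?P \<cdot> x)"
          using arg_cong[OF X, of "\<lambda>R. R \<cdot> x"]
          by (simp add: blinfun.diff_left blinfun.diff_right scale_op_apply blinfun.scaleR_left scaleR_scaleC)
        then have "norm x \<le> norm X * norm (?P \<cdot> x)"
          using norm_blinfun[of X "?P \<cdot> x"] by (metis norm_minus_cancel)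
        then have "1 \<le> (norm X)\<^sup>2 * (norm (?P \<cdot> x))\<^sup>2"
          using x(1) power_mono[of 1 "norm X * norm (?P \<cdot> x)" 2] by (simp add: power_mult_distrib)
        also have "\<dots> \<le> (norm X)\<^sup>2 * (norm ?P * inner x (?P \<cdot> x))"
          by (intro mult_left_mono positive_op_norm_sq_le[OF P]) simp
        also have "inner x (?P \<cdot> x) = q - m"
          using x by (simp add: blinfun.diff_left blinfun.scaleR_left inner_diff_right power2_norm_eq_inner[symmetric])
        finally show ?thesis
          by (simp add: K_def mult.assoc)
      qed
      have "K \<ge> 0"
        by (simp add: K_def)
      have "m + 1 / (K + 1) \<le> Inf Q"
      proof (rule cInf_greatest)
        show "Q \<noteq> {}"
          using inQ[OF \<open>x0 \<noteq> 0\<close>] by blast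
        fix q assume q: "q \<in> Q"
        have "m \<le> q"
          unfolding m_def by (rule cInf_lower[OF q bdd])
        then have "1 \<le> (K + 1) * (q - m)"
          using K[OF q] by (simp add: distrib_right)
        then have "1 / (K + 1) \<le> q - m"
          using \<open>K \<ge> 0\<close> by (simp add: divide_le_eq mult.commute)
        then show "m + 1 / (K + 1) \<le> q"
          by simp
      qed
      then have "1 / (K + 1) \<le> 0"
        by (simp add: m_def)
      then show False
        using \<open>K \<ge> 0\<close> by simp
    qed
  qed
  then show ?thesis
    unfolding positive_in_def using True by simp
qed

lemma le_in_operator_algebra_iff:
  assumes S: "star_subalgebra S"
  shows "le_in (operator_algebra S) a b \<longleftrightarrow> a \<in> S \<and> b \<in> S \<and> positive_op (b - a)"
  unfolding le_in_def
  by (auto simp: positive_in_operator_algebra_iff[OF S] operator_algebra_minus[OF S] star_subalgebraD[OF S])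

section \<open>Square roots\<close>

text \<open>
  The iteration \<open>y \<mapsto> (E + y\<^sup>2) / 2\<close> converges to \<open>1 - sqrt (1 - E)\<close>. All
  iterates are polynomials in \<open>E\<close> with nonnegative coefficients, so their distances are
  dominated by the corresponding iteration for the number \<open>1\<close>, which increases to \<open>1\<close>.
\<close>

fun sqrt_iter :: "'h::chilbert_space op \<Rightarrow> nat \<Rightarrow> 'h op" where
  "sqrt_iter E 0 = 0"
| "sqrt_iter E (Suc n) = (1 / 2) *\<^sub>R (E + (sqrt_iter E n o\<^sub>L sqrt_iter E n))"

fun sqrt_bound :: "nat \<Rightarrow> real" where
  "sqrt_bound 0 = 0"
| "sqrt_bound (Suc n) = (1 + (sqrt_bound n)\<^sup>2) / 2"

lemma sqrt_bound_range: "0 \<le> sqrt_bound n" "sqrt_bound n \<le> 1"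
proof (induction n)
  case (Suc n)
  { case 1 then show ?case by simp }
  { case 2 then show ?case using Suc by (simp add: power_le_one) }
qed simp_all

lemma Cauchy_sqrt_bound: "Cauchy sqrt_bound"
proof -
  have "sqrt_bound n \<le> sqrt_bound (Suc n)" for n
    using zero_le_power2[of "1 - sqrt_bound n"] by (simp add: power2_eq_square algebra_simps)
  then have "incseq sqrt_bound"
    by (rule incseq_SucI)
  then have "convergent sqrt_bound"
    using incseq_convergent[of sqrt_bound 1] sqrt_bound_range(2) convergentI by metis
  then show ?thesis
    by (simp add: convergent_Cauchy)
qed

lemma sqrt_iter_commute:
  assumes "Z o\<^sub>L E = E o\<^sub>L Z"
  shows "Z o\<^sub>L sqrt_iter E n = sqrt_iter E n o\<^sub>L Z"
proof (induction n)
  case (Suc n)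
  have E: "Z \<cdot> (E \<cdot> x) = E \<cdot> (Z \<cdot> x)" for x
    using assms by (metis blinfun_apply_blinfun_compose)
  have Y: "Z \<cdot> (sqrt_iter E n \<cdot> x) = sqrt_iter E n \<cdot> (Z \<cdot> x)" for x
    using Suc by (metis blinfun_apply_blinfun_compose)
  show ?case
    by (rule blinfun_eqI) (simp add: blinfun.scaleR_left blinfun.scaleR_right blinfun.add_left blinfun.add_right E Y)
qed (auto intro: blinfun_eqI)

text \<open>
  The second bound uses \<open>z\<^sup>2 - y\<^sup>2 = (z + y) (z - y)\<close>, which holds because the iterates
  commute.
\<close>

lemma sqrt_iter_bounds:
  assumes E: "norm E \<le> 1"
  shows "norm (sqrt_iter E n) \<le> sqrt_bound n"
    and "norm (sqrt_iter E (Suc n) - sqrt_iter E n) \<le> sqrt_bound (Suc n) - sqrt_bound n"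
proof -
  show b: "norm (sqrt_iter E n) \<le> sqrt_bound n" for n
  proof (induction n)
    case (Suc n)
    have "norm (E + (sqrt_iter E n o\<^sub>L sqrt_iter E n)) \<le> norm E + norm (sqrt_iter E n) * norm (sqrt_iter E n)"
      by (rule order_trans[OF norm_triangle_ineq]) (simp add: norm_blinfun_compose)
    also have "\<dots> \<le> 1 + sqrt_bound n * sqrt_bound n"
      by (intro add_mono E mult_mono Suc) (simp_all add: sqrt_bound_range)
    finally show ?case
      by (simp add: power2_eq_square)
  qed simp
  show "norm (sqrt_iter E (Suc n) - sqrt_iter E n) \<le> sqrt_bound (Suc n) - sqrt_bound n"
  proof (induction n)
    case 0
    then show ?case using E by simp
  next
    case (Suc n)
    let ?y = "sqrt_iter E n" and ?z = "sqrt_iter E (Suc n)"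
    have "?y o\<^sub>L E = E o\<^sub>L ?y"
      by (rule sqrt_iter_commute[symmetric]) simp
    then have "?y o\<^sub>L ?z = ?z o\<^sub>L ?y"
      by (rule sqrt_iter_commute)
    then have "?y \<cdot> (?z \<cdot> x) = ?z \<cdot> (?y \<cdot> x)" for x
      by (metis blinfun_apply_blinfun_compose)
    then have fac: "(?z o\<^sub>L ?z) - (?y o\<^sub>L ?y) = (?z + ?y) o\<^sub>L (?z - ?y)"
      by (intro blinfun_eqI) (simp add: blinfun.add_left blinfun.diff_left blinfun.diff_right blinfun.add_right
          del: sqrt_iter.simps)
    have "sqrt_iter E (Suc (Suc n)) - ?z = (1 / 2) *\<^sub>R (E + (?z o\<^sub>L ?z)) - (1 / 2) *\<^sub>R (E + (?y o\<^sub>L ?y))"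
      by (simp only: sqrt_iter.simps)
    also have "\<dots> = (1 / 2) *\<^sub>R ((?z o\<^sub>L ?z) - (?y o\<^sub>L ?y))"
      by (simp only: scaleR_diff_right[symmetric] add_diff_cancel_left)
    also have "norm \<dots> = (1 / 2) * norm ((?z + ?y) o\<^sub>L (?z - ?y))"
      unfolding fac by simp
    also have "\<dots> \<le> (1 / 2) * ((sqrt_bound (Suc n) + sqrt_bound n) * (sqrt_bound (Suc n) - sqrt_bound n))"
    proof (intro mult_left_mono order_trans[OF norm_blinfun_compose] mult_mono Suc)
      show "norm (?z + ?y) \<le> sqrt_bound (Suc n) + sqrt_bound n"
        by (intro order_trans[OF norm_triangle_ineq] add_mono b)
      show "0 \<le> sqrt_bound (Suc n) + sqrt_bound n"
        by (intro add_nonneg_nonneg sqrt_bound_range)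
    qed simp_all
    also have "\<dots> = sqrt_bound (Suc (Suc n)) - sqrt_bound (Suc n)"
    proof -
      have "(1 / 2) * ((a + b) * (a - b)) = (1 + a\<^sup>2) / 2 - (1 + b\<^sup>2) / 2" for a b :: real
        by (simp add: power2_eq_square field_simps)
      then show ?thesis
        by (metis sqrt_bound.simps(2))
    qed
    finally show ?case .
  qed
qed

lemma positive_op_sqrt_unit:
  assumes E: "selfadjoint E" "norm E \<le> 1"
  shows "\<exists>R. positive_op R \<and> R o\<^sub>L R = id_blinfun - E \<and> (\<forall>Z. Z o\<^sub>L E = E o\<^sub>L Z \<longrightarrow> Z o\<^sub>L R = R o\<^sub>L Z)"
proof -
  let ?Y = "sqrt_iter E"
  have diff: "norm (?Y (n + k) - ?Y n) \<le> sqrt_bound (n + k) - sqrt_bound n" for n k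
  proof (induction k)
    case (Suc k)
    have "norm (?Y (n + Suc k) - ?Y n) \<le> norm (?Y (Suc (n + k)) - ?Y (n + k)) + norm (?Y (n + k) - ?Y n)"
      using norm_triangle_ineq[of "?Y (Suc (n + k)) - ?Y (n + k)" "?Y (n + k) - ?Y n"] by simp
    then show ?case
      using Suc sqrt_iter_bounds(2)[OF E(2), of "n + k"] by simp
  qed simp
  have "Cauchy ?Y"
  proof (rule CauchyI')
    fix e :: real assume "e > 0"
    then obtain M where M: "\<And>m n. m \<ge> M \<Longrightarrow> n \<ge> M \<Longrightarrow> norm (sqrt_bound m - sqrt_bound n) < e"
      using CauchyD[OF Cauchy_sqrt_bound] by blast
    have "dist (?Y m) (?Y n) < e" if "m \<ge> M" "n > m" for m n
    proof -
      have "dist (?Y m) (?Y n) \<le> sqrt_bound n - sqrt_bound m"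
        using diff[of m "n - m"] that by (simp add: dist_norm norm_minus_commute)
      also have "\<dots> < e"
        using M[of n m] that by (simp add: abs_less_iff)
      finally show ?thesis .
    qed
    then show "\<exists>M. \<forall>m\<ge>M. \<forall>n>m. dist (?Y m) (?Y n) < e"
      by blast
  qed
  then obtain Y where Y: "?Y \<longlonglongrightarrow> Y"
    using Cauchy_convergent convergent_def by blast
  have ap: "(\<lambda>n. ?Y n \<cdot> x) \<longlonglongrightarrow> Y \<cdot> x" for x
    by (rule bounded_linear.tendsto[OF blinfun.bounded_linear_left Y])
  have "(\<lambda>n. ?Y (Suc n)) \<longlonglongrightarrow> (1 / 2) *\<^sub>R (E + (Y o\<^sub>L Y))"
    unfolding sqrt_iter.simps
    by (intro tendsto_scaleR tendsto_add tendsto_const bounded_bilinear.tendsto[OF bounded_bilinear_blinfun_compose] Y)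
  then have fix_Y: "Y = (1 / 2) *\<^sub>R (E + (Y o\<^sub>L Y))"
    using LIMSEQ_unique LIMSEQ_Suc[OF Y] by blast
  have clin: "clinear_op (?Y n)" for n
    by (induction n)
      (simp_all add: selfadjointD(1)[OF E(1)] clinear_op_scaleR clinear_op_add clinear_op_compose,
        simp add: clinear_op_def)
  have sa_n: "selfadjoint (?Y n)" for n
  proof (induction n)
    case 0
    show ?case by (simp add: selfadjoint_def hadj_zero) (simp add: clinear_op_def)
  next
    case (Suc n)
    then show ?case
      using selfadjoint_scaleR[OF selfadjoint_add[OF E(1) selfadjoint_square[OF Suc]] E(1)] by simp
  qed
  have clY: "clinear_op Y"
    using closed_sequentially[OF clinear_ops_closed_subspace(2) _ Y] clin by simp
  have saY: "selfadjoint Y"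
  proof (rule selfadjointI[OF clY])
    fix x y
    have "(\<lambda>n. cinner y (?Y n \<cdot> x)) \<longlonglongrightarrow> cinner y (Y \<cdot> x)" for x y
      by (rule bounded_linear.tendsto[OF bounded_linear_cinner ap])
    note l = this
    have "(\<lambda>n. cnj (cinner y (?Y n \<cdot> x))) \<longlonglongrightarrow> cnj (cinner y (Y \<cdot> x))"
      by (intro tendsto_cnj l)
    moreover have "cnj (cinner y (?Y n \<cdot> x)) = cinner x (?Y n \<cdot> y)" for n
      using selfadjointD(3)[OF sa_n, of n x y] cinner_commute by metis
    ultimately have "cnj (cinner y (Y \<cdot> x)) = cinner x (Y \<cdot> y)"
      using l[of x y] LIMSEQ_unique by auto
    then show "cinner (Y \<cdot> x) y = cinner x (Y \<cdot> y)"
      using cinner_commute by metis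
  qed
  have "norm Y \<le> 1"
    by (rule LIMSEQ_le_const2[OF tendsto_norm[OF Y]])
      (use sqrt_iter_bounds(1)[OF E(2)] sqrt_bound_range(2) order_trans in blast)
  let ?R = "id_blinfun - Y"
  have "positive_op ?R"
    unfolding positive_op_def
  proof (intro conjI allI)
    show "selfadjoint ?R"
      by (rule selfadjoint_diff[OF selfadjoint_id saY])
    fix x
    have "inner x (Y \<cdot> x) \<le> norm x * (norm Y * norm x)"
      by (rule order_trans[OF norm_cauchy_schwarz]) (intro mult_left_mono norm_blinfun norm_ge_zero)
    also have "\<dots> \<le> norm x * (1 * norm x)"
      using \<open>norm Y \<le> 1\<close> by (intro mult_left_mono mult_right_mono) simp_all
    finally show "0 \<le> inner x (?R \<cdot> x)"
      by (simp add: blinfun.diff_left inner_diff_right dot_square_norm power2_eq_square)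
  qed
  moreover have "?R o\<^sub>L ?R = id_blinfun - E"
  proof (rule blinfun_eqI)
    fix x
    have "2 *\<^sub>R Y \<cdot> x = E \<cdot> x + Y \<cdot> (Y \<cdot> x)"
      using arg_cong[OF fix_Y, of "\<lambda>T. T \<cdot> x"]
      by (metis (no_types, lifting) blinfun.add_left blinfun.scaleR_left blinfun_apply_blinfun_compose
          divide_inverse mult.left_neutral right_inverse scaleR_one scaleR_scaleR zero_neq_numeral)
    then show "(?R o\<^sub>L ?R) \<cdot> x = (id_blinfun - E) \<cdot> x"
      by (simp add: blinfun.diff_left blinfun.diff_right scaleR_2 algebra_simps)
  qed
  moreover have "Z o\<^sub>L ?R = ?R o\<^sub>L Z" if "Z o\<^sub>L E = E o\<^sub>L Z" for Z
  proof -
    have "(\<lambda>n. Z o\<^sub>L ?Y n) \<longlonglongrightarrow> (Z o\<^sub>L Y)" "(\<lambda>n. ?Y n o\<^sub>L Z) \<longlonglongrightarrow> (Y o\<^sub>L Z)"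
      by (intro bounded_bilinear.tendsto[OF bounded_bilinear_blinfun_compose] tendsto_const Y)+
    then have "Z o\<^sub>L Y = Y o\<^sub>L Z"
      using sqrt_iter_commute[OF that] LIMSEQ_unique by simp
    then have "Z \<cdot> (Y \<cdot> x) = Y \<cdot> (Z \<cdot> x)" for x
      by (metis blinfun_apply_blinfun_compose)
    then show ?thesis
      by (intro blinfun_eqI) (simp add: blinfun.diff_left blinfun.diff_right)
  qed
  ultimately show ?thesis
    by blast
qed

lemma positive_op_sqrt:
  assumes Q: "positive_op Q"
  shows "\<exists>R. positive_op R \<and> R o\<^sub>L R = Q \<and> (\<forall>Z. Z o\<^sub>L Q = Q o\<^sub>L Z \<longrightarrow> Z o\<^sub>L R = R o\<^sub>L Z)"
proof -
  define C where "C = norm Q + 1"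
  have C: "C > 0" "norm Q \<le> C"
    unfolding C_def using norm_ge_zero[of Q] by linarith+
  have sa: "selfadjoint Q" and pos: "\<And>x. 0 \<le> inner x (Q \<cdot> x)"
    using Q unfolding positive_op_def by auto
  let ?E = "id_blinfun - (1 / C) *\<^sub>R Q"
  have val: "inner x (?E \<cdot> x) = (norm x)\<^sup>2 - inner x (Q \<cdot> x) / C" for x
    by (simp add: blinfun.diff_left blinfun.scaleR_left inner_diff_right power2_norm_eq_inner)
  have saE: "selfadjoint ?E"
    by (rule selfadjoint_diff[OF selfadjoint_id selfadjoint_scaleR[OF sa sa]])
  have up: "inner x (Q \<cdot> x) \<le> C * (norm x)\<^sup>2" for x
  proof -
    have "inner x (Q \<cdot> x) \<le> norm x * (norm Q * norm x)"
      by (rule order_trans[OF norm_cauchy_schwarz]) (intro mult_left_mono norm_blinfun norm_ge_zero)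
    also have "\<dots> \<le> C * (norm x)\<^sup>2"
      using mult_right_mono[OF C(2), of "norm x * norm x"] by (simp add: power2_eq_square ac_simps)
    finally show ?thesis .
  qed
  have "norm ?E \<le> 1"
  proof (rule positive_op_norm_le)
    show "positive_op ?E"
      unfolding positive_op_def val using saE up C(1) by (simp add: field_simps)
    show "inner x (?E \<cdot> x) \<le> 1 * (norm x)\<^sup>2" for x
      unfolding val using pos[of x] C(1) by simp
  qed simp
  then obtain R where R: "positive_op R" "R o\<^sub>L R = id_blinfun - ?E"
    "\<And>Z. Z o\<^sub>L ?E = ?E o\<^sub>L Z \<Longrightarrow> Z o\<^sub>L R = R o\<^sub>L Z"
    using positive_op_sqrt_unit[OF saE] by blast
  have sr: "R \<cdot> (R \<cdot> x) = (1 / C) *\<^sub>R Q \<cdot> x" for x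
    using arg_cong[OF R(2), of "\<lambda>T. T \<cdot> x"] by (simp add: blinfun.diff_left blinfun.scaleR_left)
  let ?S = "sqrt C *\<^sub>R R"
  have "positive_op ?S"
    using R(1) C(1) selfadjoint_scaleR[of R R "sqrt C"] unfolding positive_op_def
    by (simp add: blinfun.scaleR_left)
  moreover have "?S o\<^sub>L ?S = Q"
    using C(1) by (intro blinfun_eqI) (simp add: blinfun.scaleR_left blinfun.scaleR_right sr)
  moreover have "Z o\<^sub>L ?S = ?S o\<^sub>L Z" if "Z o\<^sub>L Q = Q o\<^sub>L Z" for Z
  proof -
    have "Z \<cdot> (Q \<cdot> x) = Q \<cdot> (Z \<cdot> x)" for x
      using that by (metis blinfun_apply_blinfun_compose)
    then have "Z o\<^sub>L ?E = ?E o\<^sub>L Z"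
      by (intro blinfun_eqI) (simp add: blinfun.diff_left blinfun.diff_right blinfun.scaleR_left blinfun.scaleR_right)
    then have "Z o\<^sub>L R = R o\<^sub>L Z"
      by (rule R(3))
    then have "Z \<cdot> (R \<cdot> x) = R \<cdot> (Z \<cdot> x)" for x
      by (metis blinfun_apply_blinfun_compose)
    then show ?thesis
      by (intro blinfun_eqI) (simp add: blinfun.scaleR_left blinfun.scaleR_right)
  qed
  ultimately show ?thesis
    by blast
qed

section \<open>Spatial tensor products and the homomorphisms between them\<close>

lemma representationD:
  assumes A: "unital_cstar_algebra A" and r: "representation A \<pi>"
  shows "a \<in> carrier A \<Longrightarrow> clinear_op (\<pi> a)"
    and "a \<in> carrier A \<Longrightarrow> b \<in> carrier A \<Longrightarrow> \<pi> (a \<otimes>\<^bsub>A\<^esub> b) = \<pi> a o\<^sub>L \<pi> b"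
    and "a \<in> carrier A \<Longrightarrow> b \<in> carrier A \<Longrightarrow> \<pi> (a \<oplus>\<^bsub>A\<^esub> b) = \<pi> a + \<pi> b"
    and "\<pi> \<one>\<^bsub>A\<^esub> = id_blinfun"
    and "a \<in> carrier A \<Longrightarrow> \<pi> (c \<odot>\<^bsub>A\<^esub> a) = scale_op c (\<pi> a)"
    and "a \<in> carrier A \<Longrightarrow> \<pi> (star A a) = hadj (\<pi> a)"
  using r unfolding representation_def star_hom_def ring_hom_def
  by (auto simp: bounded_ops_iff)

lemma unital_cstar_algebra_closed:
  assumes "unital_cstar_algebra A"
  shows "\<one>\<^bsub>A\<^esub> \<in> carrier A" "a \<in> carrier A \<Longrightarrow> b \<in> carrier A \<Longrightarrow> a \<otimes>\<^bsub>A\<^esub> b \<in> carrier A"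
    "a \<in> carrier A \<Longrightarrow> c \<odot>\<^bsub>A\<^esub> a \<in> carrier A" "a \<in> carrier A \<Longrightarrow> star A a \<in> carrier A"
proof -
  interpret unital_cstar_algebra A by fact
  show "\<one>\<^bsub>A\<^esub> \<in> carrier A" "a \<in> carrier A \<Longrightarrow> b \<in> carrier A \<Longrightarrow> a \<otimes>\<^bsub>A\<^esub> b \<in> carrier A"
    "a \<in> carrier A \<Longrightarrow> star A a \<in> carrier A"
    by (simp_all add: star_closed)
  show "a \<in> carrier A \<Longrightarrow> c \<odot>\<^bsub>A\<^esub> a \<in> carrier A"
    by (rule scalars.smult_closed) (simp_all add: complex_field_def)
qed

definition elementary_tensors ::
  "'a cstar \<Rightarrow> ('a \<Rightarrow> 'h::chilbert_space op) \<Rightarrow> 'b cstar \<Rightarrow> ('b \<Rightarrow> 'k::chilbert_space op)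
     \<Rightarrow> ('h, 'k) htensor op set" where
  "elementary_tensors A \<pi> B \<sigma> = {tensor_op (\<pi> a) (\<sigma> b) |a b. a \<in> carrier A \<and> b \<in> carrier B}"

lemma spatial_tensor_eq:
  "spatial_tensor A \<pi> B \<sigma> = operator_algebra (closure (span (elementary_tensors A \<pi> B \<sigma>)))"
  unfolding spatial_tensor_def elementary_tensors_def ..

lemma carrier_spatial_tensor:
  "carrier (spatial_tensor A \<pi> B \<sigma>) = closure (span (elementary_tensors A \<pi> B \<sigma>))"
  by (simp add: spatial_tensor_eq)

lemma tensor_op_in_spatial_tensor:
  assumes "a \<in> carrier A" "b \<in> carrier B"
  shows "tensor_op (\<pi> a) (\<sigma> b) \<in> carrier (spatial_tensor A \<pi> B \<sigma>)"
proof -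
  have "tensor_op (\<pi> a) (\<sigma> b) \<in> elementary_tensors A \<pi> B \<sigma>"
    unfolding elementary_tensors_def using assms by blast
  then show ?thesis
    unfolding carrier_spatial_tensor using closure_subset span_base by blast
qed

lemma
  assumes A: "unital_cstar_algebra A" "representation A \<pi>" and B: "unital_cstar_algebra B" "representation B \<sigma>"
  shows clinear_op_elementary: "g \<in> elementary_tensors A \<pi> B \<sigma> \<Longrightarrow> clinear_op g"
    and star_subalgebra_spatial_tensor: "star_subalgebra (carrier (spatial_tensor A \<pi> B \<sigma>))"
proof -
  note rA = representationD[OF A] and rB = representationD[OF B]
  note cA = unital_cstar_algebra_closed[OF A(1)] and cB = unital_cstar_algebra_closed[OF B(1)]
  let ?G = "elementary_tensors A \<pi> B \<sigma>"
  have G: "tensor_op (\<pi> a) (\<sigma> b) \<in> ?G" if "a \<in> carrier A" "b \<in> carrier B" for a b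
    unfolding elementary_tensors_def using that by blast
  have GE: "\<exists>a\<in>carrier A. \<exists>b\<in>carrier B. T = tensor_op (\<pi> a) (\<sigma> b)" if "T \<in> ?G" for T
    using that unfolding elementary_tensors_def by blast
  have cl: "clinear_op T" if "T \<in> ?G" for T
    using GE[OF that] by (auto simp: rA(1) rB(1) clinear_op_tensor_op)
  then show "g \<in> ?G \<Longrightarrow> clinear_op g" .
  have "star_subalgebra (closure (span ?G))"
  proof (rule star_subalgebra_generated[OF cl])
    show "id_blinfun \<in> ?G"
      using G[OF cA(1) cB(1)] by (simp add: rA(4) rB(4) tensor_op_id)
  next
    fix c T assume "T \<in> ?G"
    then obtain a b where ab: "a \<in> carrier A" "b \<in> carrier B" "T = tensor_op (\<pi> a) (\<sigma> b)"
      using GE by blast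
    have "scale_op c T = tensor_op (\<pi> (c \<odot>\<^bsub>A\<^esub> a)) (\<sigma> b)"
      by (simp add: ab rA(1,5) rB(1) tensor_op_scale_left)
    then show "scale_op c T \<in> ?G"
      using G[OF cA(3) ab(2)] ab(1) by simp
  next
    fix S T assume "S \<in> ?G" "T \<in> ?G"
    obtain a b where ab: "a \<in> carrier A" "b \<in> carrier B" "S = tensor_op (\<pi> a) (\<sigma> b)"
      using GE[OF \<open>S \<in> ?G\<close>] by blast
    obtain a' b' where ab': "a' \<in> carrier A" "b' \<in> carrier B" "T = tensor_op (\<pi> a') (\<sigma> b')"
      using GE[OF \<open>T \<in> ?G\<close>] by blast
    have "S o\<^sub>L T = tensor_op (\<pi> (a \<otimes>\<^bsub>A\<^esub> a')) (\<sigma> (b \<otimes>\<^bsub>B\<^esub> b'))"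
      by (simp add: ab ab' rA(1,2) rB(1,2) tensor_op_compose)
    then show "S o\<^sub>L T \<in> ?G"
      using G[OF cA(2)[OF ab(1) ab'(1)] cB(2)[OF ab(2) ab'(2)]] by simp
  next
    fix T assume "T \<in> ?G"
    then obtain a b where ab: "a \<in> carrier A" "b \<in> carrier B" "T = tensor_op (\<pi> a) (\<sigma> b)"
      using GE by blast
    have "hadj T = tensor_op (\<pi> (star A a)) (\<sigma> (star B b))"
      by (simp add: ab rA(1,6) rB(1,6) hadj_tensor_op)
    then show "hadj T \<in> ?G"
      using G[OF cA(4)[OF ab(1)] cB(4)[OF ab(2)]] by simp
  qed
  then show "star_subalgebra (carrier (spatial_tensor A \<pi> B \<sigma>))"
    by (simp add: carrier_spatial_tensor)
qed

lemma spatial_tensor_operator_algebra: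
  "spatial_tensor A \<pi> B \<sigma> = operator_algebra (carrier (spatial_tensor A \<pi> B \<sigma>))"
  by (simp add: spatial_tensor_eq)

lemma
  assumes A: "unital_cstar_algebra A" "representation A \<pi>" and B: "unital_cstar_algebra B" "representation B \<sigma>"
  shows unital_cstar_algebra_spatial_tensor: "unital_cstar_algebra (spatial_tensor A \<pi> B \<sigma>)"
    and tensor_rep_apply: "T \<in> carrier (spatial_tensor A \<pi> B \<sigma>) \<Longrightarrow> tensor_rep A \<pi> B \<sigma> T = T"
    and representation_tensor_rep: "representation (spatial_tensor A \<pi> B \<sigma>) (tensor_rep A \<pi> B \<sigma>)"
proof -
  note S = star_subalgebra_spatial_tensor[OF A B]
  show "unital_cstar_algebra (spatial_tensor A \<pi> B \<sigma>)"
    by (subst spatial_tensor_operator_algebra) (rule unital_cstar_algebra_operator_algebra[OF S])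
  have id: "tensor_rep A \<pi> B \<sigma> T = T" if "T \<in> carrier (spatial_tensor A \<pi> B \<sigma>)" for T
    unfolding tensor_rep_def
    by (subst spatial_tensor_operator_algebra,
        rule star_hom_extending_spatial(1)[OF spatial_hom_id S carrier_spatial_tensor star_subalgebra_bounded_ops _ _ _ that])
      (auto simp: elementary_tensors_def bounded_ops_iff tensor_op_in_spatial_tensor
        clinear_op_tensor_op representationD(1)[OF A] representationD(1)[OF B])
  then show "T \<in> carrier (spatial_tensor A \<pi> B \<sigma>) \<Longrightarrow> tensor_rep A \<pi> B \<sigma> T = T" .
  show "representation (spatial_tensor A \<pi> B \<sigma>) (tensor_rep A \<pi> B \<sigma>)"
    unfolding representation_def star_hom_def ring_hom_def
    using star_subalgebraD[OF S] id
    by (auto simp: spatial_tensor_eq bounded_ops_iff)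
qed

lemma tensor_square_operator_algebra: "tensor_square A \<pi> = operator_algebra (carrier (tensor_square A \<pi>))"
  unfolding tensor_square_def by (rule spatial_tensor_operator_algebra)

lemma tensor_cube_operator_algebra: "tensor_cube A \<pi> = operator_algebra (carrier (tensor_cube A \<pi>))"
  unfolding tensor_cube_def by (rule spatial_tensor_operator_algebra)

lemma
  assumes A: "unital_cstar_algebra A" "representation A \<pi>"
  shows star_subalgebra_tensor_square: "star_subalgebra (carrier (tensor_square A \<pi>))"
    and unital_cstar_algebra_tensor_square: "unital_cstar_algebra (tensor_square A \<pi>)"
    and representation_tensor_square: "representation (tensor_square A \<pi>) (tensor_rep A \<pi> A \<pi>)"
    and tensor_square_rep_apply: "T \<in> carrier (tensor_square A \<pi>) \<Longrightarrow> tensor_rep A \<pi> A \<pi> T = T"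
    and star_subalgebra_tensor_cube: "star_subalgebra (carrier (tensor_cube A \<pi>))"
proof -
  show sq: "star_subalgebra (carrier (tensor_square A \<pi>))" "unital_cstar_algebra (tensor_square A \<pi>)"
    "representation (tensor_square A \<pi>) (tensor_rep A \<pi> A \<pi>)"
    "T \<in> carrier (tensor_square A \<pi>) \<Longrightarrow> tensor_rep A \<pi> A \<pi> T = T"
    unfolding tensor_square_def
    by (rule star_subalgebra_spatial_tensor[OF A A] unital_cstar_algebra_spatial_tensor[OF A A]
        representation_tensor_rep[OF A A] tensor_rep_apply[OF A A], assumption?)+
  show "star_subalgebra (carrier (tensor_cube A \<pi>))"
    unfolding tensor_cube_def by (rule star_subalgebra_spatial_tensor[OF sq(2,3) A])
qed

lemma tensor_op_in_tensor_cube: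
  assumes A: "unital_cstar_algebra A" "representation A \<pi>"
    and "T \<in> carrier (tensor_square A \<pi>)" "a \<in> carrier A"
  shows "tensor_op T (\<pi> a) \<in> carrier (tensor_cube A \<pi>)"
  using tensor_op_in_spatial_tensor[OF assms(3,4), of "tensor_rep A \<pi> A \<pi>" \<pi>]
  by (simp add: tensor_cube_def tensor_square_rep_apply[OF A assms(3)])

lemma hadj_unitary_eq: "unitary_op U \<Longrightarrow> U \<cdot> x = y \<Longrightarrow> hadj U \<cdot> y = x"
  using unitary_opD(5) by blast

lemma conjugate_tensor_flip:
  assumes W: "unitary_op W" "\<And>x y. W \<cdot> (tensor_vec x y) = tensor_vec y x"
    and S: "clinear_op S" and T: "clinear_op T"
  shows "W o\<^sub>L (tensor_op S T o\<^sub>L hadj W) = tensor_op T S"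
  by (rule tensor_op_unique[symmetric])
    (simp_all add: unitary_opD(1,2)[OF W(1)] hadj_unitary_eq[OF W] W(2) S T tensor_op_apply
      clinear_op_compose clinear_op_tensor_op)

lemma conjugate_tensor_swap_last:
  assumes W: "unitary_op W" "\<And>x y z. W \<cdot> (tensor_vec (tensor_vec x y) z) = tensor_vec (tensor_vec x z) y"
    and S: "clinear_op S" and T: "clinear_op T" and R: "clinear_op R"
  shows "W o\<^sub>L (tensor_op (tensor_op S T) R o\<^sub>L hadj W) = tensor_op (tensor_op S R) T"
  by (rule clinear_op_eq_on_tensor_triples)
    (simp_all add: unitary_opD(1,2)[OF W(1)] hadj_unitary_eq[OF W] W(2) S T R tensor_op_apply
      clinear_op_compose clinear_op_tensor_op)

lemma conjugate_tensor_rotate: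
  assumes W: "unitary_op W" "\<And>x y z. W \<cdot> (tensor_vec (tensor_vec x y) z) = tensor_vec (tensor_vec z x) y"
    and S: "clinear_op S" and T: "clinear_op T" and R: "clinear_op R"
  shows "W o\<^sub>L (tensor_op (tensor_op S T) R o\<^sub>L hadj W) = tensor_op (tensor_op R S) T"
  by (rule clinear_op_eq_on_tensor_triples)
    (simp_all add: unitary_opD(1,2)[OF W(1)] hadj_unitary_eq[OF W] W(2) S T R tensor_op_apply
      clinear_op_compose clinear_op_tensor_op)

lemma conjugate_tensor_middle_swap:
  assumes W: "unitary_op W" "\<And>x x' y y'. W \<cdot> (tensor_vec (tensor_vec x x') (tensor_vec y y'))
      = tensor_vec (tensor_vec x y) (tensor_vec x' y')"
    and S: "clinear_op S" "clinear_op S'" and T: "clinear_op T" "clinear_op T'"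
  shows "W o\<^sub>L (tensor_op (tensor_op S S') (tensor_op T T') o\<^sub>L hadj W)
    = tensor_op (tensor_op S T) (tensor_op S' T')"
  by (rule clinear_op_eq_on_tensor_quadruples)
    (simp_all add: unitary_opD(1,2)[OF W(1)] hadj_unitary_eq[OF W] W(2) S T tensor_op_apply
      clinear_op_compose clinear_op_tensor_op)

lemma tensor_flip_apply:
  assumes A: "unital_cstar_algebra A" "representation A \<pi>"
    and W: "unitary_op W" "\<And>x y. W \<cdot> (tensor_vec x y) = tensor_vec y x"
    and T: "T \<in> carrier (tensor_square A \<pi>)"
  shows "tensor_flip A \<pi> T = W o\<^sub>L (T o\<^sub>L hadj W)"
proof -
  let ?S = "carrier (tensor_square A \<pi>)"
  let ?\<Phi> = "\<lambda>T. W o\<^sub>L (T o\<^sub>L hadj W)"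
  note S = star_subalgebra_tensor_square[OF A] and r = representationD[OF A]
  have \<Phi>: "?\<Phi> (tensor_op (\<pi> a) (\<pi> b)) = tensor_op (\<pi> b) (\<pi> a)" if "a \<in> carrier A" "b \<in> carrier A" for a b
    by (rule conjugate_tensor_flip[OF W r(1)[OF that(1)] r(1)[OF that(2)]])
  have mem: "tensor_op (\<pi> a) (\<pi> b) \<in> ?S" if "a \<in> carrier A" "b \<in> carrier A" for a b
    unfolding tensor_square_def by (rule tensor_op_in_spatial_tensor[OF that])
  let ?R = "{(tensor_op (\<pi> a) (\<pi> b), tensor_op (\<pi> b) (\<pi> a)) |a b. a \<in> carrier A \<and> b \<in> carrier A}"
  have "star_hom_extending (operator_algebra ?S) (operator_algebra ?S) ?R T = ?\<Phi> T"
  proof (rule star_hom_extending_spatial(1)[OF spatial_hom_conjugation[OF W(1)] S _ S _ _ _ T])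
    show "?S = closure (span (elementary_tensors A \<pi> A \<pi>))"
      by (simp add: tensor_square_def carrier_spatial_tensor)
  next
    fix g assume "g \<in> elementary_tensors A \<pi> A \<pi>"
    then obtain a b where ab: "a \<in> carrier A" "b \<in> carrier A" "g = tensor_op (\<pi> a) (\<pi> b)"
      unfolding elementary_tensors_def by blast
    show "?\<Phi> g \<in> ?S"
      unfolding ab(3) \<Phi>[OF ab(1,2)] by (rule mem[OF ab(2,1)])
    show "(g, ?\<Phi> g) \<in> ?R"
      unfolding ab(3) \<Phi>[OF ab(1,2)] using ab(1,2) by blast
  next
    fix s t assume "(s, t) \<in> ?R"
    then obtain a b where ab: "a \<in> carrier A" "b \<in> carrier A"
      and st: "s = tensor_op (\<pi> a) (\<pi> b)" "t = tensor_op (\<pi> b) (\<pi> a)"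
      by blast
    show "s \<in> ?S \<and> t = ?\<Phi> s"
      unfolding st \<Phi>[OF ab] using mem[OF ab] by blast
  qed
  then show ?thesis
    unfolding tensor_flip_def tensor_square_operator_algebra[symmetric] .
qed

text \<open>
  Common part of \<open>middle_unit\<close> and \<open>left_unit\<close>: the unitary \<open>W\<close> determines
  where the unit is inserted.
\<close>

lemma unit_insertion_apply:
  assumes A: "unital_cstar_algebra A" "representation A \<pi>" and W: "unitary_op W"
    and u: "\<And>a b. a \<in> carrier A \<Longrightarrow> b \<in> carrier A \<Longrightarrow>
      W o\<^sub>L (tensor_op (tensor_op (\<pi> a) (\<pi> b)) id_blinfun o\<^sub>L hadj W) = u a b"
    and uS: "\<And>a b. a \<in> carrier A \<Longrightarrow> b \<in> carrier A \<Longrightarrow> u a b \<in> carrier (tensor_cube A \<pi>)"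
    and T: "T \<in> carrier (tensor_square A \<pi>)"
  shows "star_hom_extending (tensor_square A \<pi>) (tensor_cube A \<pi>)
      {(tensor_op (\<pi> a) (\<pi> b), u a b) |a b. a \<in> carrier A \<and> b \<in> carrier A} T
    = W o\<^sub>L (tensor_op T id_blinfun o\<^sub>L hadj W)"
    and "W o\<^sub>L (tensor_op T id_blinfun o\<^sub>L hadj W) \<in> carrier (tensor_cube A \<pi>)"
proof -
  let ?S = "carrier (tensor_square A \<pi>)" and ?S' = "carrier (tensor_cube A \<pi>)"
  let ?\<Phi> = "\<lambda>T. W o\<^sub>L (tensor_op T id_blinfun o\<^sub>L hadj W)"
  let ?R = "{(tensor_op (\<pi> a) (\<pi> b), u a b) |a b. a \<in> carrier A \<and> b \<in> carrier A}"
  note S = star_subalgebra_tensor_square[OF A] and S' = star_subalgebra_tensor_cube[OF A]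
  have hom: "spatial_hom ?\<Phi>"
    by (rule spatial_hom_compose[OF spatial_hom_conjugation[OF W] spatial_hom_amplification])
  have eq: "?S = closure (span (elementary_tensors A \<pi> A \<pi>))"
    by (simp add: tensor_square_def carrier_spatial_tensor)
  have mem: "tensor_op (\<pi> a) (\<pi> b) \<in> ?S" if "a \<in> carrier A" "b \<in> carrier A" for a b
    unfolding tensor_square_def by (rule tensor_op_in_spatial_tensor[OF that])
  have G: "?\<Phi> g \<in> ?S'" "(g, ?\<Phi> g) \<in> ?R" if g: "g \<in> elementary_tensors A \<pi> A \<pi>" for g
  proof -
    obtain a b where ab: "a \<in> carrier A" "b \<in> carrier A" "g = tensor_op (\<pi> a) (\<pi> b)"
      using g unfolding elementary_tensors_def by blast
    show "?\<Phi> g \<in> ?S'"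
      unfolding ab(3) u[OF ab(1,2)] by (rule uS[OF ab(1,2)])
    show "(g, ?\<Phi> g) \<in> ?R"
      unfolding ab(3) u[OF ab(1,2)] using ab(1,2) by blast
  qed
  have R: "s \<in> ?S \<and> t = ?\<Phi> s" if st: "(s, t) \<in> ?R" for s t
  proof -
    obtain a b where ab: "a \<in> carrier A" "b \<in> carrier A" and st: "s = tensor_op (\<pi> a) (\<pi> b)" "t = u a b"
      using st by blast
    show ?thesis
      unfolding st u[OF ab] using mem[OF ab] by blast
  qed
  show "?\<Phi> T \<in> ?S'"
    by (rule star_hom_extending_spatial(2)[OF hom S eq S' G(1) R G(2) T])
  have "star_hom_extending (operator_algebra ?S) (operator_algebra ?S') ?R T = ?\<Phi> T"
    by (rule star_hom_extending_spatial(1)[OF hom S eq S' G(1) R G(2) T])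
  then show "star_hom_extending (tensor_square A \<pi>) (tensor_cube A \<pi>) ?R T = ?\<Phi> T"
    unfolding tensor_square_operator_algebra[symmetric] tensor_cube_operator_algebra[symmetric] .
qed

lemma
  assumes A: "unital_cstar_algebra A" "representation A \<pi>"
    and W: "unitary_op W" "\<And>x y z. W \<cdot> (tensor_vec (tensor_vec x y) z) = tensor_vec (tensor_vec x z) y"
    and T: "T \<in> carrier (tensor_square A \<pi>)"
  shows middle_unit_apply: "middle_unit A \<pi> T = W o\<^sub>L (tensor_op T id_blinfun o\<^sub>L hadj W)"
    and middle_unit_closed: "middle_unit A \<pi> T \<in> carrier (tensor_cube A \<pi>)"
proof -
  note r = representationD[OF A] and c = unital_cstar_algebra_closed[OF A(1)]
  let ?u = "\<lambda>a b. tensor_op (tensor_op (\<pi> a) (\<pi> \<one>\<^bsub>A\<^esub>)) (\<pi> b)"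
  have u: "W o\<^sub>L (tensor_op (tensor_op (\<pi> a) (\<pi> b)) id_blinfun o\<^sub>L hadj W) = ?u a b"
    if "a \<in> carrier A" "b \<in> carrier A" for a b
    unfolding r(4) by (rule conjugate_tensor_swap_last[OF W r(1)[OF that(1)] r(1)[OF that(2)] clinear_op_id])
  have uS: "?u a b \<in> carrier (tensor_cube A \<pi>)" if "a \<in> carrier A" "b \<in> carrier A" for a b
    by (rule tensor_op_in_tensor_cube[OF A _ that(2)])
      (unfold tensor_square_def, rule tensor_op_in_spatial_tensor[OF that(1) c(1)])
  show *: "middle_unit A \<pi> T = W o\<^sub>L (tensor_op T id_blinfun o\<^sub>L hadj W)"
    unfolding middle_unit_def by (rule unit_insertion_apply(1)[OF A W(1) u uS T])
  show "middle_unit A \<pi> T \<in> carrier (tensor_cube A \<pi>)"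
    unfolding * by (rule unit_insertion_apply(2)[OF A W(1) u uS T])
qed

lemma
  assumes A: "unital_cstar_algebra A" "representation A \<pi>"
    and W: "unitary_op W" "\<And>x y z. W \<cdot> (tensor_vec (tensor_vec x y) z) = tensor_vec (tensor_vec z x) y"
    and T: "T \<in> carrier (tensor_square A \<pi>)"
  shows left_unit_apply: "left_unit A \<pi> T = W o\<^sub>L (tensor_op T id_blinfun o\<^sub>L hadj W)"
    and left_unit_closed: "left_unit A \<pi> T \<in> carrier (tensor_cube A \<pi>)"
proof -
  note r = representationD[OF A] and c = unital_cstar_algebra_closed[OF A(1)]
  let ?u = "\<lambda>a b. tensor_op (tensor_op (\<pi> \<one>\<^bsub>A\<^esub>) (\<pi> a)) (\<pi> b)"
  have u: "W o\<^sub>L (tensor_op (tensor_op (\<pi> a) (\<pi> b)) id_blinfun o\<^sub>L hadj W) = ?u a b"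
    if "a \<in> carrier A" "b \<in> carrier A" for a b
    unfolding r(4) by (rule conjugate_tensor_rotate[OF W r(1)[OF that(1)] r(1)[OF that(2)] clinear_op_id])
  have uS: "?u a b \<in> carrier (tensor_cube A \<pi>)" if "a \<in> carrier A" "b \<in> carrier A" for a b
    by (rule tensor_op_in_tensor_cube[OF A _ that(2)])
      (unfold tensor_square_def, rule tensor_op_in_spatial_tensor[OF c(1) that(1)])
  show *: "left_unit A \<pi> T = W o\<^sub>L (tensor_op T id_blinfun o\<^sub>L hadj W)"
    unfolding left_unit_def by (rule unit_insertion_apply(1)[OF A W(1) u uS T])
  show "left_unit A \<pi> T \<in> carrier (tensor_cube A \<pi>)"
    unfolding * by (rule unit_insertion_apply(2)[OF A W(1) u uS T])
qed

lemma
  assumes A: "unital_cstar_algebra A" "representation A \<pi>" and T: "T \<in> carrier (tensor_square A \<pi>)"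
  shows right_unit_apply: "right_unit A \<pi> T = tensor_op T id_blinfun"
    and right_unit_closed: "right_unit A \<pi> T \<in> carrier (tensor_cube A \<pi>)"
  using tensor_op_in_tensor_cube[OF A T unital_cstar_algebra_closed(1)[OF A(1)]]
  by (simp_all add: right_unit_def representationD(4)[OF A])

text \<open>
  The prescribed values of \<open>middle_swap\<close> live on fourfold elementary tensors, whereas its
  domain is spanned by \<open>s \<otimes> t\<close> with \<open>s\<close>, \<open>t\<close> arbitrary in the tensor
  squares; the two have the same closed span because \<open>\<otimes>\<close> is separately continuous.
\<close>

lemma
  fixes A :: "'a cstar" and \<pi> :: "'a \<Rightarrow> 'h::chilbert_space op"
    and B :: "'b cstar" and \<sigma> :: "'b \<Rightarrow> 'k::chilbert_space op"
  assumes A: "unital_cstar_algebra A" "representation A \<pi>" and B: "unital_cstar_algebra B" "representation B \<sigma>"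
    and W: "unitary_op W" "\<And>x x' y y'. W \<cdot> (tensor_vec (tensor_vec x x') (tensor_vec y y'))
      = tensor_vec (tensor_vec x y) (tensor_vec x' y')"
    and T: "T \<in> carrier (spatial_tensor (tensor_square A \<pi>) (tensor_rep A \<pi> A \<pi>)
      (tensor_square B \<sigma>) (tensor_rep B \<sigma> B \<sigma>))"
  shows middle_swap_apply: "middle_swap A \<pi> B \<sigma> T = W o\<^sub>L (T o\<^sub>L hadj W)"
    and middle_swap_closed: "middle_swap A \<pi> B \<sigma> T
      \<in> carrier (tensor_square (spatial_tensor A \<pi> B \<sigma>) (tensor_rep A \<pi> B \<sigma>))"
proof -
  note rA = representationD[OF A] and rB = representationD[OF B]
  note sqA = unital_cstar_algebra_tensor_square[OF A] representation_tensor_square[OF A]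
  note sqB = unital_cstar_algebra_tensor_square[OF B] representation_tensor_square[OF B]
  note AB = unital_cstar_algebra_spatial_tensor[OF A B] representation_tensor_rep[OF A B]
  let ?E = "elementary_tensors (tensor_square A \<pi>) (tensor_rep A \<pi> A \<pi>) (tensor_square B \<sigma>) (tensor_rep B \<sigma> B \<sigma>)"
  let ?S = "carrier (spatial_tensor (tensor_square A \<pi>) (tensor_rep A \<pi> A \<pi>) (tensor_square B \<sigma>) (tensor_rep B \<sigma> B \<sigma>))"
  let ?S' = "carrier (tensor_square (spatial_tensor A \<pi> B \<sigma>) (tensor_rep A \<pi> B \<sigma>))"
  let ?\<Phi> = "\<lambda>T. W o\<^sub>L (T o\<^sub>L hadj W)"
  let ?g = "\<lambda>a a' b b'. tensor_op (tensor_op (\<pi> a) (\<pi> a')) (tensor_op (\<sigma> b) (\<sigma> b'))"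
  let ?h = "\<lambda>a a' b b'. tensor_op (tensor_op (\<pi> a) (\<sigma> b)) (tensor_op (\<pi> a') (\<sigma> b'))"
  define G where "G = {?g a a' b b' |a a' b b'. a \<in> carrier A \<and> a' \<in> carrier A \<and> b \<in> carrier B \<and> b' \<in> carrier B}"
  let ?R = "{(?g a a' b b', ?h a a' b b') |a a' b b'.
    a \<in> carrier A \<and> a' \<in> carrier A \<and> b \<in> carrier B \<and> b' \<in> carrier B}"
  note S = star_subalgebra_spatial_tensor[OF sqA sqB]
  note S' = star_subalgebra_tensor_square[OF AB]
  have inA: "tensor_op (\<pi> a) (\<pi> a') \<in> carrier (tensor_square A \<pi>)" if "a \<in> carrier A" "a' \<in> carrier A" for a a'
    unfolding tensor_square_def by (rule tensor_op_in_spatial_tensor[OF that])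
  have inB: "tensor_op (\<sigma> b) (\<sigma> b') \<in> carrier (tensor_square B \<sigma>)" if "b \<in> carrier B" "b' \<in> carrier B" for b b'
    unfolding tensor_square_def by (rule tensor_op_in_spatial_tensor[OF that])
  have gE: "?g a a' b b' \<in> ?E" if "a \<in> carrier A" "a' \<in> carrier A" "b \<in> carrier B" "b' \<in> carrier B" for a a' b b'
  proof -
    have "tensor_op (tensor_rep A \<pi> A \<pi> (tensor_op (\<pi> a) (\<pi> a'))) (tensor_rep B \<sigma> B \<sigma> (tensor_op (\<sigma> b) (\<sigma> b'))) \<in> ?E"
      unfolding elementary_tensors_def using inA[OF that(1,2)] inB[OF that(3,4)] by blast
    then show ?thesis
      by (simp add: tensor_square_rep_apply[OF A inA[OF that(1,2)]] tensor_square_rep_apply[OF B inB[OF that(3,4)]])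
  qed
  have GX: "g \<in> closure (span G)" if "g \<in> G" for g
    using that closure_subset span_base by blast
  have X: "subspace (closure (span G))" "closed (closure (span G))"
    by (simp_all add: subspace_closure)
  have clA: "clinear_op s" if "s \<in> carrier (tensor_square A \<pi>)" for s
    by (rule star_subalgebraD(1)[OF star_subalgebra_tensor_square[OF A] that])
  have clB: "clinear_op t" if "t \<in> carrier (tensor_square B \<sigma>)" for t
    by (rule star_subalgebraD(1)[OF star_subalgebra_tensor_square[OF B] that])
  have 1: "tensor_op (tensor_op (\<pi> a) (\<pi> a')) t \<in> closure (span G)"
    if a: "a \<in> carrier A" "a' \<in> carrier A" and t: "t \<in> carrier (tensor_square B \<sigma>)" for a a' t
  proof (rule closure_span_map(2)[where \<Phi> = "\<lambda>t. tensor_op (tensor_op (\<pi> a) (\<pi> a')) t"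
        and G = "elementary_tensors B \<sigma> B \<sigma>" and K = "norm (tensor_op (\<pi> a) (\<pi> a'))", OF clinear_ops_closed_subspace X])
    show "t \<in> closure (span (elementary_tensors B \<sigma> B \<sigma>))"
      using t by (simp add: tensor_square_def carrier_spatial_tensor)
    show "elementary_tensors B \<sigma> B \<sigma> \<subseteq> Collect clinear_op"
      using clinear_op_elementary[OF B B] by blast
    fix g assume "g \<in> elementary_tensors B \<sigma> B \<sigma>"
    then obtain b b' where b: "b \<in> carrier B" "b' \<in> carrier B" "g = tensor_op (\<sigma> b) (\<sigma> b')"
      unfolding elementary_tensors_def by blast
    have "?g a a' b b' \<in> G"
      unfolding G_def using a b by blast
    then show "tensor_op (tensor_op (\<pi> a) (\<pi> a')) g \<in> closure (span G)"
      unfolding b(3) by (rule GX)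
  qed (simp_all add: clA[OF inA[OF a]] tensor_op_add_right scaleR_eq_scale_op tensor_op_scale_right norm_tensor_op_le)
  have 2: "tensor_op s t \<in> closure (span G)"
    if s: "s \<in> carrier (tensor_square A \<pi>)" and t: "t \<in> carrier (tensor_square B \<sigma>)" for s t
  proof (rule closure_span_map(2)[where \<Phi> = "\<lambda>s. tensor_op s t"
        and G = "elementary_tensors A \<pi> A \<pi>" and K = "norm t", OF clinear_ops_closed_subspace X])
    show "s \<in> closure (span (elementary_tensors A \<pi> A \<pi>))"
      using s by (simp add: tensor_square_def carrier_spatial_tensor)
    show "elementary_tensors A \<pi> A \<pi> \<subseteq> Collect clinear_op"
      using clinear_op_elementary[OF A A] by blast
    fix g assume "g \<in> elementary_tensors A \<pi> A \<pi>"
    then obtain a a' where a: "a \<in> carrier A" "a' \<in> carrier A" "g = tensor_op (\<pi> a) (\<pi> a')"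
      unfolding elementary_tensors_def by blast
    show "tensor_op g t \<in> closure (span G)"
      unfolding a(3) by (rule 1[OF a(1,2) t])
  next
    fix r assume "r \<in> Collect (clinear_op :: ('h, 'h) htensor op \<Rightarrow> bool)"
    then show "norm (tensor_op r t) \<le> norm t * norm r"
      using norm_tensor_op_le[of r t] clB[OF t] by (simp add: mult.commute)
  qed (simp_all add: clB[OF t] tensor_op_add_left scaleR_eq_scale_op tensor_op_scale_left)
  have eq: "?S = closure (span G)"
  proof
    have "G \<subseteq> ?E"
      unfolding G_def using gE by blast
    then show "closure (span G) \<subseteq> ?S"
      unfolding carrier_spatial_tensor by (intro closure_mono span_mono)
    have "?E \<subseteq> closure (span G)"
    proof
      fix T assume "T \<in> ?E"
      then obtain s t where st: "s \<in> carrier (tensor_square A \<pi>)" "t \<in> carrier (tensor_square B \<sigma>)"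
        "T = tensor_op (tensor_rep A \<pi> A \<pi> s) (tensor_rep B \<sigma> B \<sigma> t)"
        unfolding elementary_tensors_def by blast
      show "T \<in> closure (span G)"
        unfolding st(3) tensor_square_rep_apply[OF A st(1)] tensor_square_rep_apply[OF B st(2)]
        by (rule 2[OF st(1,2)])
    qed
    then show "?S \<subseteq> closure (span G)"
      unfolding carrier_spatial_tensor by (intro closure_minimal span_minimal X)
  qed
  have \<Phi>: "?\<Phi> (?g a a' b b') = ?h a a' b b'"
    if "a \<in> carrier A" "a' \<in> carrier A" "b \<in> carrier B" "b' \<in> carrier B" for a a' b b'
    by (rule conjugate_tensor_middle_swap[OF W rA(1)[OF that(1)] rA(1)[OF that(2)] rB(1)[OF that(3)] rB(1)[OF that(4)]])
  have hS': "?h a a' b b' \<in> ?S'" if "a \<in> carrier A" "a' \<in> carrier A" "b \<in> carrier B" "b' \<in> carrier B" for a a' b b'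
  proof -
    have m: "tensor_op (\<pi> a) (\<sigma> b) \<in> carrier (spatial_tensor A \<pi> B \<sigma>)"
      "tensor_op (\<pi> a') (\<sigma> b') \<in> carrier (spatial_tensor A \<pi> B \<sigma>)"
      by (rule tensor_op_in_spatial_tensor[OF that(1,3)] tensor_op_in_spatial_tensor[OF that(2,4)])+
    show ?thesis
      using tensor_op_in_spatial_tensor[OF m, of "tensor_rep A \<pi> B \<sigma>" "tensor_rep A \<pi> B \<sigma>"]
      by (simp add: tensor_square_def tensor_rep_apply[OF A B m(1)] tensor_rep_apply[OF A B m(2)])
  qed
  have GG: "?\<Phi> g \<in> ?S'" "(g, ?\<Phi> g) \<in> ?R" if g: "g \<in> G" for g
  proof -
    obtain a a' b b' where ab: "a \<in> carrier A" "a' \<in> carrier A" "b \<in> carrier B" "b' \<in> carrier B"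
      and g': "g = ?g a a' b b'"
      using g unfolding G_def by blast
    show "?\<Phi> g \<in> ?S'"
      unfolding g' \<Phi>[OF ab] by (rule hS'[OF ab])
    show "(g, ?\<Phi> g) \<in> ?R"
      unfolding g' \<Phi>[OF ab] using ab by blast
  qed
  have R: "s \<in> ?S \<and> t = ?\<Phi> s" if st: "(s, t) \<in> ?R" for s t
  proof -
    obtain a a' b b' where ab: "a \<in> carrier A" "a' \<in> carrier A" "b \<in> carrier B" "b' \<in> carrier B"
      and st': "s = ?g a a' b b'" "t = ?h a a' b b'"
      using st by blast
    have "?g a a' b b' \<in> ?S"
      unfolding eq by (rule GX) (unfold G_def, use ab in blast)
    then show ?thesis
      unfolding st' \<Phi>[OF ab] by blast
  qed
  have "star_hom_extending (operator_algebra ?S) (operator_algebra ?S') ?R T = ?\<Phi> T"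
    by (rule star_hom_extending_spatial(1)[OF spatial_hom_conjugation[OF W(1)] S eq S' GG(1) R GG(2) T])
  then show *: "middle_swap A \<pi> B \<sigma> T = ?\<Phi> T"
    unfolding middle_swap_def spatial_tensor_operator_algebra[symmetric] tensor_square_operator_algebra[symmetric] .
  show "middle_swap A \<pi> B \<sigma> T \<in> ?S'"
    unfolding * by (rule star_hom_extending_spatial(2)[OF spatial_hom_conjugation[OF W(1)] S eq S' GG(1) R GG(2) T])
qed

section \<open>Schur's lemma and the atoms of an atomic representation\<close>

definition star_closed_ops :: "'h::chilbert_space op set \<Rightarrow> bool" where
  "star_closed_ops X \<longleftrightarrow> (\<forall>S\<in>X. clinear_op S \<and> hadj S \<in> X)"

lemma commutant_iff: "T \<in> commutant X \<longleftrightarrow> clinear_op T \<and> (\<forall>S\<in>X. T o\<^sub>L S = S o\<^sub>L T)"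
  unfolding commutant_def by (simp add: bounded_ops_iff)

lemma commutantD:
  assumes "T \<in> commutant X"
  shows "clinear_op T" "S \<in> X \<Longrightarrow> T \<cdot> (S \<cdot> x) = S \<cdot> (T \<cdot> x)"
  using assms unfolding commutant_iff by (auto simp flip: blinfun_apply_blinfun_compose)

lemma commutantI:
  assumes "clinear_op T" "\<And>S x. S \<in> X \<Longrightarrow> T \<cdot> (S \<cdot> x) = S \<cdot> (T \<cdot> x)"
  shows "T \<in> commutant X"
  unfolding commutant_iff using assms by (auto intro!: blinfun_eqI)

lemma
  assumes "S \<in> commutant X" "T \<in> commutant X" and X: "\<And>S. S \<in> X \<Longrightarrow> clinear_op S"
  shows commutant_add: "S + T \<in> commutant X" and commutant_diff: "S - T \<in> commutant X"
    and commutant_compose: "S o\<^sub>L T \<in> commutant X" and commutant_scale: "scale_op c S \<in> commutant X"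
  by (rule commutantI; simp add: commutantD[OF assms(1)] commutantD[OF assms(2)] clinear_op_add clinear_op_diff
      clinear_op_compose clinear_op_scale blinfun.add_left blinfun.add_right blinfun.diff_left blinfun.diff_right
      scale_op_apply clinear_opD[OF X])+

lemma commutant_hadj:
  assumes T: "T \<in> commutant X" and X: "star_closed_ops X"
  shows "hadj T \<in> commutant X"
proof (rule commutantI)
  note cT = commutantD(1)[OF T]
  show "clinear_op (hadj T)"
    by (rule clinear_op_hadj[OF cT])
  fix S x assume S: "S \<in> X"
  then have cS: "clinear_op S" and S': "hadj S \<in> X"
    using X unfolding star_closed_ops_def by auto
  show "hadj T \<cdot> (S \<cdot> x) = S \<cdot> (hadj T \<cdot> x)"
  proof (rule cinner_ext)
    fix y
    have "cinner y (hadj T \<cdot> (S \<cdot> x)) = cinner (hadj S \<cdot> (T \<cdot> y)) x"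
      by (simp add: cinner_hadj_right[OF cT] cinner_hadj_left[OF cS])
    also have "\<dots> = cinner (T \<cdot> (hadj S \<cdot> y)) x"
      by (simp add: commutantD(2)[OF T S'])
    also have "\<dots> = cinner y (S \<cdot> (hadj T \<cdot> x))"
      by (simp add: cinner_hadj_right[OF cT, symmetric] cinner_hadj_left[OF cS])
    finally show "cinner y (hadj T \<cdot> (S \<cdot> x)) = cinner y (S \<cdot> (hadj T \<cdot> x))" .
  qed
qed

lemma star_closed_ops_representation:
  assumes A: "unital_cstar_algebra A" "representation A \<pi>"
  shows "star_closed_ops (\<pi> ` carrier A)"
  unfolding star_closed_ops_def
proof (intro ballI conjI)
  fix S assume "S \<in> \<pi> ` carrier A"
  then obtain a where a: "a \<in> carrier A" "S = \<pi> a" by blast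
  show "clinear_op S"
    unfolding a(2) by (rule representationD(1)[OF A a(1)])
  have "hadj S = \<pi> (star A a)"
    unfolding a(2) by (rule representationD(6)[OF A a(1), symmetric])
  then show "hadj S \<in> \<pi> ` carrier A"
    using unital_cstar_algebra_closed(4)[OF A(1) a(1)] by simp
qed

lemma star_closed_opsD: "star_closed_ops X \<Longrightarrow> S \<in> X \<Longrightarrow> clinear_op S"
  unfolding star_closed_ops_def by blast

lemma star_closed_commutant: "star_closed_ops X \<Longrightarrow> star_closed_ops (commutant X)"
  using commutant_hadj commutantD(1) unfolding star_closed_ops_def by blast

lemma is_projectionD:
  assumes "is_projection P"
  shows "selfadjoint P" "clinear_op P" "hadj P = P" "P \<cdot> (P \<cdot> x) = P \<cdot> x"
    "cinner (P \<cdot> x) y = cinner x (P \<cdot> y)"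
proof -
  show sa: "selfadjoint P"
    using assms by (simp add: is_projection_iff)
  show "clinear_op P" "hadj P = P" "cinner (P \<cdot> x) y = cinner x (P \<cdot> y)"
    by (rule selfadjointD[OF sa])+
  have "P o\<^sub>L P = P"
    using assms by (simp add: is_projection_iff)
  then show "P \<cdot> (P \<cdot> x) = P \<cdot> x"
    by (metis blinfun_apply_blinfun_compose)
qed

text \<open>
  The range of \<open>P\<close> is invariant under \<open>\<pi> a\<close> and under its adjoint \<open>\<pi> (a\<^sup>*)\<close>.
\<close>

lemma projection_in_commutant:
  assumes A: "unital_cstar_algebra A" "representation A \<pi>"
    and P: "is_projection P" and V: "invariant_subspace A \<pi> (range (blinfun_apply P))"
  shows "P \<in> commutant (\<pi> ` carrier A)"
  unfolding commutant_iff
proof (intro conjI ballI is_projectionD(2)[OF P])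
  fix S assume "S \<in> \<pi> ` carrier A"
  then obtain a where a: "a \<in> carrier A" "S = \<pi> a" by blast
  have inv: "P \<cdot> (\<pi> b \<cdot> x) = \<pi> b \<cdot> x"
    if "b \<in> carrier A" "P \<cdot> x = x" for b x
  proof -
    have "x \<in> range (blinfun_apply P)"
      using that(2) by (metis rangeI)
    then have "\<pi> b \<cdot> x \<in> range (blinfun_apply P)"
      using V that(1) unfolding invariant_subspace_def by blast
    then show ?thesis
      by (simp add: projection_range_iff[OF P])
  qed
  have "S o\<^sub>L P = P o\<^sub>L S"
    unfolding a(2)
  proof (rule commute_with_projection[OF P representationD(1)[OF A a(1)]])
    fix x assume x: "P \<cdot> x = x"
    show "P \<cdot> (\<pi> a \<cdot> x) = \<pi> a \<cdot> x"
      by (rule inv[OF a(1) x])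
    show "P \<cdot> (hadj (\<pi> a) \<cdot> x) = hadj (\<pi> a) \<cdot> x"
      using inv[OF unital_cstar_algebra_closed(4)[OF A(1) a(1)] x] by (simp add: representationD(6)[OF A a(1)])
  qed
  then show "P o\<^sub>L S = S o\<^sub>L P"
    by simp
qed

lemma closed_csubspace_kernel:
  assumes V: "closed_csubspace V" and T: "clinear_op (T :: 'h::chilbert_space op)"
  shows "closed_csubspace {v \<in> V. T \<cdot> v = 0}"
proof -
  have eq: "{v \<in> V. T \<cdot> v = 0} = V \<inter> blinfun_apply T -` {0}"
    by blast
  have "closed (blinfun_apply T -` {0})"
    by (intro continuous_closed_vimage linear_continuous_at closed_singleton blinfun.bounded_linear_right)
  then have "closed {v \<in> V. T \<cdot> v = 0}"
    using V unfolding eq closed_csubspace_def by (intro closed_Int) auto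
  moreover have "subspace {v \<in> V. T \<cdot> v = 0}"
    using V unfolding closed_csubspace_def
    by (intro subspaceI)
      (simp_all add: subspace_0 subspace_add subspace_scale blinfun.add_right blinfun.scaleR_right)
  ultimately show ?thesis
    using V unfolding closed_csubspace_def by (simp add: clinear_opD[OF T])
qed

text \<open>
  For every real \<open>t\<close> let \<open>N = T - t\<close> and \<open>R = |N|\<close>. The vectors with
  \<open>R v = N v\<close> form an invariant subspace of \<open>V\<close> that contains the range of
  \<open>R + N\<close>. By irreducibility it is everything, and then \<open>T \<ge> t\<close> on \<open>V\<close>, or
  it is zero, and then \<open>N = - R\<close>, so that \<open>T \<le> t\<close> on \<open>V\<close>. Hence the numerical
  range of \<open>T\<close> on \<open>V\<close> is a point.
\<close>

lemma schur_selfadjoint: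
  assumes A: "unital_cstar_algebra A" "representation A \<pi>"
    and V: "irreducible_subrep A \<pi> (range (blinfun_apply P))" and P: "is_projection P"
    and T: "T \<in> commutant (\<pi> ` carrier A)" "selfadjoint T" "T o\<^sub>L P = P o\<^sub>L T"
  shows "\<exists>t::real. \<forall>v\<in>range (blinfun_apply P). T \<cdot> v = t *\<^sub>R v"
proof -
  let ?V = "range (blinfun_apply P)"
  note r = representationD[OF A]
  have inv: "invariant_subspace A \<pi> ?V" and ne: "?V \<noteq> {0}"
    and irr: "\<And>W. invariant_subspace A \<pi> W \<Longrightarrow> W \<subseteq> ?V \<Longrightarrow> W = {0} \<or> W = ?V"
    using V unfolding irreducible_subrep_def by blast+
  have cV: "closed_csubspace ?V" and sV: "subspace ?V"
    and aV: "\<And>a x. a \<in> carrier A \<Longrightarrow> x \<in> ?V \<Longrightarrow> \<pi> a \<cdot> x \<in> ?V"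
    using inv unfolding invariant_subspace_def closed_csubspace_def by blast+
  have presV: "R \<cdot> v \<in> ?V" if "R o\<^sub>L P = P o\<^sub>L R" "v \<in> ?V" for R v
  proof -
    have "P \<cdot> (R \<cdot> v) = R \<cdot> (P \<cdot> v)"
      using that(1) by (metis blinfun_apply_blinfun_compose)
    then show ?thesis
      using that(2) by (simp add: projection_range_iff[OF P])
  qed
  have dich: "(\<forall>v\<in>?V. t * (norm v)\<^sup>2 \<le> inner v (T \<cdot> v)) \<or>
      (\<forall>v\<in>?V. inner v (T \<cdot> v) \<le> t * (norm v)\<^sup>2)" for t
  proof -
    let ?N = "T - t *\<^sub>R id_blinfun"
    have saN: "selfadjoint ?N"
      by (rule selfadjoint_diff[OF T(2) selfadjoint_scaleR[OF selfadjoint_id selfadjoint_id]])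
    have N: "?N \<cdot> x = T \<cdot> x - t *\<^sub>R x" for x
      by (simp add: blinfun.diff_left blinfun.scaleR_left)
    have "positive_op (?N o\<^sub>L ?N)"
      using positive_op_hadj_compose(1)[OF selfadjointD(1)[OF saN]] selfadjointD(2)[OF saN] by simp
    then obtain R where R: "positive_op R" "R o\<^sub>L R = ?N o\<^sub>L ?N"
      and Rc: "\<And>Z. Z o\<^sub>L (?N o\<^sub>L ?N) = (?N o\<^sub>L ?N) o\<^sub>L Z \<Longrightarrow> Z o\<^sub>L R = R o\<^sub>L Z"
      using positive_op_sqrt by blast
    have Rc': "Z \<cdot> (R \<cdot> x) = R \<cdot> (Z \<cdot> x)"
      if "\<And>x. Z \<cdot> (?N \<cdot> x) = ?N \<cdot> (Z \<cdot> x)" for Z x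
    proof -
      have "Z o\<^sub>L (?N o\<^sub>L ?N) = (?N o\<^sub>L ?N) o\<^sub>L Z"
        by (rule blinfun_eqI) (simp only: blinfun_apply_blinfun_compose that)
      then have "Z o\<^sub>L R = R o\<^sub>L Z"
        by (rule Rc)
      then show ?thesis
        by (metis blinfun_apply_blinfun_compose)
    qed
    have RR: "R \<cdot> (R \<cdot> x) = ?N \<cdot> (?N \<cdot> x)" for x
      using R(2) by (metis blinfun_apply_blinfun_compose)
    have RN: "?N \<cdot> (R \<cdot> x) = R \<cdot> (?N \<cdot> x)" for x
      by (rule Rc') simp
    have TP: "T \<cdot> (P \<cdot> x) = P \<cdot> (T \<cdot> x)" for x
      using T(3) by (metis blinfun_apply_blinfun_compose)
    have PN: "P \<cdot> (?N \<cdot> x) = ?N \<cdot> (P \<cdot> x)" for x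
      unfolding N by (simp add: TP blinfun.diff_right blinfun.scaleR_right)
    have PR: "P \<cdot> (R \<cdot> x) = R \<cdot> (P \<cdot> x)" for x
      by (rule Rc') (rule PN)
    have aN: "\<pi> a \<cdot> (?N \<cdot> x) = ?N \<cdot> (\<pi> a \<cdot> x)"
      if "a \<in> carrier A" for a x
      unfolding N using commutantD(2)[OF T(1) imageI[OF that], of x]
      by (simp add: blinfun.diff_right blinfun.scaleR_right)
    have aR: "\<pi> a \<cdot> (R \<cdot> x) = R \<cdot> (\<pi> a \<cdot> x)"
      if "a \<in> carrier A" for a x
      by (rule Rc') (rule aN[OF that])
    have saR: "selfadjoint R" and posR: "\<And>x. 0 \<le> inner x (R \<cdot> x)"
      using R(1) unfolding positive_op_def by blast+
    have cl: "clinear_op (R - ?N)"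
      by (rule clinear_op_diff[OF selfadjointD(1)[OF saR] selfadjointD(1)[OF saN]])
    let ?K = "{v \<in> ?V. (R - ?N) \<cdot> v = 0}"
    have K: "v \<in> ?K \<longleftrightarrow> v \<in> ?V \<and> R \<cdot> v = ?N \<cdot> v" for v
      unfolding blinfun.diff_left[of R] by simp
    have "invariant_subspace A \<pi> ?K"
      unfolding invariant_subspace_def
    proof (intro conjI closed_csubspace_kernel[OF cV cl] ballI)
      fix a x assume a: "a \<in> carrier A" and x: "x \<in> ?K"
      have x': "x \<in> ?V" "R \<cdot> x = ?N \<cdot> x"
        using x K by blast+
      have "R \<cdot> (\<pi> a \<cdot> x) = ?N \<cdot> (\<pi> a \<cdot> x)"
        unfolding aR[OF a, symmetric] aN[OF a, symmetric] x'(2) ..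
      then show "\<pi> a \<cdot> x \<in> ?K"
        unfolding K using aV[OF a x'(1)] by blast
    qed
    then have "?K = {0} \<or> ?K = ?V"
      by (rule irr) blast
    then show ?thesis
    proof
      assume eq: "?K = ?V"
      have "t * (norm v)\<^sup>2 \<le> inner v (T \<cdot> v)" if "v \<in> ?V" for v
      proof -
        have "v \<in> ?K"
          using that unfolding eq .
        then have "R \<cdot> v = ?N \<cdot> v"
          unfolding K by blast
        then have "R \<cdot> v = T \<cdot> v - t *\<^sub>R v"
          unfolding N .
        then show ?thesis
          using posR[of v] by (simp add: inner_diff_right power2_norm_eq_inner)
      qed
      then show ?thesis by blast
    next
      assume eq: "?K = {0}"
      have "inner v (T \<cdot> v) \<le> t * (norm v)\<^sup>2" if v: "v \<in> ?V" for v
      proof -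
        let ?w = "R \<cdot> v + ?N \<cdot> v"
        have "R \<cdot> v \<in> ?V" "?N \<cdot> v \<in> ?V"
          using v PR[of v] PN[of v] by (simp_all only: projection_range_iff[OF P])
        then have "?w \<in> ?V"
          by (rule subspace_add[OF sV])
        moreover have "R \<cdot> ?w = ?N \<cdot> ?w"
          unfolding blinfun.add_right RR RN by (simp only: add.commute)
        ultimately have "?w = 0"
          using K[of ?w] eq by blast
        then have "R \<cdot> v = t *\<^sub>R v - T \<cdot> v"
          unfolding N by (simp add: algebra_simps add_eq_0_iff)
        then show ?thesis
          using posR[of v] by (simp add: inner_diff_right power2_norm_eq_inner)
      qed
      then show ?thesis by blast
    qed
  qed
  obtain v0 where v0: "v0 \<in> ?V" "v0 \<noteq> 0"
    using ne subspace_0[OF sV] by blast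
  define t where "t = inner v0 (T \<cdot> v0) / (norm v0)\<^sup>2"
  have t: "inner v0 (T \<cdot> v0) = t * (norm v0)\<^sup>2"
    using v0(2) by (simp add: t_def)
  have form: "inner v (T \<cdot> v) = t * (norm v)\<^sup>2" if v: "v \<in> ?V" for v
  proof (cases "v = 0")
    case False
    define q where "q = inner v (T \<cdot> v) / (norm v)\<^sup>2"
    have q: "inner v (T \<cdot> v) = q * (norm v)\<^sup>2"
      using False by (simp add: q_def)
    have n: "(norm v)\<^sup>2 > 0" "(norm v0)\<^sup>2 > 0"
      using False v0 by simp_all
    have "(t + q) / 2 \<le> t \<and> (t + q) / 2 \<le> q \<or> t \<le> (t + q) / 2 \<and> q \<le> (t + q) / 2"
      using dich[of "(t + q) / 2"]
    proof
      assume "\<forall>v\<in>?V. (t + q) / 2 * (norm v)\<^sup>2 \<le> inner v (T \<cdot> v)"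
      then have "(t + q) / 2 * (norm v0)\<^sup>2 \<le> t * (norm v0)\<^sup>2" "(t + q) / 2 * (norm v)\<^sup>2 \<le> q * (norm v)\<^sup>2"
        using v0(1) v t q by metis+
      then show ?thesis
        using mult_right_le_imp_le n by blast
    next
      assume "\<forall>v\<in>?V. inner v (T \<cdot> v) \<le> (t + q) / 2 * (norm v)\<^sup>2"
      then have "t * (norm v0)\<^sup>2 \<le> (t + q) / 2 * (norm v0)\<^sup>2" "q * (norm v)\<^sup>2 \<le> (t + q) / 2 * (norm v)\<^sup>2"
        using v0(1) v t q by metis+
      then show ?thesis
        using mult_right_le_imp_le n by blast
    qed
    then have "q = t"
      by argo
    then show ?thesis
      using q by simp
  qed simp
  have "T \<cdot> v = t *\<^sub>R v" if v: "v \<in> ?V" for v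
  proof -
    \<comment> \<open>The form of \<open>T - t\<close> vanishes on \<open>V\<close>, hence so does its polarization.\<close>
    define w where "w = T \<cdot> v - t *\<^sub>R v"
    have w: "w \<in> ?V"
      unfolding w_def by (rule subspace_diff[OF sV presV[OF T(3) v] subspace_scale[OF sV v]])
    have "inner (w + v) (T \<cdot> (w + v)) = t * (norm (w + v))\<^sup>2"
      by (rule form[OF subspace_add[OF sV w v]])
    then have "inner w (T \<cdot> v) + inner v (T \<cdot> w) = 2 * t * inner w v"
      using form[OF v] form[OF w]
      by (simp add: blinfun.add_right inner_add_left inner_add_right power2_norm_eq_inner inner_commute algebra_simps)
    moreover have "inner v (T \<cdot> w) = inner w (T \<cdot> v)"
      using inner_selfadjoint[OF T(2), of v w] by (simp add: inner_commute)
    ultimately have "inner w (T \<cdot> v - t *\<^sub>R v) = 0"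
      by (simp add: inner_diff_right)
    then have "w = 0"
      unfolding w_def[symmetric] by simp
    then show ?thesis
      by (simp add: w_def)
  qed
  then show ?thesis
    by blast
qed

text \<open>
  The selfadjoint case is applied to \<open>T + T\<^sup>*\<close> and \<open>\<i> (T - T\<^sup>*)\<close>.
\<close>

lemma schur:
  assumes A: "unital_cstar_algebra A" "representation A \<pi>"
    and V: "irreducible_subrep A \<pi> (range (blinfun_apply P))" and P: "is_projection P"
    and T: "T \<in> commutant (\<pi> ` carrier A)" "T o\<^sub>L P = P o\<^sub>L T"
  shows "\<exists>c. \<forall>v\<in>range (blinfun_apply P). T \<cdot> v = c *\<^sub>C v"
proof -
  let ?X = "\<pi> ` carrier A"
  note X = star_closed_ops_representation[OF A]
  note cX = star_closed_opsD[OF X]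
  note cT = commutantD(1)[OF T(1)] and pP = is_projectionD[OF P]
  note T' = commutant_hadj[OF T(1) X]
  have TP: "T \<cdot> (P \<cdot> x) = P \<cdot> (T \<cdot> x)" for x
    using T(2) by (metis blinfun_apply_blinfun_compose)
  have "hadj (T o\<^sub>L P) = hadj (P o\<^sub>L T)"
    using T(2) by simp
  then have "P o\<^sub>L hadj T = hadj T o\<^sub>L P"
    by (simp add: hadj_compose cT pP(2,3))
  then have TP': "hadj T \<cdot> (P \<cdot> x) = P \<cdot> (hadj T \<cdot> x)" for x
    by (metis blinfun_apply_blinfun_compose)
  have "selfadjoint (T + hadj T)"
    unfolding selfadjoint_def
    by (simp add: clinear_op_add cT clinear_op_hadj hadj_add hadj_hadj add.commute)
  moreover have "(T + hadj T) o\<^sub>L P = P o\<^sub>L (T + hadj T)"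
    by (rule blinfun_eqI) (simp add: blinfun.add_left blinfun.add_right TP TP')
  ultimately obtain t where t: "\<And>v. v \<in> range (blinfun_apply P) \<Longrightarrow> (T + hadj T) \<cdot> v = t *\<^sub>R v"
    using schur_selfadjoint[OF A V P commutant_add[OF T(1) T' cX]] by blast
  have "selfadjoint (scale_op \<i> (T - hadj T))"
  proof -
    have "hadj (scale_op \<i> (T - hadj T)) = scale_op (- \<i>) (hadj T - T)"
      by (simp add: hadj_scale hadj_diff clinear_op_diff cT clinear_op_hadj hadj_hadj)
    also have "\<dots> = scale_op \<i> (T - hadj T)"
      by (rule blinfun_eqI) (simp add: scale_op_apply blinfun.diff_left scaleC_diff_right scaleC_minus_left)
    finally show ?thesis
      unfolding selfadjoint_def by (simp add: clinear_op_scale clinear_op_diff cT clinear_op_hadj)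
  qed
  moreover have "scale_op \<i> (T - hadj T) o\<^sub>L P = P o\<^sub>L scale_op \<i> (T - hadj T)"
    by (rule blinfun_eqI)
      (simp add: scale_op_apply blinfun.diff_left blinfun.diff_right TP TP' clinear_opD[OF pP(2)])
  ultimately obtain s where s: "\<And>v. v \<in> range (blinfun_apply P) \<Longrightarrow> (scale_op \<i> (T - hadj T)) \<cdot> v = s *\<^sub>R v"
    using schur_selfadjoint[OF A V P commutant_scale[OF commutant_diff[OF T(1) T' cX] T' cX]] by blast
  have "T \<cdot> v = ((complex_of_real t - \<i> * complex_of_real s) / 2) *\<^sub>C v" if "v \<in> range (blinfun_apply P)" for v
  proof -
    have 1: "T \<cdot> v + hadj T \<cdot> v = complex_of_real t *\<^sub>C v"
      using t[OF that] by (simp add: blinfun.add_left scaleR_scaleC)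
    have "(- \<i>) *\<^sub>C (\<i> *\<^sub>C (T \<cdot> v - hadj T \<cdot> v)) = (- \<i>) *\<^sub>C (complex_of_real s *\<^sub>C v)"
      using s[OF that] by (simp add: scale_op_apply blinfun.diff_left scaleR_scaleC)
    then have 2: "T \<cdot> v - hadj T \<cdot> v = (- \<i> * complex_of_real s) *\<^sub>C v"
      by (simp add: scaleC_scaleC)
    have "2 *\<^sub>C T \<cdot> v = T \<cdot> v + T \<cdot> v"
      using scaleC_add_left[of 1 1 "T \<cdot> v"] by simp
    also have "\<dots> = (T \<cdot> v + hadj T \<cdot> v) + (T \<cdot> v - hadj T \<cdot> v)"
      by simp
    also have "\<dots> = (complex_of_real t + - \<i> * complex_of_real s) *\<^sub>C v"
      unfolding 1 2 by (simp only: scaleC_add_left)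
    finally have "(1 / 2) *\<^sub>C (2 *\<^sub>C T \<cdot> v) = (1 / 2) *\<^sub>C ((complex_of_real t + - \<i> * complex_of_real s) *\<^sub>C v)"
      by simp
    then show ?thesis
      by (simp add: scaleC_scaleC)
  qed
  then show ?thesis
    by blast
qed

text \<open>
  An intertwiner \<open>B\<close> between inequivalent irreducible subspaces vanishes: otherwise
  \<open>B\<^sup>* B\<close> and \<open>B B\<^sup>*\<close> are nonzero scalars there, and a multiple of \<open>B\<close>
  is a unitary equivalence.
\<close>

lemma intertwiner_zero:
  assumes A: "unital_cstar_algebra A" "representation A \<pi>"
    and V: "irreducible_subrep A \<pi> (range (blinfun_apply P))" and P: "is_projection P"
    and W: "irreducible_subrep A \<pi> (range (blinfun_apply Q))" and Q: "is_projection Q"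
    and T: "T \<in> commutant (\<pi> ` carrier A)"
    and neq: "\<not> equivalent_subreps A \<pi> (range (blinfun_apply P)) (range (blinfun_apply Q))"
  shows "Q o\<^sub>L (T o\<^sub>L P) = 0"
proof -
  let ?V = "range (blinfun_apply P)" and ?W = "range (blinfun_apply Q)" and ?X = "\<pi> ` carrier A"
  note X = star_closed_ops_representation[OF A]
  note cX = star_closed_opsD[OF X] and pP = is_projectionD[OF P] and pQ = is_projectionD[OF Q]
  have PX: "P \<in> commutant ?X" and QX: "Q \<in> commutant ?X"
    using projection_in_commutant[OF A P] projection_in_commutant[OF A Q] V W
    unfolding irreducible_subrep_def by blast+
  define B where "B = Q o\<^sub>L (T o\<^sub>L P)"
  have BX: "B \<in> commutant ?X"
    unfolding B_def by (rule commutant_compose[OF QX commutant_compose[OF T PX cX] cX])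
  have B'X: "hadj B \<in> commutant ?X"
    by (rule commutant_hadj[OF BX X])
  note cB = commutantD(1)[OF BX]
  have hB: "hadj B = P o\<^sub>L (hadj T o\<^sub>L Q)"
    unfolding B_def
    by (simp add: hadj_compose clinear_op_compose commutantD(1)[OF T] pP(2,3) pQ(2,3))
      (rule blinfun_eqI, simp)
  have BP: "B \<cdot> (P \<cdot> x) = B \<cdot> x" "Q \<cdot> (B \<cdot> x) = B \<cdot> x"
    "hadj B \<cdot> (Q \<cdot> x) = hadj B \<cdot> x"
    "P \<cdot> (hadj B \<cdot> x) = hadj B \<cdot> x" for x
    unfolding hB unfolding B_def by (simp_all add: pP(4) pQ(4))
  have "(hadj B o\<^sub>L B) o\<^sub>L P = P o\<^sub>L (hadj B o\<^sub>L B)"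
    by (rule blinfun_eqI) (simp add: BP)
  moreover have "selfadjoint (hadj B o\<^sub>L B)"
    using positive_op_hadj_compose(1)[OF cB] unfolding positive_op_def by blast
  ultimately obtain t where t: "\<And>v. v \<in> ?V \<Longrightarrow> hadj B \<cdot> (B \<cdot> v) = t *\<^sub>R v"
    using schur_selfadjoint[OF A V P commutant_compose[OF B'X BX cX]] by auto
  have "(B o\<^sub>L hadj B) o\<^sub>L Q = Q o\<^sub>L (B o\<^sub>L hadj B)"
    by (rule blinfun_eqI) (simp add: BP)
  moreover have "selfadjoint (B o\<^sub>L hadj B)"
    using positive_op_hadj_compose(1)[OF clinear_op_hadj[OF cB]] hadj_hadj[OF cB] unfolding positive_op_def by simp
  ultimately obtain s where s: "\<And>w. w \<in> ?W \<Longrightarrow> B \<cdot> (hadj B \<cdot> w) = s *\<^sub>R w"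
    using schur_selfadjoint[OF A W Q commutant_compose[OF BX B'X cX]] by auto
  have nB: "(norm (B \<cdot> v))\<^sup>2 = t * (norm v)\<^sup>2" if "v \<in> ?V" for v
    using positive_op_hadj_compose(2)[OF cB, of v] t[OF that] by (simp add: power2_norm_eq_inner)
  have "B \<cdot> (P \<cdot> x) = 0" for x
  proof (rule ccontr)
    define v where "v = P \<cdot> x"
    assume "B \<cdot> (P \<cdot> x) \<noteq> 0"
    then have v: "v \<in> ?V" "B \<cdot> v \<noteq> 0"
      by (simp_all add: v_def)
    have "0 < (norm (B \<cdot> v))\<^sup>2"
      using v(2) by simp
    then have "t * (norm v)\<^sup>2 > 0"
      unfolding nB[OF v(1)] .
    then have tpos: "t > 0"
      by (simp add: zero_less_mult_iff)
    have "B \<cdot> v \<in> ?W"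
      by (simp add: projection_range_iff[OF Q] BP)
    then have "s *\<^sub>R B \<cdot> v = t *\<^sub>R B \<cdot> v"
      using s t[OF v(1)] by (metis blinfun.scaleR_right)
    then have st: "s = t"
      using v(2) by simp
    define U where "U = (1 / sqrt t) *\<^sub>R B"
    have U: "U \<cdot> x = (1 / sqrt t) *\<^sub>R B \<cdot> x" for x
      by (simp add: U_def blinfun.scaleR_left)
    have "blinfun_apply U ` ?V = ?W"
    proof
      show "blinfun_apply U ` ?V \<subseteq> ?W"
      proof
        fix y assume "y \<in> blinfun_apply U ` ?V"
        then obtain z where "y = (1 / sqrt t) *\<^sub>R B \<cdot> z"
          using U by blast
        then show "y \<in> ?W"
          by (simp add: projection_range_iff[OF Q] blinfun.scaleR_right BP)
      qed
      show "?W \<subseteq> blinfun_apply U ` ?V"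
      proof
        fix w assume w: "w \<in> ?W"
        let ?v = "(1 / sqrt t) *\<^sub>R hadj B \<cdot> w"
        have "U \<cdot> ?v = (1 / t) *\<^sub>R B \<cdot> (hadj B \<cdot> w)"
          using tpos by (simp add: U blinfun.scaleR_right flip: real_sqrt_mult)
        also have "\<dots> = w"
          using tpos s[OF w] st by simp
        finally have "U \<cdot> ?v = w" .
        moreover have "?v \<in> ?V"
          by (simp add: projection_range_iff[OF P] blinfun.scaleR_right BP)
        ultimately show "w \<in> blinfun_apply U ` ?V"
          by (metis image_eqI)
      qed
    qed
    moreover have "norm (U \<cdot> x) = norm x" if "x \<in> ?V" for x
    proof -
      have "(norm (U \<cdot> x))\<^sup>2 = (norm x)\<^sup>2"
        using nB[OF that] tpos by (simp add: U power_mult_distrib power_divide)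
      then show ?thesis
        by simp
    qed
    moreover have "clinear_op U"
      unfolding U_def by (rule clinear_op_scaleR[OF cB])
    moreover have "U \<cdot> (\<pi> a \<cdot> x) = \<pi> a \<cdot> (U \<cdot> x)"
      if "a \<in> carrier A" for a x
      using commutantD(2)[OF BX imageI[OF that]] by (simp add: U blinfun.scaleR_right)
    ultimately have "equivalent_subreps A \<pi> ?V ?W"
      unfolding equivalent_subreps_def
      by (intro exI[of _ "blinfun_apply U"]) (simp add: blinfun.add_right clinear_opD)
    then show False
      using neq by blast
  qed
  then have "B = 0"
    by (intro blinfun_eqI) (simp add: BP)
  then show ?thesis
    by (simp add: B_def)
qed

definition atomic_decomposition :: "'a cstar \<Rightarrow> ('a \<Rightarrow> 'h::chilbert_space op) \<Rightarrow> 'h set set \<Rightarrow> bool" where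
  "atomic_decomposition A \<pi> \<V> \<longleftrightarrow> (\<forall>V\<in>\<V>. irreducible_subrep A \<pi> V) \<and>
     (\<forall>V\<in>\<V>. \<forall>W\<in>\<V>. V \<noteq> W \<longrightarrow>
        (\<forall>x\<in>V. \<forall>y\<in>W. cinner x y = 0) \<and> \<not> equivalent_subreps A \<pi> V W) \<and>
     closure (span (\<Union>\<V>)) = UNIV"

lemma atomic_representation_iff:
  "atomic_representation A \<pi> \<longleftrightarrow> representation A \<pi> \<and> (\<exists>\<V>. atomic_decomposition A \<pi> \<V>)"
  unfolding atomic_representation_def atomic_decomposition_def ..

lemma total_set_ext:
  assumes "closure (span G) = UNIV" "\<And>g. g \<in> G \<Longrightarrow> cinner g z = 0"
  shows "z = 0"
proof -
  have "cinner z z \<in> {0}"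
    by (rule closure_span_linear_map[OF bounded_linear_cinner, where G = G])
      (use assms cinner_zero_commute[of z] in auto)
  then show ?thesis
    by (simp add: cinner_self_eq_0)
qed

text \<open>
  By \<open>intertwiner_zero\<close> the vector \<open>T v\<close> has no component in the other summands, so that
  \<open>T\<close>, and likewise its adjoint, preserves \<open>V\<close>, where Schur's lemma applies.
\<close>

lemma atomic_commutant_scalar:
  assumes A: "unital_cstar_algebra A" "representation A \<pi>" and \<V>: "atomic_decomposition A \<pi> \<V>"
    and T: "T \<in> commutant (\<pi> ` carrier A)" and V: "V \<in> \<V>"
  shows "\<exists>c. \<forall>v\<in>V. T \<cdot> v = c *\<^sub>C v"
proof -
  have irr: "irreducible_subrep A \<pi> W" if "W \<in> \<V>" for W
    using \<V> that unfolding atomic_decomposition_def by blast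
  have pairwise: "(\<forall>x\<in>W. \<forall>y\<in>W'. cinner x y = 0) \<and> \<not> equivalent_subreps A \<pi> W W'"
    if "W \<in> \<V>" "W' \<in> \<V>" "W \<noteq> W'" for W W'
    using \<V> that unfolding atomic_decomposition_def by simp
  then have orth: "cinner x y = 0" if "W \<in> \<V>" "W' \<in> \<V>" "W \<noteq> W'" "x \<in> W" "y \<in> W'" for W W' x y
    using that by simp
  have dense: "closure (span (\<Union>\<V>)) = UNIV"
    using \<V> unfolding atomic_decomposition_def by simp
  have proj: "\<exists>P. is_projection P \<and> range (blinfun_apply P) = W" if "W \<in> \<V>" for W
    by (rule orthogonal_projection_exists)
      (use irr[OF that] in \<open>simp add: irreducible_subrep_def invariant_subspace_def\<close>)
  obtain P where P: "is_projection P" and PV: "range (blinfun_apply P) = V"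
    using proj[OF V] by blast
  note pP = is_projectionD[OF P]
  have fixP: "P \<cdot> v = v \<longleftrightarrow> v \<in> V" for v
    using projection_range_iff[OF P, of v] PV by simp
  have pres: "P \<cdot> (R \<cdot> v) = R \<cdot> v"
    if R: "R \<in> commutant (\<pi> ` carrier A)" and v: "v \<in> V" for R v
  proof -
    let ?z = "R \<cdot> v - P \<cdot> (R \<cdot> v)"
    have "?z = 0"
    proof (rule total_set_ext[OF dense])
      fix w assume "w \<in> \<Union>\<V>"
      then obtain W where W: "W \<in> \<V>" "w \<in> W" by blast
      show "cinner w ?z = 0"
      proof (cases "W = V")
        case True
        then have "P \<cdot> w = w"
          using W fixP by blast
        then have "cinner w (P \<cdot> (R \<cdot> v)) = cinner w (R \<cdot> v)"
          using pP(5)[of w "R \<cdot> v"] by simp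
        then show ?thesis
          by (simp add: cinner_diff_right)
      next
        case False
        obtain Q where Q: "is_projection Q" and QW: "range (blinfun_apply Q) = W"
          using proj[OF W(1)] by blast
        have "Q o\<^sub>L (R o\<^sub>L P) = 0"
          by (rule intertwiner_zero[OF A _ P _ Q R])
            (use irr[OF V] irr[OF W(1)] PV QW pairwise[OF V W(1) False[symmetric]] in simp_all)
        then have "Q \<cdot> (R \<cdot> (P \<cdot> v)) = 0"
          by (metis blinfun_apply_blinfun_compose zero_blinfun.rep_eq)
        then have "Q \<cdot> (R \<cdot> v) = 0"
          unfolding fixP[THEN iffD2, OF v] .
        moreover have "Q \<cdot> w = w"
          using W(2) QW projection_range_iff[OF Q] by blast
        ultimately have "cinner w (R \<cdot> v) = 0"
          using is_projectionD(5)[OF Q, of w "R \<cdot> v"] by simp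
        moreover have "P \<cdot> (R \<cdot> v) \<in> V"
          using PV by blast
        then have "cinner w (P \<cdot> (R \<cdot> v)) = 0"
          by (rule orth[OF W(1) V False W(2)])
        ultimately show ?thesis
          by (simp add: cinner_diff_right)
      qed
    qed
    then show ?thesis
      by simp
  qed
  have "T o\<^sub>L P = P o\<^sub>L T"
    by (rule commute_with_projection[OF P commutantD(1)[OF T]])
      (use fixP pres[OF T] pres[OF commutant_hadj[OF T star_closed_ops_representation[OF A]]] in blast)+
  then show ?thesis
    using schur[OF A _ P T] irr[OF V] PV by simp
qed

definition rank_one :: "'h::chilbert_space \<Rightarrow> 'h op" where
  "rank_one v = Blinfun (\<lambda>x. cinner v x *\<^sub>C v)"

lemma rank_one: "clinear_op (rank_one v)" "rank_one v \<cdot> x = cinner v x *\<^sub>C v"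
proof -
  have "\<exists>T. clinear_op T \<and> (\<forall>x. T \<cdot> x = cinner v x *\<^sub>C v) \<and> norm T \<le> norm v * norm v"
  proof (rule clinear_op_of_fun)
    fix x
    have "cmod (cinner v x) * norm v \<le> (norm v * norm x) * norm v"
      by (intro mult_right_mono cinner_cauchy_schwarz norm_ge_zero)
    then show "norm (cinner v x *\<^sub>C v) \<le> norm v * norm v * norm x"
      by (simp add: norm_scaleC ac_simps)
  qed (simp_all add: cinner_add_right scaleC_add_left cinner_scaleC_right scaleC_scaleC)
  then obtain T where T: "clinear_op T" "\<And>x. T \<cdot> x = cinner v x *\<^sub>C v"
    by blast
  have "rank_one v = T"
    unfolding rank_one_def T(2)[symmetric] by (rule blinfun_apply_inverse)
  then show "clinear_op (rank_one v)" "rank_one v \<cdot> x = cinner v x *\<^sub>C v"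
    using T by auto
qed

lemma selfadjoint_rank_one: "selfadjoint (rank_one v)"
proof (rule selfadjointI[OF rank_one(1)])
  fix x y
  show "cinner (rank_one v \<cdot> x) y = cinner x (rank_one v \<cdot> y)"
    using cinner_commute[of x v] by (simp add: rank_one cinner_scaleC_left cinner_scaleC_right)
qed

lemma is_projection_rank_one:
  assumes "norm v = 1"
  shows "is_projection (rank_one v)"
proof -
  have "cinner v v = 1"
    using assms by (simp add: cinner_self)
  then have "rank_one v o\<^sub>L rank_one v = rank_one v"
    by (intro blinfun_eqI) (simp add: rank_one cinner_scaleC_right)
  then show ?thesis
    by (simp add: is_projection_iff selfadjoint_rank_one)
qed

lemma tensor_op_rank_one: "tensor_op (rank_one v) (rank_one w) = rank_one (tensor_vec v w)"
  by (rule tensor_op_unique)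
    (simp_all add: rank_one cinner_tensor_vec tensor_vec_scaleC_left tensor_vec_scaleC_right scaleC_scaleC mult.commute)

lemma rank_one_in_bicommutant:
  assumes A: "unital_cstar_algebra A" "representation A \<pi>" and \<V>: "atomic_decomposition A \<pi> \<V>" and v: "v \<in> \<Union>\<V>"
  shows "rank_one v \<in> bicommutant (\<pi> ` carrier A)"
  unfolding bicommutant_def
proof (rule commutantI[OF rank_one(1)])
  fix T x assume T: "T \<in> commutant (\<pi> ` carrier A)"
  obtain V where V: "V \<in> \<V>" "v \<in> V"
    using v by blast
  obtain c where c: "T \<cdot> v = c *\<^sub>C v"
    using atomic_commutant_scalar[OF A \<V> T V(1)] V(2) by blast
  obtain c' where c': "hadj T \<cdot> v = c' *\<^sub>C v"
    using atomic_commutant_scalar[OF A \<V> commutant_hadj[OF T star_closed_ops_representation[OF A]] V(1)] V(2) by blast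
  note cT = commutantD(1)[OF T]
  show "rank_one v \<cdot> (T \<cdot> x) = T \<cdot> (rank_one v \<cdot> x)"
  proof (cases "v = 0")
    case False
    have "cnj c' * cinner v v = cinner (hadj T \<cdot> v) v"
      by (simp add: c' cinner_scaleC_left)
    also have "\<dots> = c * cinner v v"
      by (simp add: cinner_hadj_left[OF cT] c cinner_scaleC_right)
    finally have "cnj c' = c"
      using False by (simp add: cinner_self_eq_0)
    moreover have "cinner v (T \<cdot> x) = cnj c' * cinner v x"
      using cinner_hadj_left[OF cT, of v x] by (simp add: c' cinner_scaleC_left)
    ultimately show ?thesis
      by (simp add: rank_one clinear_opD[OF cT] c scaleC_scaleC mult.commute)
  qed (simp add: rank_one)
qed

text \<open>
  Elements of the bicommutant preserve each summand, since the projection onto it lies in the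
  commutant. A nonzero projection \<open>p\<close> in the bicommutant therefore fixes a unit vector
  \<open>w\<close> in some summand, and the projection onto the line of \<open>w\<close>, which is in the
  bicommutant as well, lies below \<open>p\<close>.
\<close>

lemma minimal_projection_iff_rank_one:
  assumes A: "unital_cstar_algebra A" "representation A \<pi>" and \<V>: "atomic_decomposition A \<pi> \<V>"
  shows "minimal_projection (bicommutant (\<pi> ` carrier A)) p \<longleftrightarrow> (\<exists>v\<in>\<Union>\<V>. norm v = 1 \<and> p = rank_one v)"
proof
  let ?M = "bicommutant (\<pi> ` carrier A)"
  assume p: "minimal_projection ?M p"
  then have pM: "p \<in> ?M" and pp: "is_projection p" and p0: "p \<noteq> 0"
    and min: "\<And>q. q \<in> ?M \<Longrightarrow> is_projection q \<Longrightarrow> projection_le q p \<Longrightarrow> q = 0 \<or> q = p"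
    unfolding minimal_projection_def by blast+
  have dense: "closure (span (\<Union>\<V>)) = UNIV"
    using \<V> unfolding atomic_decomposition_def by simp
  have "\<exists>v\<in>\<Union>\<V>. p \<cdot> v \<noteq> 0"
  proof (rule ccontr)
    assume no: "\<not> (\<exists>v\<in>\<Union>\<V>. p \<cdot> v \<noteq> 0)"
    have "p \<cdot> x = 0" for x
    proof (rule total_set_ext[OF dense])
      fix g assume "g \<in> \<Union>\<V>"
      then have "p \<cdot> g = 0"
        using no by blast
      then show "cinner g (p \<cdot> x) = 0"
        using is_projectionD(5)[OF pp, of g x] by simp
    qed
    then show False
      using p0 blinfun_eqI[of p 0] by simp
  qed
  then obtain v V where v: "V \<in> \<V>" "v \<in> V" "p \<cdot> v \<noteq> 0"
    by blast
  have inv: "invariant_subspace A \<pi> V"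
    using \<V> v(1) by (simp add: atomic_decomposition_def irreducible_subrep_def)
  then have cV: "closed_csubspace V"
    by (simp add: invariant_subspace_def)
  obtain P where P: "is_projection P" and PV: "range (blinfun_apply P) = V"
    using orthogonal_projection_exists[OF cV] by blast
  have "P \<in> commutant (\<pi> ` carrier A)"
    by (rule projection_in_commutant[OF A P]) (simp add: PV inv)
  then have "p \<cdot> (P \<cdot> v) = P \<cdot> (p \<cdot> v)"
    by (rule commutantD(2)[OF pM[unfolded bicommutant_def]])
  moreover have "P \<cdot> v = v"
    using v(2) projection_range_iff[OF P, of v] PV by simp
  ultimately have pv: "p \<cdot> v \<in> V"
    using projection_range_iff[OF P, of "p \<cdot> v"] PV by simp
  define w where "w = inverse (norm (p \<cdot> v)) *\<^sub>R p \<cdot> v"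
  have w: "norm w = 1" "p \<cdot> w = w"
    using v(3) by (simp_all add: w_def blinfun.scaleR_right is_projectionD(4)[OF pp])
  have "w \<in> V"
    using subspace_scale[OF _ pv] cV unfolding w_def closed_csubspace_def by simp
  then have wV: "w \<in> \<Union>\<V>"
    using v(1) by blast
  have "projection_le (rank_one w) p"
    unfolding projection_le_def
    by (rule blinfun_eqI) (simp add: rank_one clinear_opD[OF is_projectionD(2)[OF pp]] w(2))
  then have "rank_one w = 0 \<or> rank_one w = p"
    by (rule min[OF rank_one_in_bicommutant[OF A \<V> wV] is_projection_rank_one[OF w(1)]])
  moreover have "rank_one w \<cdot> w = w"
    using w(1) by (simp add: rank_one cinner_self)
  then have "rank_one w \<noteq> 0"
    using w(1) by auto
  ultimately show "\<exists>v\<in>\<Union>\<V>. norm v = 1 \<and> p = rank_one v"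
    using wV w(1) by blast
next
  let ?M = "bicommutant (\<pi> ` carrier A)"
  assume "\<exists>v\<in>\<Union>\<V>. norm v = 1 \<and> p = rank_one v"
  then obtain v where v: "v \<in> \<Union>\<V>" "norm v = 1" "p = rank_one v"
    by blast
  have vv: "cinner v v = 1"
    using v(2) by (simp add: cinner_self)
  have "rank_one v \<noteq> 0"
  proof
    assume "rank_one v = 0"
    then have "rank_one v \<cdot> v = 0"
      by simp
    then show False
      using vv v(2) by (auto simp: rank_one)
  qed
  moreover have "q = 0 \<or> q = rank_one v"
    if q: "is_projection q" "projection_le q (rank_one v)" for q
  proof -
    note pq = is_projectionD[OF q(1)]
    have "rank_one v o\<^sub>L q = q"
      using q(2) by (simp add: projection_le_def)
    then have rq: "cinner v (q \<cdot> x) *\<^sub>C v = q \<cdot> x" for x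
      using rank_one(2) by (metis blinfun_apply_blinfun_compose)
    define c where "c = cinner v (q \<cdot> v)"
    have qv: "q \<cdot> v = c *\<^sub>C v"
      unfolding c_def by (rule rq[symmetric])
    have qx: "q \<cdot> x = (cinner v x * cnj c) *\<^sub>C v" for x
    proof -
      have "cinner v (q \<cdot> x) = cnj c * cinner v x"
        using pq(5)[of v x] by (simp add: qv cinner_scaleC_left)
      then show ?thesis
        using rq[of x] by (simp add: mult.commute)
    qed
    have "cnj c *\<^sub>C v = c *\<^sub>C v"
      using qx[of v] qv vv by simp
    from arg_cong[OF this, of "cinner v"] have cc: "cnj c = c"
      by (simp add: cinner_scaleC_right vv)
    have "c *\<^sub>C c *\<^sub>C v = c *\<^sub>C v"
      using pq(4)[of v] by (simp add: qv clinear_opD[OF pq(2)])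
    from arg_cong[OF this, of "cinner v"] have "c = 0 \<or> c = 1"
      by (simp add: cinner_scaleC_right vv)
    then show ?thesis
    proof
      assume "c = 0"
      then have "q = 0"
        by (intro blinfun_eqI) (simp add: qx)
      then show ?thesis ..
    next
      assume "c = 1"
      then have "q = rank_one v"
        by (intro blinfun_eqI) (simp add: qx rank_one)
      then show ?thesis ..
    qed
  qed
  ultimately show "minimal_projection ?M p"
    unfolding minimal_projection_def v(3)
    using rank_one_in_bicommutant[OF A \<V> v(1)] is_projection_rank_one[OF v(2)] by simp
qed

text \<open>
  The supremum defining the diagonal projection is the projection onto the closed span of the
  vectors \<open>v \<otimes> v\<close> with \<open>v\<close> in one of the irreducible subspaces. It belongs to the von
  Neumann algebra because everything that commutes with the rank one projections preserves
  that span.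
\<close>

lemma diagonal_projection:
  assumes A: "unital_cstar_algebra A" "representation A \<pi>" and \<V>: "atomic_decomposition A \<pi> \<V>"
  shows "is_projection (diagonal_projection A \<pi>)"
    and "v \<in> \<Union>\<V> \<Longrightarrow> (diagonal_projection A \<pi>) \<cdot> (tensor_vec v v) = tensor_vec v v"
    and "(\<And>v. v \<in> \<Union>\<V> \<Longrightarrow> cinner (tensor_vec v v) x = 0) \<Longrightarrow> (diagonal_projection A \<pi>) \<cdot> x = 0"
proof -
  define M where "M = bicommutant (\<pi> ` carrier A)"
  define Y where "Y = {tensor_op S T |S T. S \<in> M \<and> T \<in> M}"
  define Q where "Q = {tensor_op p p |p. minimal_projection M p}"
  define D where "D = {c *\<^sub>C tensor_vec v v |c v. v \<in> \<Union>\<V> \<and> norm v = 1}"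
  let ?V = "closure (span D)"
  have sub: "subspace ?V"
    by (rule subspace_closure[OF subspace_span])
  have DV: "d \<in> ?V" if "d \<in> D" for d
    using that closure_subset span_base by blast
  have Dt: "tensor_vec v v \<in> D" if "v \<in> \<Union>\<V>" "norm v = 1" for v
    unfolding D_def mem_Collect_eq using that by (intro exI[of _ 1] exI[of _ v]) simp
  have "c *\<^sub>C x \<in> ?V" if "x \<in> ?V" for c x
  proof (rule closure_span_linear_map[OF bounded_linear_scaleC sub closed_closure _ that])
    fix d assume "d \<in> D"
    then obtain k v where "d = k *\<^sub>C tensor_vec v v" "v \<in> \<Union>\<V>" "norm v = 1"
      unfolding D_def by blast
    then have "c *\<^sub>C d \<in> D"
      unfolding D_def mem_Collect_eq by (intro exI[of _ "c * k"] exI[of _ v]) (simp add: scaleC_scaleC)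
    then show "c *\<^sub>C d \<in> ?V"
      by (rule DV)
  qed
  then have "closed_csubspace ?V"
    unfolding closed_csubspace_def using sub by simp
  then obtain P where P: "is_projection P" and PV: "range (blinfun_apply P) = ?V"
    using orthogonal_projection_exists[of ?V] by blast
  note pP = is_projectionD[OF P]
  have fixP: "P \<cdot> x = x \<longleftrightarrow> x \<in> ?V" for x
    using projection_range_iff[OF P, of x] PV by simp
  have starM: "star_closed_ops M"
    unfolding M_def bicommutant_def
    by (intro star_closed_commutant star_closed_ops_representation[OF A])
  have starY: "star_closed_ops Y"
    unfolding star_closed_ops_def
  proof (intro ballI conjI)
    fix R assume "R \<in> Y"
    then obtain S T where ST: "S \<in> M" "T \<in> M" "R = tensor_op S T"
      unfolding Y_def by blast
    have c: "clinear_op S" "clinear_op T" "hadj S \<in> M" "hadj T \<in> M"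
      using starM ST(1,2) by (simp_all add: star_closed_ops_def)
    show "clinear_op R"
      unfolding ST(3) by (rule clinear_op_tensor_op[OF c(1,2)])
    show "hadj R \<in> Y"
      unfolding ST(3) hadj_tensor_op[OF c(1,2)] Y_def mem_Collect_eq
      by (intro exI[of _ "hadj S"] exI[of _ "hadj T"] conjI c(3,4) refl)
  qed
  have rY: "rank_one (tensor_vec v v) \<in> Y" if "v \<in> \<Union>\<V>" for v
    unfolding Y_def M_def tensor_op_rank_one[symmetric] mem_Collect_eq
    by (intro exI[of _ "rank_one v"] conjI rank_one_in_bicommutant[OF A \<V> that] refl)
  have Q: "q \<in> Q \<longleftrightarrow> (\<exists>v\<in>\<Union>\<V>. norm v = 1 \<and> q = rank_one (tensor_vec v v))" for q
    unfolding Q_def M_def minimal_projection_iff_rank_one[OF A \<V>] tensor_op_rank_one[symmetric] mem_Collect_eq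
    by blast
  have pres: "T \<cdot> x \<in> ?V" if T: "T \<in> commutant Y" and x: "x \<in> ?V" for T x
  proof (rule closure_span_linear_map[OF blinfun.bounded_linear_right sub closed_closure _ x])
    fix d assume "d \<in> D"
    then obtain k v where d: "d = k *\<^sub>C tensor_vec v v" "v \<in> \<Union>\<V>" "norm v = 1"
      unfolding D_def by blast
    let ?t = "tensor_vec v v"
    have "rank_one ?t \<cdot> ?t = ?t"
      using d(3) by (simp add: rank_one cinner_self norm_tensor_vec)
    then have "cinner ?t (T \<cdot> ?t) *\<^sub>C ?t = T \<cdot> ?t"
      using commutantD(2)[OF T rY[OF d(2)], of ?t] unfolding rank_one(2) by simp
    then have "T \<cdot> d = (k * cinner ?t (T \<cdot> ?t)) *\<^sub>C ?t"
      unfolding d(1) clinear_opD[OF commutantD(1)[OF T]] scaleC_scaleC[symmetric] by simp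
    then have "T \<cdot> d \<in> D"
      unfolding D_def mem_Collect_eq
      by (intro exI[of _ "k * cinner ?t (T \<cdot> ?t)"] exI[of _ v] conjI d(2,3))
    then show "T \<cdot> d \<in> ?V"
      by (rule DV)
  qed
  have PN: "P \<in> vn_tensor M M"
    unfolding vn_tensor_def bicommutant_def Y_def[symmetric] commutant_iff[of P]
  proof (intro conjI ballI pP(2))
    fix T assume T: "T \<in> commutant Y"
    have "T o\<^sub>L P = P o\<^sub>L T"
      by (rule commute_with_projection[OF P commutantD(1)[OF T]])
        (use fixP pres[OF T] pres[OF commutant_hadj[OF T starY]] in blast)+
    then show "P o\<^sub>L T = T o\<^sub>L P"
      by simp
  qed
  have upper: "projection_le q P" if "q \<in> Q" for q
  proof -
    obtain v where v: "v \<in> \<Union>\<V>" "norm v = 1" "q = rank_one (tensor_vec v v)"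
      using \<open>q \<in> Q\<close> Q by blast
    have "P \<cdot> (tensor_vec v v) = tensor_vec v v"
      unfolding fixP by (rule DV[OF Dt[OF v(1,2)]])
    then show ?thesis
      unfolding projection_le_def v(3)
      by (intro blinfun_eqI) (simp add: rank_one clinear_opD[OF pP(2)])
  qed
  have least: "projection_le P P'" if P': "is_projection P'" and up: "\<And>q. q \<in> Q \<Longrightarrow> projection_le q P'" for P'
  proof -
    have "P' \<cdot> x - x \<in> {0}" if "x \<in> ?V" for x
    proof (rule closure_span_linear_map[OF _ _ _ _ that])
      show "bounded_linear (\<lambda>x. P' \<cdot> x - x)"
        by (intro bounded_linear_sub blinfun.bounded_linear_right bounded_linear_ident)
      fix d assume "d \<in> D"
      then obtain k v where d: "d = k *\<^sub>C tensor_vec v v" "v \<in> \<Union>\<V>" "norm v = 1"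
        unfolding D_def by blast
      let ?t = "tensor_vec v v"
      have "rank_one ?t \<in> Q"
        unfolding Q using d(2,3) by blast
      then have "P' o\<^sub>L rank_one ?t = rank_one ?t"
        using up[of "rank_one ?t"] by (simp add: projection_le_def)
      then have "P' \<cdot> (rank_one ?t \<cdot> ?t) = rank_one ?t \<cdot> ?t"
        by (metis blinfun_apply_blinfun_compose)
      then have "P' \<cdot> ?t = ?t"
        using d(3) by (simp add: rank_one cinner_self norm_tensor_vec)
      then show "P' \<cdot> d - d \<in> {0}"
        by (simp add: d(1) clinear_opD[OF is_projectionD(2)[OF P']])
    qed simp_all
    then have "P' \<cdot> (P \<cdot> x) = P \<cdot> x" for x
      using PV by (metis eq_iff_diff_eq_0 rangeI singletonD)
    then show ?thesis
      unfolding projection_le_def by (intro blinfun_eqI) simp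
  qed
  have "projection_Sup (vn_tensor M M) Q = P"
    unfolding projection_Sup_def
  proof (rule the_equality)
    show "(P \<in> vn_tensor M M \<and> is_projection P \<and> (\<forall>q\<in>Q. projection_le q P)) \<and>
      (\<forall>P'. P' \<in> vn_tensor M M \<and> is_projection P' \<and> (\<forall>q\<in>Q. projection_le q P') \<longrightarrow> projection_le P P')"
      using PN P upper least by simp
    fix R assume R: "(R \<in> vn_tensor M M \<and> is_projection R \<and> (\<forall>q\<in>Q. projection_le q R)) \<and>
      (\<forall>P'. P' \<in> vn_tensor M M \<and> is_projection P' \<and> (\<forall>q\<in>Q. projection_le q P') \<longrightarrow> projection_le R P')"
    have 1: "P o\<^sub>L R = R"
      using R PN P upper by (simp add: projection_le_def)
    have 2: "R o\<^sub>L P = P"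
      using R least by (simp add: projection_le_def)
    have "hadj (R o\<^sub>L P) = hadj P"
      using 2 by simp
    then have "P o\<^sub>L R = P"
      using R by (simp add: hadj_compose pP(2,3) is_projectionD(2,3))
    then show "R = P"
      using 1 by simp
  qed
  then have eq: "diagonal_projection A \<pi> = P"
    unfolding diagonal_projection_def Let_def M_def Q_def .
  show "is_projection (diagonal_projection A \<pi>)"
    unfolding eq by (rule P)
  show "diagonal_projection A \<pi> \<cdot> (tensor_vec v v) = tensor_vec v v" if v: "v \<in> \<Union>\<V>"
  proof (cases "v = 0")
    case False
    obtain V where V: "V \<in> \<V>" "v \<in> V"
      using v by blast
    let ?u = "inverse (norm v) *\<^sub>R v"
    have "irreducible_subrep A \<pi> V"
      using \<V> V(1) unfolding atomic_decomposition_def by simp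
    then have "subspace V"
      by (simp add: irreducible_subrep_def invariant_subspace_def closed_csubspace_def)
    then have "?u \<in> V"
      by (rule subspace_scale) (rule V(2))
    then have "?u \<in> \<Union>\<V>"
      using V(1) by blast
    moreover have "norm ?u = 1"
      using False by simp
    ultimately have u: "P \<cdot> (tensor_vec ?u ?u) = tensor_vec ?u ?u"
      unfolding fixP by (intro DV Dt)
    define r where "r = complex_of_real (norm v)"
    define u where "u = ?u"
    have v': "v = r *\<^sub>C u"
      using False unfolding r_def u_def by (simp add: scaleC_of_real)
    have "tensor_vec v v = (r * r) *\<^sub>C tensor_vec ?u ?u"
      unfolding u_def[symmetric] by (subst (1 2) v') (simp only: scaleC_scaleC tensor_vec_scaleC_left tensor_vec_scaleC_right)
    then show ?thesis
      unfolding eq by (simp only: clinear_opD[OF pP(2)] u)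
  qed simp
  show "diagonal_projection A \<pi> \<cdot> x = 0"
    if x: "\<And>v. v \<in> \<Union>\<V> \<Longrightarrow> cinner (tensor_vec v v) x = 0"
  proof -
    have "P \<cdot> x \<in> ?V"
      using PV by blast
    then have "cinner x (P \<cdot> x) \<in> {0}"
    proof (rule closure_span_linear_map[OF bounded_linear_cinner, rotated -1])
      fix d assume "d \<in> D"
      then obtain k v where d: "d = k *\<^sub>C tensor_vec v v" "v \<in> \<Union>\<V>"
        unfolding D_def by blast
      have "cinner x (tensor_vec v v) = 0"
        using x[OF d(2)] cinner_zero_commute[of x] by simp
      then show "cinner x d \<in> {0}"
        by (simp add: d(1) cinner_scaleC_right)
    qed simp_all
    moreover have "cinner (P \<cdot> x) (P \<cdot> x) = cinner x (P \<cdot> x)"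
      by (simp add: pP(4,5))
    ultimately show ?thesis
      unfolding eq by (simp add: cinner_self_eq_0)
  qed
qed

lemma diagonal_complement_iff:
  assumes A: "unital_cstar_algebra A" "representation A \<pi>" and \<V>: "atomic_decomposition A \<pi> \<V>"
  shows "x \<in> diagonal_complement A \<pi> \<longleftrightarrow> (\<forall>v\<in>\<Union>\<V>. cinner (tensor_vec v v) x = 0)"
proof
  let ?P = "diagonal_projection A \<pi>"
  note P = diagonal_projection[OF A \<V>]
  { assume x: "x \<in> diagonal_complement A \<pi>"
    show "\<forall>v\<in>\<Union>\<V>. cinner (tensor_vec v v) x = 0"
    proof
      fix v assume "v \<in> \<Union>\<V>"
      then have "tensor_vec v v \<in> range (blinfun_apply ?P)"
        using P(2)[of v] rangeI[of "blinfun_apply ?P" "tensor_vec v v"] by simp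
      then show "cinner (tensor_vec v v) x = 0"
        using x unfolding diagonal_complement_def by blast
    qed }
  assume "\<forall>v\<in>\<Union>\<V>. cinner (tensor_vec v v) x = 0"
  then have "?P \<cdot> x = 0"
    by (intro P(3)) blast
  then have "cinner (?P \<cdot> z) x = 0" for z
    using is_projectionD(5)[OF P(1), of z x] by simp
  then show "x \<in> diagonal_complement A \<pi>"
    unfolding diagonal_complement_def by blast
qed

section \<open>The irreducible subspaces of a compact quantum metric space are lines\<close>

text \<open>
  The order relations of the two C*-algebras are replaced by statements about quadratic forms.
\<close>

lemma compact_quantum_metric_spaceD:
  assumes "compact_quantum_metric_space A \<rho> \<pi>"
  shows "unital_cstar_algebra A" "representation A \<pi>" "\<exists>\<V>. atomic_decomposition A \<pi> \<V>" "inj_on \<pi> (carrier A)"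
    "\<rho> \<in> carrier (tensor_square A \<pi>)" "positive_op \<rho>"
    "\<rho> o\<^sub>L diagonal_projection A \<pi> = 0"
    "x \<in> diagonal_complement A \<pi> \<Longrightarrow> \<rho> \<cdot> x = 0 \<Longrightarrow> x = 0"
    "tensor_flip A \<pi> \<rho> = \<rho>"
    "positive_op (right_unit A \<pi> \<rho> + left_unit A \<pi> \<rho> - middle_unit A \<pi> \<rho>)"
proof -
  show A: "unital_cstar_algebra A" "representation A \<pi>" "\<exists>\<V>. atomic_decomposition A \<pi> \<V>" "inj_on \<pi> (carrier A)"
    using assms by (simp_all add: compact_quantum_metric_space_def atomic_representation_iff)
  have "positive_in (operator_algebra (carrier (tensor_square A \<pi>))) \<rho>"
    using assms unfolding tensor_square_operator_algebra[symmetric] by (simp add: compact_quantum_metric_space_def)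
  then show "\<rho> \<in> carrier (tensor_square A \<pi>)" "positive_op \<rho>"
    unfolding positive_in_operator_algebra_iff[OF star_subalgebra_tensor_square[OF A(1,2)]] by simp_all
  show "\<rho> o\<^sub>L diagonal_projection A \<pi> = 0" "tensor_flip A \<pi> \<rho> = \<rho>"
    "x \<in> diagonal_complement A \<pi> \<Longrightarrow> \<rho> \<cdot> x = 0 \<Longrightarrow> x = 0"
    using assms unfolding compact_quantum_metric_space_def by simp_all blast
  have "add (tensor_cube A \<pi>) = (+)"
    by (simp add: tensor_cube_def spatial_tensor_eq)
  then have "le_in (operator_algebra (carrier (tensor_cube A \<pi>))) (middle_unit A \<pi> \<rho>)
      (right_unit A \<pi> \<rho> + left_unit A \<pi> \<rho>)"
    using assms unfolding tensor_cube_operator_algebra[symmetric] by (simp add: compact_quantum_metric_space_def)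
  then show "positive_op (right_unit A \<pi> \<rho> + left_unit A \<pi> \<rho> - middle_unit A \<pi> \<rho>)"
    unfolding le_in_operator_algebra_iff[OF star_subalgebra_tensor_cube[OF A(1,2)]] by simp
qed

lemma inner_conjugate:
  assumes "unitary_op W"
  shows "inner x ((W o\<^sub>L (T o\<^sub>L hadj W)) \<cdot> x)
    = inner (hadj W \<cdot> x) (T \<cdot> (hadj W \<cdot> x))"
  by (simp add: inner_eq_Re_cinner cinner_hadj_left[OF unitary_opD(1)[OF assms]])

text \<open>
  The real inner product is multiplicative on elementary tensors only where one of the two
  complex factors is real.
\<close>

lemma inner_tensor_vec:
  assumes "cinner z w = complex_of_real r"
  shows "inner (tensor_vec x z) (tensor_vec y w) = r * inner x y"
  by (simp add: inner_eq_Re_cinner cinner_tensor_vec assms)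

text \<open>
  On an irreducible subspace \<open>V\<close> the operator \<open>\<rho>\<close> kills the symmetric tensors and is
  strictly positive on the antisymmetric ones. If \<open>V\<close> contained orthonormal vectors
  \<open>e\<close> and \<open>f\<close>, put \<open>b = \<rho> (e \<otimes> f)\<close> and \<open>\<beta> = \<langle>e \<otimes> f, b\<rangle>\<close>, so that
  \<open>\<rho> (f \<otimes> e) = - b\<close>. At \<open>x = e \<otimes> e \<otimes> f - f \<otimes> e \<otimes> e\<close>, which is
  antisymmetric in its outer factors, the form of \<open>\<MM>(\<rho>)\<close> takes the value
  \<open>4 \<beta>\<close> and those of \<open>\<rho> \<otimes> 1\<close> and \<open>1 \<otimes> \<rho>\<close> take the value
  \<open>\<beta>\<close>, which contradicts the triangle inequality.
\<close>

lemma no_orthonormal_pair: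
  assumes cqms: "compact_quantum_metric_space A \<rho> \<pi>" and \<V>: "atomic_decomposition A \<pi> \<V>"
    and V: "V \<in> \<V>" and ef: "e \<in> V" "f \<in> V"
    and on: "cinner e e = 1" "cinner f f = 1" "cinner e f = 0"
  shows False
proof -
  note A = compact_quantum_metric_spaceD(1,2)[OF cqms]
  note D = compact_quantum_metric_spaceD[OF cqms]
  have on': "cinner f e = 0"
    using on(3) cinner_zero_commute[of f e] by simp
  have "irreducible_subrep A \<pi> V"
    using \<V> V unfolding atomic_decomposition_def by simp
  then have sub: "subspace V"
    by (simp add: irreducible_subrep_def invariant_subspace_def closed_csubspace_def)
  have sa: "selfadjoint \<rho>" and pos: "\<And>x. 0 \<le> inner x (\<rho> \<cdot> x)"
    using D(6) by (simp_all add: positive_op_def)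
  have kill: "\<rho> \<cdot> (tensor_vec v v) = 0" if "v \<in> V" for v
  proof -
    have "v \<in> \<Union>\<V>"
      using V that by blast
    then have "diagonal_projection A \<pi> \<cdot> (tensor_vec v v) = tensor_vec v v"
      by (rule diagonal_projection(2)[OF A \<V>])
    then show ?thesis
      using arg_cong[OF D(7), of "\<lambda>T. T \<cdot> (tensor_vec v v)"] by simp
  qed
  define b where "b = \<rho> \<cdot> (tensor_vec e f)"
  have "\<rho> \<cdot> (tensor_vec (e + f) (e + f)) = 0"
    by (rule kill[OF subspace_add[OF sub ef]])
  then have fe: "\<rho> \<cdot> (tensor_vec f e) = - b"
    using kill[OF ef(1)] kill[OF ef(2)]
    by (simp add: tensor_vec_add_left tensor_vec_add_right blinfun.add_right b_def eq_neg_iff_add_eq_0 add.commute)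
  define \<beta> where "\<beta> = inner (tensor_vec e f) b"
  have fe_b: "inner (tensor_vec f e) b = - \<beta>"
    using inner_selfadjoint[OF sa, of "tensor_vec f e" "tensor_vec e f"] fe
    by (simp add: b_def \<beta>_def inner_commute)
  define a where "a = tensor_vec e f - tensor_vec f e"
  have \<rho>a: "\<rho> \<cdot> a = b + b"
    by (simp add: a_def blinfun.diff_right fe b_def)
  have a_form: "inner a (\<rho> \<cdot> a) = 4 * \<beta>"
    unfolding \<rho>a by (simp add: a_def inner_diff_left inner_add_right fe_b \<beta>_def[symmetric])
  have "\<beta> > 0"
  proof (rule ccontr)
    assume "\<not> \<beta> > 0"
    then have "inner a (\<rho> \<cdot> a) = 0"
      using a_form pos[of a] by simp
    then have "(norm (\<rho> \<cdot> a))\<^sup>2 \<le> 0"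
      using positive_op_norm_sq_le[OF D(6), of a] by simp
    then have "\<rho> \<cdot> a = 0"
      by simp
    moreover have "a \<in> diagonal_complement A \<pi>"
      unfolding diagonal_complement_iff[OF A \<V>]
      by (simp add: a_def cinner_diff_right cinner_tensor_vec mult.commute)
    ultimately have "a = 0"
      using D(8) by blast
    moreover have "cinner (tensor_vec e f) a = 1"
      by (simp add: a_def cinner_diff_right cinner_tensor_vec on on')
    ultimately show False
      by simp
  qed
  obtain U :: "(('b, 'b) htensor, 'b) htensor op" where
    U: "unitary_op U" "\<And>x y z. U \<cdot> (tensor_vec (tensor_vec x y) z) = tensor_vec (tensor_vec x z) y"
    using tensor_swap_last_exists by blast
  obtain W :: "(('b, 'b) htensor, 'b) htensor op" where
    W: "unitary_op W" "\<And>x y z. W \<cdot> (tensor_vec (tensor_vec x y) z) = tensor_vec (tensor_vec z x) y"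
    using tensor_rotate_exists by blast
  let ?R = "tensor_op \<rho> (id_blinfun :: 'b op)"
  note R = tensor_op_apply[OF selfadjointD(1)[OF sa] clinear_op_id[where 'a = 'b]]
  define x where "x = tensor_vec (tensor_vec e e) f - tensor_vec (tensor_vec f e) e"
  have ee: "cinner e e = complex_of_real 1" "cinner e f = complex_of_real 0" "cinner f e = complex_of_real 0"
    using on on' by simp_all
  have Ux: "hadj U \<cdot> x = tensor_vec a e"
    by (simp add: x_def blinfun.diff_right hadj_unitary_eq[OF U] a_def tensor_vec_diff_left)
  have Wx: "hadj W \<cdot> x = tensor_vec (tensor_vec e f) e - tensor_vec (tensor_vec e e) f"
    by (simp add: x_def blinfun.diff_right hadj_unitary_eq[OF W])
  have neg: "tensor_vec (- b) e = - tensor_vec b e"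
    using tensor_vec_diff_left[of 0 b e] by simp
  have "inner x (right_unit A \<pi> \<rho> \<cdot> x) = \<beta>"
    unfolding right_unit_apply[OF A D(5)]
    by (simp add: x_def blinfun.diff_right R kill[OF ef(1)] fe neg inner_diff_left
        inner_tensor_vec[OF ee(1)] inner_tensor_vec[OF ee(3)] fe_b)
  moreover have "inner x (left_unit A \<pi> \<rho> \<cdot> x) = \<beta>"
    unfolding left_unit_apply[OF A W D(5)] inner_conjugate[OF W(1)] Wx
    by (simp add: blinfun.diff_right R kill[OF ef(1)] inner_diff_left b_def[symmetric]
        inner_tensor_vec[OF ee(1)] inner_tensor_vec[OF ee(3)] \<beta>_def)
  moreover have "inner x (middle_unit A \<pi> \<rho> \<cdot> x) = 4 * \<beta>"
    unfolding middle_unit_apply[OF A U D(5)] inner_conjugate[OF U(1)] Ux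
    by (simp add: R inner_tensor_vec[OF ee(1)] a_form)
  moreover have "0 \<le> inner x ((right_unit A \<pi> \<rho> + left_unit A \<pi> \<rho> - middle_unit A \<pi> \<rho>) \<cdot> x)"
    using D(10) unfolding positive_op_def by simp
  ultimately show False
    using \<open>\<beta> > 0\<close> by (simp add: blinfun.add_left blinfun.diff_left inner_add_right inner_diff_right)
qed

lemma irreducible_subspace_line:
  assumes cqms: "compact_quantum_metric_space A \<rho> \<pi>" and \<V>: "atomic_decomposition A \<pi> \<V>" and V: "V \<in> \<V>"
  shows "\<exists>e. cinner e e = 1 \<and> V = range (\<lambda>c. c *\<^sub>C e)"
proof -
  have irr: "irreducible_subrep A \<pi> V"
    using \<V> V unfolding atomic_decomposition_def by simp
  then have sub: "subspace V" and sc: "\<And>c x. x \<in> V \<Longrightarrow> c *\<^sub>C x \<in> V" and ne: "V \<noteq> {0}"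
    by (simp_all add: irreducible_subrep_def invariant_subspace_def closed_csubspace_def)
  have unit: "\<exists>c. cinner (c *\<^sub>C x) (c *\<^sub>C x) = 1" if "x \<noteq> 0" for x :: 'b
    using that by (intro exI[of _ "complex_of_real (inverse (norm x))"]) (simp add: cinner_self norm_scaleC norm_inverse)
  obtain x where x: "x \<in> V" "x \<noteq> 0"
    using ne subspace_0[OF sub] by blast
  obtain c where c: "cinner (c *\<^sub>C x) (c *\<^sub>C x) = 1"
    using unit[OF x(2)] by blast
  define e where "e = c *\<^sub>C x"
  have e: "e \<in> V" "cinner e e = 1"
    using sc[OF x(1)] c by (simp_all add: e_def)
  have "v = cinner e v *\<^sub>C e" if v: "v \<in> V" for v
  proof (rule ccontr)
    let ?w = "v - cinner e v *\<^sub>C e"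
    assume "v \<noteq> cinner e v *\<^sub>C e"
    then have "?w \<noteq> 0"
      by simp
    then obtain k where k: "cinner (k *\<^sub>C ?w) (k *\<^sub>C ?w) = 1"
      using unit by blast
    have "k *\<^sub>C ?w \<in> V"
      by (intro sc subspace_diff[OF sub] v e(1))
    moreover have "cinner e (k *\<^sub>C ?w) = 0"
      by (simp add: cinner_scaleC_right cinner_diff_right e(2))
    ultimately show False
      by (intro no_orthonormal_pair[OF cqms \<V> V e(1) _ e(2) k])
  qed
  then have "V = range (\<lambda>c. c *\<^sub>C e)"
    using sc[OF e(1)] by blast
  then show ?thesis
    using e(2) by blast
qed

section \<open>Compact quantum metric spaces are diagonal\<close>

text \<open>
  An orthonormal basis of joint eigenvectors with pairwise different characters; the basis plays
  the role of the set of points.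
\<close>

definition joint_eigenbasis :: "'a cstar \<Rightarrow> ('a \<Rightarrow> 'h::chilbert_space op) \<Rightarrow> 'h set \<Rightarrow> bool" where
  "joint_eigenbasis A \<pi> E \<longleftrightarrow> is_onb E \<and>
     (\<forall>e\<in>E. \<forall>a\<in>carrier A. \<pi> a \<cdot> e = cinner e (\<pi> a \<cdot> e) *\<^sub>C e) \<and>
     (\<forall>e\<in>E. \<forall>f\<in>E. e \<noteq> f \<longrightarrow>
        (\<exists>a\<in>carrier A. cinner e (\<pi> a \<cdot> e) \<noteq> cinner f (\<pi> a \<cdot> f)))"

definition diagonal_metric ::
  "'h::chilbert_space set \<Rightarrow> ('h \<Rightarrow> 'h \<Rightarrow> real) \<Rightarrow> ('h, 'h) htensor op \<Rightarrow> bool" where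
  "diagonal_metric E d \<rho> \<longleftrightarrow>
     (\<forall>e\<in>E. \<forall>f\<in>E. \<rho> \<cdot> (tensor_vec e f) = complex_of_real (d e f) *\<^sub>C tensor_vec e f \<and>
        0 \<le> d e f \<and> (d e f = 0 \<longleftrightarrow> e = f) \<and> d e f = d f e \<and> (\<forall>g\<in>E. d e g \<le> d e f + d f g))"

lemma eigenvector_closure_span:
  fixes x :: "'h::chilbert_space"
  assumes G: "\<And>g. g \<in> G \<Longrightarrow> g \<cdot> x = cinner x (g \<cdot> x) *\<^sub>C x" and T: "T \<in> closure (span G)"
  shows "T \<cdot> x = cinner x (T \<cdot> x) *\<^sub>C x"
proof -
  have sc: "bounded_linear (\<lambda>c. c *\<^sub>C x)"
    by (rule bounded_linear_intro[where K = "norm x"])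
      (simp_all add: scaleC_add_left norm_scaleC scaleR_scaleC scaleC_scaleC scaleR_conv_of_real)
  have "T \<cdot> x - cinner x (T \<cdot> x) *\<^sub>C x \<in> {0}"
  proof (rule closure_span_linear_map[OF _ _ _ _ T])
    show "bounded_linear (\<lambda>T. T \<cdot> x - cinner x (T \<cdot> x) *\<^sub>C x)"
      by (intro bounded_linear_sub blinfun.bounded_linear_left bounded_linear_compose[OF sc]
          bounded_linear_compose[OF bounded_linear_cinner blinfun.bounded_linear_left])
    show "g \<cdot> x - cinner x (g \<cdot> x) *\<^sub>C x \<in> {0}" if "g \<in> G" for g
      using G[OF that] by simp
  qed simp_all
  then show ?thesis
    by simp
qed

text \<open>
  A unit vector is chosen in each irreducible line. Two of these vectors with the same character
  would span equivalent subrepresentations. The tensor square consists of operators that are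
  diagonal in the product basis, and the properties of \<open>d\<close> are read off by evaluating the
  axioms at basis vectors.
\<close>

lemma compact_quantum_metric_space_imp_diagonal:
  assumes cqms: "compact_quantum_metric_space A \<rho> \<pi>"
  shows "\<exists>E d. joint_eigenbasis A \<pi> E \<and> diagonal_metric E d \<rho>"
proof -
  note A = compact_quantum_metric_spaceD(1,2)[OF cqms]
  note D = compact_quantum_metric_spaceD[OF cqms]
  obtain \<V> where \<V>: "atomic_decomposition A \<pi> \<V>"
    using D(3) by blast
  have irr: "irreducible_subrep A \<pi> V" if "V \<in> \<V>" for V
    using \<V> that unfolding atomic_decomposition_def by simp
  have pairwise: "(\<forall>x\<in>V. \<forall>y\<in>W. cinner x y = 0) \<and> \<not> equivalent_subreps A \<pi> V W"
    if "V \<in> \<V>" "W \<in> \<V>" "V \<noteq> W" for V W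
    using \<V> that unfolding atomic_decomposition_def by simp
  have dense: "closure (span (\<Union>\<V>)) = UNIV"
    using \<V> unfolding atomic_decomposition_def by simp
  have "\<forall>V\<in>\<V>. \<exists>e. cinner e e = 1 \<and> V = range (\<lambda>c. c *\<^sub>C e)"
    using irreducible_subspace_line[OF cqms \<V>] by blast
  then obtain u where u: "\<And>V. V \<in> \<V> \<Longrightarrow> cinner (u V) (u V) = 1" "\<And>V. V \<in> \<V> \<Longrightarrow> V = range (\<lambda>c. c *\<^sub>C u V)"
    by metis
  have uV: "u V \<in> V" if "V \<in> \<V>" for V
    using u(2)[OF that] rangeI[of "\<lambda>c. c *\<^sub>C u V" 1] by simp
  have orth: "cinner (u V) (u W) = 0" if "V \<in> \<V>" "W \<in> \<V>" "V \<noteq> W" for V W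
    using pairwise[OF that] uV[OF that(1)] uV[OF that(2)] by simp
  have un0: "u V \<noteq> 0" if "V \<in> \<V>" for V
    using u(1)[OF that] by auto
  have u_eq: "u V = u W \<longleftrightarrow> V = W" if "V \<in> \<V>" "W \<in> \<V>" for V W
    using u(2)[OF that(1)] u(2)[OF that(2)] by metis
  define E where "E = u ` \<V>"
  have onb: "is_onb E"
    unfolding is_onb_def orthonormal_def
  proof (intro conjI ballI allI impI)
    fix e f assume "e \<in> E" "f \<in> E"
    then obtain V W where VW: "V \<in> \<V>" "W \<in> \<V>" "e = u V" "f = u W"
      unfolding E_def by blast
    show "cinner e f = (if e = f then 1 else 0)"
      unfolding VW(3,4) u_eq[OF VW(1,2)] using u(1)[OF VW(2)] orth[OF VW(1,2)] by simp
  next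
    fix x assume x: "\<forall>e\<in>E. cinner e x = 0"
    show "x = 0"
    proof (rule total_set_ext[OF dense])
      fix g assume "g \<in> \<Union>\<V>"
      then obtain V where V: "V \<in> \<V>" "g \<in> V" by blast
      obtain c where "g = c *\<^sub>C u V"
        using V u(2)[OF V(1)] by blast
      moreover have "cinner (u V) x = 0"
        using x V(1) unfolding E_def by simp
      ultimately show "cinner g x = 0"
        by (simp add: cinner_scaleC_left)
    qed
  qed
  have eig: "\<pi> a \<cdot> e = cinner e (\<pi> a \<cdot> e) *\<^sub>C e" if e: "e \<in> E" and a: "a \<in> carrier A" for e a
  proof -
    obtain V where V: "V \<in> \<V>" "e = u V"
      using e unfolding E_def by blast
    have "\<pi> a \<cdot> (u V) \<in> V"
      using irr[OF V(1)] a uV[OF V(1)] by (simp add: irreducible_subrep_def invariant_subspace_def)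
    then obtain c where c: "\<pi> a \<cdot> (u V) = c *\<^sub>C u V"
      using u(2)[OF V(1)] by blast
    show ?thesis
      unfolding V(2) c by (simp add: cinner_scaleC_right u(1)[OF V(1)])
  qed
  have chars: "\<exists>a\<in>carrier A. cinner e (\<pi> a \<cdot> e) \<noteq> cinner f (\<pi> a \<cdot> f)"
    if ef: "e \<in> E" "f \<in> E" "e \<noteq> f" for e f
  proof (rule ccontr)
    assume no: "\<not> ?thesis"
    obtain V W where VW: "V \<in> \<V>" "W \<in> \<V>" "e = u V" "f = u W"
      using ef(1,2) unfolding E_def by blast
    have "V \<noteq> W"
      using ef(3) VW(3,4) by blast
    let ?U = "\<lambda>x. cinner e x *\<^sub>C f"
    have ee: "cinner e e = 1" and ff: "cinner f f = 1"
      unfolding VW(3,4) by (rule u(1)[OF VW(1)], rule u(1)[OF VW(2)])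
    have V: "\<exists>c. x = c *\<^sub>C e" if "x \<in> V" for x
      using u(2)[OF VW(1)] that unfolding VW(3) by blast
    have W: "c *\<^sub>C f \<in> W" for c
      using u(2)[OF VW(2)] unfolding VW(4) by blast
    have W': "\<exists>c. x = c *\<^sub>C f" if "x \<in> W" for x
      using u(2)[OF VW(2)] that unfolding VW(4) by blast
    have eV: "c *\<^sub>C e \<in> V" for c
      using u(2)[OF VW(1)] unfolding VW(3) by blast
    have "?U ` V = W"
    proof (intro equalityI subsetI)
      fix y assume "y \<in> ?U ` V"
      then show "y \<in> W"
        using W by blast
    next
      fix y assume "y \<in> W"
      then obtain c where "y = c *\<^sub>C f"
        using W' by blast
      then have "y = ?U (c *\<^sub>C e)"
        by (simp add: cinner_scaleC_right ee)
      then show "y \<in> ?U ` V"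
        using eV by blast
    qed
    moreover have "norm (?U x) = norm x" if x: "x \<in> V" for x
    proof -
      obtain c where "x = c *\<^sub>C e"
        using V[OF x] by blast
      moreover have "norm e = 1" "norm f = 1"
        using ee ff by (simp_all add: norm_eq_sqrt_inner inner_eq_Re_cinner)
      ultimately show ?thesis
        by (simp add: norm_scaleC cinner_scaleC_right ee)
    qed
    moreover have "?U (\<pi> a \<cdot> x) = \<pi> a \<cdot> (?U x)" if a: "a \<in> carrier A" and x: "x \<in> V" for a x
    proof -
      obtain c where c: "x = c *\<^sub>C e"
        using V[OF x] by blast
      note cl = clinear_opD[OF representationD(1)[OF A a]]
      define k where "k = cinner e (\<pi> a \<cdot> e)"
      have "\<pi> a \<cdot> f = k *\<^sub>C f"
        using eig[OF ef(2) a] no a unfolding k_def by metis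
      moreover have 1: "cinner e (\<pi> a \<cdot> x) = c * k"
        by (simp add: c cl k_def cinner_scaleC_right)
      ultimately show ?thesis
        unfolding 1 by (simp add: c cl cinner_scaleC_right ee scaleC_scaleC)
    qed
    ultimately have "equivalent_subreps A \<pi> V W"
      unfolding equivalent_subreps_def
      by (intro exI[of _ ?U]) (simp add: cinner_add_right scaleC_add_left cinner_scaleC_right scaleC_scaleC)
    then show False
      using pairwise[OF VW(1,2) \<open>V \<noteq> W\<close>] by blast
  qed
  have basis: "joint_eigenbasis A \<pi> E"
    unfolding joint_eigenbasis_def using onb eig chars by simp
  have sa: "selfadjoint \<rho>" and pos: "\<And>x. 0 \<le> inner x (\<rho> \<cdot> x)"
    using D(6) by (simp_all add: positive_op_def)
  have EE: "cinner e f = (if e = f then 1 else 0)" if "e \<in> E" "f \<in> E" for e f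
    using onb that unfolding is_onb_def orthonormal_def by simp
  define d where "d e f = inner (tensor_vec e f) (\<rho> \<cdot> (tensor_vec e f))" for e f
  have diag: "\<rho> \<cdot> (tensor_vec e f) = complex_of_real (d e f) *\<^sub>C tensor_vec e f" if ef: "e \<in> E" "f \<in> E" for e f
  proof -
    have "\<rho> \<cdot> (tensor_vec e f) = cinner (tensor_vec e f) (\<rho> \<cdot> (tensor_vec e f)) *\<^sub>C tensor_vec e f"
    proof (rule eigenvector_closure_span)
      show "\<rho> \<in> closure (span (elementary_tensors A \<pi> A \<pi>))"
        using D(5) by (simp add: tensor_square_def carrier_spatial_tensor)
      fix g assume "g \<in> elementary_tensors A \<pi> A \<pi>"
      then obtain a b where ab: "a \<in> carrier A" "b \<in> carrier A" "g = tensor_op (\<pi> a) (\<pi> b)"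
        unfolding elementary_tensors_def by blast
      obtain k l where kl: "\<pi> a \<cdot> e = k *\<^sub>C e" "\<pi> b \<cdot> f = l *\<^sub>C f"
        using eig[OF ef(1) ab(1)] eig[OF ef(2) ab(2)] by blast
      have "g \<cdot> (tensor_vec e f) = (k * l) *\<^sub>C tensor_vec e f"
        by (simp add: ab(3) tensor_op_apply representationD(1)[OF A ab(1)] representationD(1)[OF A ab(2)] kl
            tensor_vec_scaleC_left tensor_vec_scaleC_right scaleC_scaleC mult.commute)
      then show "g \<cdot> (tensor_vec e f) = cinner (tensor_vec e f) (g \<cdot> (tensor_vec e f)) *\<^sub>C tensor_vec e f"
        by (simp add: cinner_scaleC_right cinner_tensor_vec EE ef)
    qed
    then show ?thesis
      by (simp add: cinner_selfadjoint_self[OF sa] d_def)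
  qed
  have d0: "d e e = 0" if e: "e \<in> E" for e
  proof -
    have "e \<in> \<Union>\<V>"
      using e uV unfolding E_def by blast
    then have "diagonal_projection A \<pi> \<cdot> (tensor_vec e e) = tensor_vec e e"
      by (rule diagonal_projection(2)[OF A \<V>])
    then have "\<rho> \<cdot> (tensor_vec e e) = 0"
      using arg_cong[OF D(7), of "\<lambda>T. T \<cdot> (tensor_vec e e)"] by simp
    then show ?thesis
      by (simp add: d_def)
  qed
  have dne: "d e f \<noteq> 0" if ef: "e \<in> E" "f \<in> E" "e \<noteq> f" for e f
  proof
    assume "d e f = 0"
    then have "\<rho> \<cdot> (tensor_vec e f) = 0"
      using diag[OF ef(1,2)] by simp
    moreover have "tensor_vec e f \<in> diagonal_complement A \<pi>"
      unfolding diagonal_complement_iff[OF A \<V>]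
    proof
      fix v assume "v \<in> \<Union>\<V>"
      then obtain V where V: "V \<in> \<V>" "v \<in> V" by blast
      obtain c where c: "v = c *\<^sub>C u V"
        using V u(2)[OF V(1)] by blast
      have "u V \<in> E"
        using V(1) by (simp add: E_def)
      then have "cinner (u V) e = 0 \<or> cinner (u V) f = 0"
        using EE[of "u V"] ef by metis
      then show "cinner (tensor_vec v v) (tensor_vec e f) = 0"
        unfolding c cinner_tensor_vec cinner_scaleC_left by auto
    qed
    ultimately have "tensor_vec e f = 0"
      using D(8) by blast
    then have "cinner (tensor_vec e f) (tensor_vec e f) = 0"
      by simp
    then show False
      by (simp add: cinner_tensor_vec EE ef(1,2))
  qed
  obtain F :: "('b, 'b) htensor op" where
    F: "unitary_op F" "\<And>x y. F \<cdot> (tensor_vec x y) = tensor_vec y x"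
    using tensor_flip_unitary_exists by blast
  have dsym: "d e f = d f e" if "e \<in> E" "f \<in> E" for e f
  proof -
    have "inner (tensor_vec e f) ((F o\<^sub>L (\<rho> o\<^sub>L hadj F)) \<cdot> (tensor_vec e f)) = d f e"
      unfolding inner_conjugate[OF F(1)] by (simp add: hadj_unitary_eq[OF F] d_def)
    then show ?thesis
      unfolding tensor_flip_apply[OF A F D(5), symmetric] D(9) d_def .
  qed
  obtain U :: "(('b, 'b) htensor, 'b) htensor op" where
    U: "unitary_op U" "\<And>x y z. U \<cdot> (tensor_vec (tensor_vec x y) z) = tensor_vec (tensor_vec x z) y"
    using tensor_swap_last_exists by blast
  obtain W :: "(('b, 'b) htensor, 'b) htensor op" where
    W: "unitary_op W" "\<And>x y z. W \<cdot> (tensor_vec (tensor_vec x y) z) = tensor_vec (tensor_vec z x) y"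
    using tensor_rotate_exists by blast
  note R = tensor_op_apply[OF selfadjointD(1)[OF sa] clinear_op_id[where 'a = 'b]]
  have dtri: "d e g \<le> d e f + d f g" if "e \<in> E" "f \<in> E" "g \<in> E" for e f g
  proof -
    let ?x = "tensor_vec (tensor_vec e f) g"
    have 1: "cinner e e = complex_of_real 1" "cinner f f = complex_of_real 1" "cinner g g = complex_of_real 1"
      using that by (simp_all add: EE)
    have "inner ?x (right_unit A \<pi> \<rho> \<cdot> ?x) = d e f"
      unfolding right_unit_apply[OF A D(5)] by (simp add: R inner_tensor_vec[OF 1(3)] d_def)
    moreover have "inner ?x (left_unit A \<pi> \<rho> \<cdot> ?x) = d f g"
      unfolding left_unit_apply[OF A W D(5)] inner_conjugate[OF W(1)]
      by (simp add: hadj_unitary_eq[OF W] R inner_tensor_vec[OF 1(1)] d_def)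
    moreover have "inner ?x (middle_unit A \<pi> \<rho> \<cdot> ?x) = d e g"
      unfolding middle_unit_apply[OF A U D(5)] inner_conjugate[OF U(1)]
      by (simp add: hadj_unitary_eq[OF U] R inner_tensor_vec[OF 1(2)] d_def)
    moreover have "0 \<le> inner ?x ((right_unit A \<pi> \<rho> + left_unit A \<pi> \<rho> - middle_unit A \<pi> \<rho>) \<cdot> ?x)"
      using D(10) unfolding positive_op_def by simp
    ultimately show ?thesis
      by (simp add: blinfun.add_left blinfun.diff_left inner_add_right inner_diff_right)
  qed
  have "diagonal_metric E d \<rho>"
    unfolding diagonal_metric_def
  proof (intro ballI conjI)
    fix e f assume ef: "e \<in> E" "f \<in> E"
    show "0 \<le> d e f"
      unfolding d_def by (rule pos)
    show "d e f = 0 \<longleftrightarrow> e = f"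
      using d0 dne ef by metis
  qed (rule diag dsym dtri; assumption)+
  then show ?thesis
    using basis by blast
qed

text \<open>
  By Parseval's identity the form of \<open>T\<close> at \<open>x\<close> is \<open>\<Sum> \<delta> b \<bar>\<langle>b, x\<rangle>\<bar>\<^sup>2\<close>.
\<close>

lemma diagonal_positive_op:
  assumes B: "is_onb B" and T: "clinear_op T"
    and diag: "\<And>b. b \<in> B \<Longrightarrow> T \<cdot> b = complex_of_real (\<delta> b) *\<^sub>C b" and pos: "\<And>b. b \<in> B \<Longrightarrow> 0 \<le> \<delta> b"
  shows "positive_op T"
proof -
  have on: "cinner b b' = (if b = b' then 1 else 0)" if "b \<in> B" "b' \<in> B" for b b'
    using B that unfolding is_onb_def orthonormal_def by simp
  have "hadj T = T"
  proof (rule clinear_op_eq_on_onb[OF clinear_op_hadj[OF T] T B])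
    fix b assume b: "b \<in> B"
    show "hadj T \<cdot> b = T \<cdot> b"
      by (rule is_onb_ext[OF B])
        (simp add: cinner_hadj_right[OF T] diag b cinner_scaleC_left cinner_scaleC_right on)
  qed
  then have sa: "selfadjoint T"
    using T by (simp add: selfadjoint_def)
  have "0 \<le> inner x (T \<cdot> x)" for x
  proof -
    have "((\<lambda>b. cnj (cinner b x) * cinner b (T \<cdot> x)) has_sum cinner x (T \<cdot> x)) B"
      by (rule parseval[OF B])
    moreover have "cnj (cinner b x) * cinner b (T \<cdot> x) = complex_of_real (\<delta> b * (cmod (cinner b x))\<^sup>2)"
      if "b \<in> B" for b
    proof -
      have "cinner b (T \<cdot> x) = complex_of_real (\<delta> b) * cinner b x"
        using selfadjointD(3)[OF sa, of b x] by (simp add: diag[OF that] cinner_scaleC_left)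
      then show ?thesis
        unfolding of_real_mult complex_norm_square by (simp only: ac_simps)
    qed
    ultimately have "((\<lambda>b. complex_of_real (\<delta> b * (cmod (cinner b x))\<^sup>2)) has_sum
        complex_of_real (inner x (T \<cdot> x))) B"
      unfolding cinner_selfadjoint_self[OF sa] by (simp cong: has_sum_cong)
    then have "((\<lambda>b. \<delta> b * (cmod (cinner b x))\<^sup>2) has_sum inner x (T \<cdot> x)) B"
      by (simp only: has_sum_of_real_iff)
    then show ?thesis
      by (rule has_sum_nonneg) (simp add: pos)
  qed
  then show ?thesis
    using sa by (simp add: positive_op_def)
qed

text \<open>
  A line has no proper subspaces, so the eigenlines are irreducible; an equivalence between two
  of them would identify their characters.
\<close>

lemma atomic_decomposition_eigenbasis:
  assumes A: "unital_cstar_algebra A" "representation A \<pi>" and E: "joint_eigenbasis A \<pi> E"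
  shows "atomic_decomposition A \<pi> {range (\<lambda>c. c *\<^sub>C e) |e. e \<in> E}"
proof -
  have onb: "is_onb E"
    and eig: "\<And>e a. e \<in> E \<Longrightarrow> a \<in> carrier A \<Longrightarrow> \<pi> a \<cdot> e = cinner e (\<pi> a \<cdot> e) *\<^sub>C e"
    and chars: "\<And>e f. e \<in> E \<Longrightarrow> f \<in> E \<Longrightarrow> e \<noteq> f \<Longrightarrow>
      \<exists>a\<in>carrier A. cinner e (\<pi> a \<cdot> e) \<noteq> cinner f (\<pi> a \<cdot> f)"
    using E unfolding joint_eigenbasis_def by simp_all
  have EE: "cinner e f = (if e = f then 1 else 0)" if "e \<in> E" "f \<in> E" for e f
    using onb that unfolding is_onb_def orthonormal_def by simp
  let ?L = "\<lambda>e. range (\<lambda>c. c *\<^sub>C e)"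
  have mem: "x \<in> ?L e \<longleftrightarrow> x = cinner e x *\<^sub>C e" if e: "e \<in> E" for e x
  proof
    assume "x \<in> ?L e"
    then obtain c where "x = c *\<^sub>C e" by blast
    then show "x = cinner e x *\<^sub>C e"
      by (simp add: cinner_scaleC_right EE e)
  qed (metis rangeI)
  have csub: "closed_csubspace (?L e)" if e: "e \<in> E" for e
  proof -
    have "closed_csubspace {x \<in> UNIV. (id_blinfun - rank_one e) \<cdot> x = 0}"
      by (rule closed_csubspace_kernel)
        (simp_all add: closed_csubspace_def clinear_op_diff clinear_op_id rank_one(1))
    moreover have "(id_blinfun - rank_one e) \<cdot> x = 0 \<longleftrightarrow> x \<in> ?L e" for x
      unfolding mem[OF e] by (simp add: blinfun.diff_left rank_one)
    then have "{x \<in> UNIV. (id_blinfun - rank_one e) \<cdot> x = 0} = ?L e"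
      by blast
    ultimately show ?thesis
      by simp
  qed
  have inv: "invariant_subspace A \<pi> (?L e)" if e: "e \<in> E" for e
    unfolding invariant_subspace_def
  proof (intro conjI csub[OF e] ballI)
    fix a x assume a: "a \<in> carrier A" and "x \<in> ?L e"
    then obtain c where "x = c *\<^sub>C e" by blast
    then have "\<pi> a \<cdot> x = (c * cinner e (\<pi> a \<cdot> e)) *\<^sub>C e"
      using eig[OF e a] clinear_opD[OF representationD(1)[OF A a]] by (metis scaleC_scaleC)
    then show "\<pi> a \<cdot> x \<in> ?L e"
      by blast
  qed
  have irr: "irreducible_subrep A \<pi> (?L e)" if e: "e \<in> E" for e
    unfolding irreducible_subrep_def
  proof (intro conjI inv[OF e] allI impI)
    have "e \<in> ?L e"
      unfolding mem[OF e] by (simp add: EE e)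
    moreover have "e \<noteq> 0"
      using EE[OF e e] by auto
    ultimately show "?L e \<noteq> {0}"
      by blast
    fix W assume W: "invariant_subspace A \<pi> W \<and> W \<subseteq> ?L e"
    then have sub: "subspace W" and sc: "\<And>c x. x \<in> W \<Longrightarrow> c *\<^sub>C x \<in> W"
      by (simp_all add: invariant_subspace_def closed_csubspace_def)
    show "W = {0} \<or> W = ?L e"
    proof (cases "W = {0}")
      case False
      then obtain x where x: "x \<in> W" "x \<noteq> 0"
        using subspace_0[OF sub] by blast
      then obtain k where k: "x = k *\<^sub>C e"
        using W by blast
      then have "k \<noteq> 0"
        using x(2) by auto
      then have "c *\<^sub>C e = (c / k) *\<^sub>C x" for c
        by (simp add: k scaleC_scaleC)
      then have "c *\<^sub>C e \<in> W" for c
        using sc[OF x(1)] by simp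
      then show ?thesis
        using W by blast
    qed simp
  qed
  have neq: "\<not> equivalent_subreps A \<pi> (?L e) (?L f)" if ef: "e \<in> E" "f \<in> E" "e \<noteq> f" for e f
  proof
    assume "equivalent_subreps A \<pi> (?L e) (?L f)"
    then obtain U where U: "U ` ?L e = ?L f" "\<forall>c. \<forall>x\<in>?L e. U (c *\<^sub>C x) = c *\<^sub>C U x"
      "\<forall>x\<in>?L e. norm (U x) = norm x"
      "\<forall>a\<in>carrier A. \<forall>x\<in>?L e. U (\<pi> a \<cdot> x) = \<pi> a \<cdot> (U x)"
      unfolding equivalent_subreps_def by blast
    have eL: "e \<in> ?L e"
      unfolding mem[OF ef(1)] by (simp add: EE ef)
    have "U e \<in> ?L f"
      using U(1) eL by blast
    then obtain k where k: "U e = k *\<^sub>C f"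
      by blast
    have "norm (U e) = norm e"
      using U(3) eL by blast
    moreover have "cinner e e = 1"
      by (simp add: EE ef)
    ultimately have k0: "k \<noteq> 0" "f \<noteq> 0"
      using k by auto
    obtain a where a: "a \<in> carrier A" "cinner e (\<pi> a \<cdot> e) \<noteq> cinner f (\<pi> a \<cdot> f)"
      using chars[OF ef] by blast
    let ?p = "cinner e (\<pi> a \<cdot> e)" and ?q = "cinner f (\<pi> a \<cdot> f)"
    have "U (\<pi> a \<cdot> e) = U (?p *\<^sub>C e)"
      using eig[OF ef(1) a(1)] by simp
    also have "\<dots> = (?p * k) *\<^sub>C f"
      using U(2)[rule_format, OF eL] by (simp add: k scaleC_scaleC)
    finally have 1: "U (\<pi> a \<cdot> e) = (?p * k) *\<^sub>C f" .
    have "U (\<pi> a \<cdot> e) = \<pi> a \<cdot> (k *\<^sub>C f)"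
      using U(4) a(1) eL k by metis
    also have "\<dots> = (k * ?q) *\<^sub>C f"
      using eig[OF ef(2) a(1)] clinear_opD[OF representationD(1)[OF A a(1)], of k f] by (metis scaleC_scaleC)
    finally have "(?p * k) *\<^sub>C f = (k * ?q) *\<^sub>C f"
      using 1 by simp
    from arg_cong[OF this, of "cinner f"] have "?p * k = k * ?q"
      using EE[OF ef(2) ef(2)] by (simp add: cinner_scaleC_right)
    then show False
      using a(2) k0(1) by simp
  qed
  have dense: "closure (span (\<Union>{?L e |e. e \<in> E})) = UNIV"
  proof -
    have "\<Union>{?L e |e. e \<in> E} = {c *\<^sub>C e |c e. e \<in> E}"
      by blast
    then show ?thesis
      using closure_span_onb[OF onb] by simp
  qed
  show ?thesis
    unfolding atomic_decomposition_def
  proof (intro conjI ballI impI dense)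
    fix V assume "V \<in> {?L e |e. e \<in> E}"
    then obtain e where e: "e \<in> E" "V = ?L e"
      by blast
    show "irreducible_subrep A \<pi> V"
      unfolding e(2) by (rule irr[OF e(1)])
    fix W assume "W \<in> {?L e |e. e \<in> E}" and VW: "V \<noteq> W"
    then obtain f where f: "f \<in> E" "W = ?L f"
      by blast
    have "e \<noteq> f"
      using VW e(2) f(2) by blast
    then show "\<not> equivalent_subreps A \<pi> V W"
      unfolding e(2) f(2) by (rule neq[OF e(1) f(1)])
    fix x y assume "x \<in> V" "y \<in> W"
    then obtain c k where "x = c *\<^sub>C e" "y = k *\<^sub>C f"
      using e(2) f(2) by blast
    then show "cinner x y = 0"
      using \<open>e \<noteq> f\<close> by (simp add: cinner_scaleC_left cinner_scaleC_right EE e(1) f(1))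
  qed
qed

text \<open>
  The diagonal projection is the projection onto the closed span of the vectors \<open>e \<otimes> e\<close>, which is
  the kernel of \<open>\<rho>\<close> because \<open>d e f = 0\<close> only for \<open>e = f\<close>. The operator in the triangle
  inequality is diagonal with entries \<open>d e f + d f g - d e g\<close>.
\<close>

lemma diagonal_imp_compact_quantum_metric_space:
  assumes A: "unital_cstar_algebra A" "representation A \<pi>" and inj: "inj_on \<pi> (carrier A)"
    and E: "joint_eigenbasis A \<pi> E" and d: "diagonal_metric E d \<rho>" and \<rho>: "\<rho> \<in> carrier (tensor_square A \<pi>)"
  shows "compact_quantum_metric_space A \<rho> \<pi>"
proof -
  define \<V> where "\<V> = {range (\<lambda>c. c *\<^sub>C e) |e. e \<in> E}"
  have \<V>: "atomic_decomposition A \<pi> \<V>"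
    unfolding \<V>_def by (rule atomic_decomposition_eigenbasis[OF A E])
  have onb: "is_onb E"
    using E unfolding joint_eigenbasis_def by simp
  have EE: "cinner e f = (if e = f then 1 else 0)" if "e \<in> E" "f \<in> E" for e f
    using onb that unfolding is_onb_def orthonormal_def by simp
  let ?E2 = "{tensor_vec e f |e f. e \<in> E \<and> f \<in> E}"
  have onb2: "is_onb ?E2"
    by (rule is_onb_tensor[OF onb onb])
  have dm: "\<rho> \<cdot> (tensor_vec e f) = complex_of_real (d e f) *\<^sub>C tensor_vec e f"
    "0 \<le> d e f" "d e f = 0 \<longleftrightarrow> e = f" "d e f = d f e" if "e \<in> E" "f \<in> E" for e f
    using d that unfolding diagonal_metric_def by simp_all
  have tri: "d e g \<le> d e f + d f g" if "e \<in> E" "f \<in> E" "g \<in> E" for e f g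
    using d that unfolding diagonal_metric_def by simp
  note sq = star_subalgebra_tensor_square[OF A]
  have cl: "clinear_op \<rho>"
    by (rule star_subalgebraD(1)[OF sq \<rho>])
  have form: "inner (tensor_vec e f) (\<rho> \<cdot> (tensor_vec e f)) = d e f" if "e \<in> E" "f \<in> E" for e f
    by (simp add: dm(1)[OF that] inner_eq_Re_cinner cinner_scaleC_right cinner_tensor_vec EE that)
  have "positive_op \<rho>"
  proof (rule diagonal_positive_op[OF onb2 cl, where \<delta> = "\<lambda>b. inner b (\<rho> \<cdot> b)"])
    fix b assume "b \<in> ?E2"
    then obtain e f where b: "e \<in> E" "f \<in> E" "b = tensor_vec e f"
      by blast
    show "\<rho> \<cdot> b = complex_of_real (inner b (\<rho> \<cdot> b)) *\<^sub>C b"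
      unfolding b(3) form[OF b(1,2)] by (rule dm(1)[OF b(1,2)])
    show "0 \<le> inner b (\<rho> \<cdot> b)"
      unfolding b(3) form[OF b(1,2)] by (rule dm(2)[OF b(1,2)])
  qed
  then have sa: "selfadjoint \<rho>" and pos: "positive_in (tensor_square A \<pi>) \<rho>"
    using positive_in_operator_algebra_iff[OF sq, of \<rho>] \<rho>
    unfolding tensor_square_operator_algebra[symmetric] by (simp_all add: positive_op_def)
  let ?P = "diagonal_projection A \<pi>"
  note P = diagonal_projection[OF A \<V>]
  have Poff: "cinner (tensor_vec v v) (tensor_vec e f) = 0" if ef: "e \<in> E" "f \<in> E" "e \<noteq> f" and v: "v \<in> \<Union>\<V>" for e f v
  proof -
    obtain g c where g: "g \<in> E" "v = c *\<^sub>C g"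
      using v unfolding \<V>_def by blast
    have "cinner g e = 0 \<or> cinner g f = 0"
      using EE[OF g(1) ef(1)] EE[OF g(1) ef(2)] ef(3) by metis
    then show ?thesis
      unfolding g(2) cinner_tensor_vec cinner_scaleC_left by auto
  qed
  have P\<rho>: "?P o\<^sub>L \<rho> = 0"
  proof (rule clinear_op_eq_on_onb[OF _ _ onb2])
    show "clinear_op (?P o\<^sub>L \<rho>)"
      by (rule clinear_op_compose[OF is_projectionD(2)[OF P(1)] cl])
    show "clinear_op (0 :: ('b, 'b) htensor op)"
      by (simp add: clinear_op_def)
    fix b assume "b \<in> ?E2"
    then obtain e f where b: "e \<in> E" "f \<in> E" "b = tensor_vec e f"
      by blast
    show "(?P o\<^sub>L \<rho>) \<cdot> b = 0 \<cdot> b"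
    proof (cases "e = f")
      case True
      then have "\<rho> \<cdot> b = 0"
        using dm(1,3)[OF b(1,2)] by (simp add: b(3))
      then show ?thesis
        by simp
    next
      case False
      have "?P \<cdot> b = 0"
        unfolding b(3) by (rule P(3)) (rule Poff[OF b(1,2) False])
      then show ?thesis
        using dm(1)[OF b(1,2)] by (simp add: b(3) clinear_opD[OF is_projectionD(2)[OF P(1)]])
    qed
  qed
  have "hadj (?P o\<^sub>L \<rho>) = \<rho> o\<^sub>L ?P"
    by (simp add: hadj_compose cl is_projectionD(2,3)[OF P(1)] selfadjointD(2)[OF sa])
  then have \<rho>P: "\<rho> o\<^sub>L ?P = 0"
    using P\<rho> by (simp add: hadj_zero)
  have inj_\<rho>: "x = 0" if x: "x \<in> diagonal_complement A \<pi>" "\<rho> \<cdot> x = 0" for x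
  proof (rule is_onb_ext[OF onb2])
    fix b assume "b \<in> ?E2"
    then obtain e f where b: "e \<in> E" "f \<in> E" "b = tensor_vec e f"
      by blast
    show "cinner b x = cinner b 0"
    proof (cases "e = f")
      case True
      have "e \<in> \<Union>\<V>"
        unfolding \<V>_def using b(1) rangeI[of "\<lambda>c. c *\<^sub>C e" 1] by auto
      then have "cinner (tensor_vec e e) x = 0"
        using x(1) unfolding diagonal_complement_iff[OF A \<V>] by blast
      then show ?thesis
        using True by (simp add: b(3))
    next
      case False
      have "complex_of_real (d e f) * cinner b x = cinner (\<rho> \<cdot> b) x"
        by (simp add: b(3) dm(1)[OF b(1,2)] cinner_scaleC_left)
      also have "\<dots> = 0"
        by (simp add: selfadjointD(3)[OF sa] x(2))
      finally show ?thesis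
        using False dm(3)[OF b(1,2)] by simp
    qed
  qed
  obtain F :: "('b, 'b) htensor op" where
    F: "unitary_op F" "\<And>x y. F \<cdot> (tensor_vec x y) = tensor_vec y x"
    using tensor_flip_unitary_exists by blast
  have flip: "tensor_flip A \<pi> \<rho> = \<rho>"
    unfolding tensor_flip_apply[OF A F \<rho>]
  proof (rule clinear_op_eq_on_onb[OF _ cl onb2])
    show "clinear_op (F o\<^sub>L (\<rho> o\<^sub>L hadj F))"
      by (intro clinear_op_compose unitary_opD[OF F(1)] cl)
    fix b assume "b \<in> ?E2"
    then obtain e f where b: "e \<in> E" "f \<in> E" "b = tensor_vec e f"
      by blast
    show "(F o\<^sub>L (\<rho> o\<^sub>L hadj F)) \<cdot> b = \<rho> \<cdot> b"
      by (simp add: b(3) hadj_unitary_eq[OF F] dm(1)[OF b(1,2)] dm(1)[OF b(2,1)] dm(4)[OF b(1,2)]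
          clinear_opD[OF unitary_opD(1)[OF F(1)]] F(2))
  qed
  obtain U :: "(('b, 'b) htensor, 'b) htensor op" where
    U: "unitary_op U" "\<And>x y z. U \<cdot> (tensor_vec (tensor_vec x y) z) = tensor_vec (tensor_vec x z) y"
    using tensor_swap_last_exists by blast
  obtain W :: "(('b, 'b) htensor, 'b) htensor op" where
    W: "unitary_op W" "\<And>x y z. W \<cdot> (tensor_vec (tensor_vec x y) z) = tensor_vec (tensor_vec z x) y"
    using tensor_rotate_exists by blast
  note R = tensor_op_apply[OF cl clinear_op_id[where 'a = 'b]]
  let ?E3 = "{tensor_vec b g |b g. b \<in> ?E2 \<and> g \<in> E}"
  have onb3: "is_onb ?E3"
    by (rule is_onb_tensor[OF onb2 onb])
  note cube = star_subalgebra_tensor_cube[OF A]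
  let ?T = "right_unit A \<pi> \<rho> + left_unit A \<pi> \<rho> - middle_unit A \<pi> \<rho>"
  have mem: "right_unit A \<pi> \<rho> \<in> carrier (tensor_cube A \<pi>)" "left_unit A \<pi> \<rho> \<in> carrier (tensor_cube A \<pi>)"
    "middle_unit A \<pi> \<rho> \<in> carrier (tensor_cube A \<pi>)"
    by (rule right_unit_closed[OF A \<rho>] left_unit_closed[OF A W \<rho>] middle_unit_closed[OF A U \<rho>])+
  have clT: "clinear_op ?T"
    by (intro clinear_op_diff clinear_op_add star_subalgebraD(1)[OF cube] mem)
  have T: "?T \<cdot> (tensor_vec (tensor_vec e f) g)
      = complex_of_real (d e f + d f g - d e g) *\<^sub>C tensor_vec (tensor_vec e f) g"
    if "e \<in> E" "f \<in> E" "g \<in> E" for e f g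
  proof -
    let ?x = "tensor_vec (tensor_vec e f) g"
    have 1: "right_unit A \<pi> \<rho> \<cdot> ?x = complex_of_real (d e f) *\<^sub>C ?x"
      unfolding right_unit_apply[OF A \<rho>] by (simp add: R dm(1) that tensor_vec_scaleC_left)
    have 2: "left_unit A \<pi> \<rho> \<cdot> ?x = complex_of_real (d f g) *\<^sub>C ?x"
      unfolding left_unit_apply[OF A W \<rho>]
      by (simp add: hadj_unitary_eq[OF W] R dm(1) that tensor_vec_scaleC_left clinear_opD[OF unitary_opD(1)[OF W(1)]] W(2))
    have 3: "middle_unit A \<pi> \<rho> \<cdot> ?x = complex_of_real (d e g) *\<^sub>C ?x"
      unfolding middle_unit_apply[OF A U \<rho>]
      by (simp add: hadj_unitary_eq[OF U] R dm(1) that tensor_vec_scaleC_left clinear_opD[OF unitary_opD(1)[OF U(1)]] U(2))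
    have "complex_of_real (d e f + d f g - d e g) *\<^sub>C ?x
        = complex_of_real (d e f) *\<^sub>C ?x + complex_of_real (d f g) *\<^sub>C ?x - complex_of_real (d e g) *\<^sub>C ?x"
      by (simp only: scaleC_of_real scaleR_add_left scaleR_diff_left)
    then show ?thesis
      by (simp add: blinfun.add_left blinfun.diff_left 1 2 3)
  qed
  have formT: "inner (tensor_vec (tensor_vec e f) g) (?T \<cdot> (tensor_vec (tensor_vec e f) g))
      = d e f + d f g - d e g" if "e \<in> E" "f \<in> E" "g \<in> E" for e f g
    unfolding T[OF that] by (simp add: inner_eq_Re_cinner cinner_scaleC_right cinner_tensor_vec EE that)
  have "positive_op ?T"
  proof (rule diagonal_positive_op[OF onb3 clT, where \<delta> = "\<lambda>b. inner b (?T \<cdot> b)"])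
    fix b assume "b \<in> ?E3"
    then obtain e f g where b: "e \<in> E" "f \<in> E" "g \<in> E" "b = tensor_vec (tensor_vec e f) g"
      by blast
    show "?T \<cdot> b = complex_of_real (inner b (?T \<cdot> b)) *\<^sub>C b"
      unfolding b(4) formT[OF b(1-3)] by (rule T[OF b(1-3)])
    show "0 \<le> inner b (?T \<cdot> b)"
      unfolding b(4) formT[OF b(1-3)] using tri[OF b(1-3)] by simp
  qed
  moreover have "right_unit A \<pi> \<rho> + left_unit A \<pi> \<rho> \<in> carrier (tensor_cube A \<pi>)"
    by (rule star_subalgebraD(9)[OF cube mem(1,2)])
  ultimately have "le_in (operator_algebra (carrier (tensor_cube A \<pi>))) (middle_unit A \<pi> \<rho>)
      (right_unit A \<pi> \<rho> + left_unit A \<pi> \<rho>)"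
    unfolding le_in_operator_algebra_iff[OF cube] using mem(3) by simp
  moreover have "add (tensor_cube A \<pi>) = (+)"
    by (simp add: tensor_cube_def spatial_tensor_eq)
  ultimately have le: "le_in (tensor_cube A \<pi>) (middle_unit A \<pi> \<rho>)
      (right_unit A \<pi> \<rho> \<oplus>\<^bsub>tensor_cube A \<pi>\<^esub> left_unit A \<pi> \<rho>)"
    unfolding tensor_cube_operator_algebra[symmetric] by simp
  have "atomic_representation A \<pi>"
    unfolding atomic_representation_iff using A(2) \<V> by blast
  then show ?thesis
    unfolding compact_quantum_metric_space_def
    using A(1) inj pos \<rho>P P\<rho> inj_\<rho> flip le by blast
qed

section \<open>Products\<close>

text \<open>
  If \<open>e \<otimes> f\<close> and \<open>e' \<otimes> f'\<close> differ, their characters are separated by some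
  \<open>a \<otimes> 1\<close> or \<open>1 \<otimes> b\<close>.
\<close>

lemma joint_eigenbasis_tensor:
  assumes A: "unital_cstar_algebra A" "representation A \<pi>" and B: "unital_cstar_algebra B" "representation B \<sigma>"
    and E: "joint_eigenbasis A \<pi> E" and F: "joint_eigenbasis B \<sigma> F"
  shows "joint_eigenbasis (spatial_tensor A \<pi> B \<sigma>) (tensor_rep A \<pi> B \<sigma>) {tensor_vec e f |e f. e \<in> E \<and> f \<in> F}"
proof -
  have onb: "is_onb E" "is_onb F"
    and eigE: "\<And>e a. e \<in> E \<Longrightarrow> a \<in> carrier A \<Longrightarrow> \<pi> a \<cdot> e = cinner e (\<pi> a \<cdot> e) *\<^sub>C e"
    and eigF: "\<And>e a. e \<in> F \<Longrightarrow> a \<in> carrier B \<Longrightarrow> (\<sigma> a) \<cdot> e = cinner e (\<sigma> a \<cdot> e) *\<^sub>C e"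
    using E F unfolding joint_eigenbasis_def by simp_all
  have chE: "\<exists>a\<in>carrier A. cinner e (\<pi> a \<cdot> e) \<noteq> cinner f (\<pi> a \<cdot> f)"
    if "e \<in> E" "f \<in> E" "e \<noteq> f" for e f
    using E that unfolding joint_eigenbasis_def by simp
  have chF: "\<exists>a\<in>carrier B. cinner e (\<sigma> a \<cdot> e) \<noteq> cinner f (\<sigma> a \<cdot> f)"
    if "e \<in> F" "f \<in> F" "e \<noteq> f" for e f
    using F that unfolding joint_eigenbasis_def by simp
  have EE: "cinner e e = 1" if "e \<in> E" for e
    using onb(1) that unfolding is_onb_def orthonormal_def by simp
  have FF: "cinner f f = 1" if "f \<in> F" for f
    using onb(2) that unfolding is_onb_def orthonormal_def by simp
  note rA = representationD[OF A] and rB = representationD[OF B]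
  note oneA = unital_cstar_algebra_closed(1)[OF A(1)] and oneB = unital_cstar_algebra_closed(1)[OF B(1)]
  note id = tensor_rep_apply[OF A B]
  have eig: "T \<cdot> (tensor_vec e f) = cinner (tensor_vec e f) (T \<cdot> (tensor_vec e f)) *\<^sub>C tensor_vec e f"
    if T: "T \<in> carrier (spatial_tensor A \<pi> B \<sigma>)" and ef: "e \<in> E" "f \<in> F" for T e f
  proof (rule eigenvector_closure_span)
    show "T \<in> closure (span (elementary_tensors A \<pi> B \<sigma>))"
      using T by (simp add: carrier_spatial_tensor)
    fix g assume "g \<in> elementary_tensors A \<pi> B \<sigma>"
    then obtain a b where ab: "a \<in> carrier A" "b \<in> carrier B" "g = tensor_op (\<pi> a) (\<sigma> b)"
      unfolding elementary_tensors_def by blast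
    obtain k l where kl: "\<pi> a \<cdot> e = k *\<^sub>C e" "\<sigma> b \<cdot> f = l *\<^sub>C f"
      using eigE[OF ef(1) ab(1)] eigF[OF ef(2) ab(2)] by blast
    have "g \<cdot> (tensor_vec e f) = (k * l) *\<^sub>C tensor_vec e f"
      by (simp add: ab(3) tensor_op_apply rA(1)[OF ab(1)] rB(1)[OF ab(2)] kl
          tensor_vec_scaleC_left tensor_vec_scaleC_right scaleC_scaleC mult.commute)
    then show "g \<cdot> (tensor_vec e f) = cinner (tensor_vec e f) (g \<cdot> (tensor_vec e f)) *\<^sub>C tensor_vec e f"
      by (simp add: cinner_scaleC_right cinner_tensor_vec EE FF ef)
  qed
  have val: "cinner (tensor_vec e f) (tensor_op (\<pi> a) (\<sigma> b) \<cdot> (tensor_vec e f))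
      = cinner e (\<pi> a \<cdot> e) * cinner f (\<sigma> b \<cdot> f)"
    if "a \<in> carrier A" "b \<in> carrier B" for a b e f
    by (simp add: tensor_op_apply rA(1)[OF that(1)] rB(1)[OF that(2)] cinner_tensor_vec)
  show ?thesis
    unfolding joint_eigenbasis_def
  proof (intro conjI ballI impI is_onb_tensor[OF onb])
    fix u T assume "u \<in> {tensor_vec e f |e f. e \<in> E \<and> f \<in> F}" and T: "T \<in> carrier (spatial_tensor A \<pi> B \<sigma>)"
    then obtain e f where u: "e \<in> E" "f \<in> F" "u = tensor_vec e f"
      by blast
    show "tensor_rep A \<pi> B \<sigma> T \<cdot> u = cinner u (tensor_rep A \<pi> B \<sigma> T \<cdot> u) *\<^sub>C u"
      unfolding id[OF T] u(3) by (rule eig[OF T u(1,2)])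
  next
    fix u v assume "u \<in> {tensor_vec e f |e f. e \<in> E \<and> f \<in> F}" "v \<in> {tensor_vec e f |e f. e \<in> E \<and> f \<in> F}" and uv: "u \<noteq> v"
    then obtain e f e' f' where u: "e \<in> E" "f \<in> F" "u = tensor_vec e f" and v: "e' \<in> E" "f' \<in> F" "v = tensor_vec e' f'"
      by blast
    have "e \<noteq> e' \<or> f \<noteq> f'"
      using uv u(3) v(3) by blast
    then have "\<exists>a\<in>carrier A. \<exists>b\<in>carrier B. cinner e (\<pi> a \<cdot> e) * cinner f (\<sigma> b \<cdot> f)
        \<noteq> cinner e' (\<pi> a \<cdot> e') * cinner f' (\<sigma> b \<cdot> f')"
    proof
      assume "e \<noteq> e'"
      then obtain a where a: "a \<in> carrier A" "cinner e (\<pi> a \<cdot> e) \<noteq> cinner e' (\<pi> a \<cdot> e')"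
        using chE[OF u(1) v(1)] by blast
      show ?thesis
        by (rule bexI[OF _ a(1)], rule bexI[OF _ oneB]) (simp add: rB(4) FF u(2) v(2) a(2))
    next
      assume "f \<noteq> f'"
      then obtain b where b: "b \<in> carrier B" "cinner f (\<sigma> b \<cdot> f) \<noteq> cinner f' (\<sigma> b \<cdot> f')"
        using chF[OF u(2) v(2)] by blast
      show ?thesis
        by (rule bexI[OF _ oneA], rule bexI[OF _ b(1)]) (simp add: rA(4) EE u(1) v(1) b(2))
    qed
    then obtain a b where ab: "a \<in> carrier A" "b \<in> carrier B"
      "cinner e (\<pi> a \<cdot> e) * cinner f (\<sigma> b \<cdot> f)
        \<noteq> cinner e' (\<pi> a \<cdot> e') * cinner f' (\<sigma> b \<cdot> f')"
      by blast
    have mem: "tensor_op (\<pi> a) (\<sigma> b) \<in> carrier (spatial_tensor A \<pi> B \<sigma>)"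
      by (rule tensor_op_in_spatial_tensor[OF ab(1,2)])
    show "\<exists>T\<in>carrier (spatial_tensor A \<pi> B \<sigma>).
        cinner u (tensor_rep A \<pi> B \<sigma> T \<cdot> u) \<noteq> cinner v (tensor_rep A \<pi> B \<sigma> T \<cdot> v)"
      by (rule bexI[OF _ mem]) (simp only: id[OF mem] u(3) v(3) val[OF ab(1,2)] ab(3) not_False_eq_True)
  qed
qed

text \<open>
  Transported along the flip of the middle factors, \<open>\<rho>\<^sub>1 \<otimes> 1 + 1 \<otimes> \<rho>\<^sub>2\<close> is diagonal
  with entries \<open>d\<^sub>1 + d\<^sub>2\<close>, the metric of the \<open>\<ell>\<^sup>1\<close> product. The function
  \<open>p\<close> recovers the factors of a basis vector.
\<close>

theorem theorem3:
  fixes A1 :: "'a cstar" and A2 :: "'b cstar"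
    and \<pi>1 :: "'a \<Rightarrow> 'h::chilbert_space op" and \<pi>2 :: "'b \<Rightarrow> 'k::chilbert_space op"
    and \<rho>1 :: "('h, 'h) htensor op" and \<rho>2 :: "('k, 'k) htensor op"
  assumes "compact_quantum_metric_space A1 \<rho>1 \<pi>1"
    and "compact_quantum_metric_space A2 \<rho>2 \<pi>2"
  shows "compact_quantum_metric_space
    (spatial_tensor A1 \<pi>1 A2 \<pi>2)
    (middle_swap A1 \<pi>1 A2 \<pi>2
       (tensor_op \<rho>1 \<one>\<^bsub>tensor_square A2 \<pi>2\<^esub> + tensor_op \<one>\<^bsub>tensor_square A1 \<pi>1\<^esub> \<rho>2))
    (tensor_rep A1 \<pi>1 A2 \<pi>2)"
proof -
  note D1 = compact_quantum_metric_spaceD[OF assms(1)] and D2 = compact_quantum_metric_spaceD[OF assms(2)]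
  note A = D1(1,2) and B = D2(1,2)
  obtain E d1 where E: "joint_eigenbasis A1 \<pi>1 E" and d1: "diagonal_metric E d1 \<rho>1"
    using compact_quantum_metric_space_imp_diagonal[OF assms(1)] by blast
  obtain F d2 where F: "joint_eigenbasis A2 \<pi>2 F" and d2: "diagonal_metric F d2 \<rho>2"
    using compact_quantum_metric_space_imp_diagonal[OF assms(2)] by blast
  have onb: "is_onb E" "is_onb F"
    using E F unfolding joint_eigenbasis_def by simp_all
  have dm1: "\<rho>1 \<cdot> (tensor_vec e e') = complex_of_real (d1 e e') *\<^sub>C tensor_vec e e'"
    "0 \<le> d1 e e'" "d1 e e' = 0 \<longleftrightarrow> e = e'" "d1 e e' = d1 e' e" if "e \<in> E" "e' \<in> E" for e e'
    using d1 that unfolding diagonal_metric_def by auto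
  have dm2: "\<rho>2 \<cdot> (tensor_vec f f') = complex_of_real (d2 f f') *\<^sub>C tensor_vec f f'"
    "0 \<le> d2 f f'" "d2 f f' = 0 \<longleftrightarrow> f = f'" "d2 f f' = d2 f' f" if "f \<in> F" "f' \<in> F" for f f'
    using d2 that unfolding diagonal_metric_def by auto
  have tri1: "d1 e e'' \<le> d1 e e' + d1 e' e''" if "e \<in> E" "e' \<in> E" "e'' \<in> E" for e e' e''
    using d1 that unfolding diagonal_metric_def by blast
  have tri2: "d2 f f'' \<le> d2 f f' + d2 f' f''" if "f \<in> F" "f' \<in> F" "f'' \<in> F" for f f' f''
    using d2 that unfolding diagonal_metric_def by blast
  let ?C = "spatial_tensor A1 \<pi>1 A2 \<pi>2" and ?\<tau> = "tensor_rep A1 \<pi>1 A2 \<pi>2"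
  note C = unital_cstar_algebra_spatial_tensor[OF A B] representation_tensor_rep[OF A B]
  note sqA = unital_cstar_algebra_tensor_square[OF A] representation_tensor_square[OF A]
  note sqB = unital_cstar_algebra_tensor_square[OF B] representation_tensor_square[OF B]
  define T where "T = tensor_op \<rho>1 id_blinfun + tensor_op id_blinfun \<rho>2"
  have one: "\<one>\<^bsub>tensor_square A1 \<pi>1\<^esub> = id_blinfun" "\<one>\<^bsub>tensor_square A2 \<pi>2\<^esub> = id_blinfun"
    by (simp_all add: tensor_square_def spatial_tensor_eq)
  have idA: "id_blinfun \<in> carrier (tensor_square A1 \<pi>1)" and idB: "id_blinfun \<in> carrier (tensor_square A2 \<pi>2)"
    by (rule star_subalgebraD(4)[OF star_subalgebra_tensor_square[OF A]],
        rule star_subalgebraD(4)[OF star_subalgebra_tensor_square[OF B]])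
  have in_spatial: "tensor_op s t \<in> carrier (spatial_tensor (tensor_square A1 \<pi>1) (tensor_rep A1 \<pi>1 A1 \<pi>1)
      (tensor_square A2 \<pi>2) (tensor_rep A2 \<pi>2 A2 \<pi>2))"
    if "s \<in> carrier (tensor_square A1 \<pi>1)" "t \<in> carrier (tensor_square A2 \<pi>2)" for s t
    using tensor_op_in_spatial_tensor[OF that, of "tensor_rep A1 \<pi>1 A1 \<pi>1" "tensor_rep A2 \<pi>2 A2 \<pi>2"]
    by (simp add: tensor_square_rep_apply[OF A that(1)] tensor_square_rep_apply[OF B that(2)])
  have T: "T \<in> carrier (spatial_tensor (tensor_square A1 \<pi>1) (tensor_rep A1 \<pi>1 A1 \<pi>1)
      (tensor_square A2 \<pi>2) (tensor_rep A2 \<pi>2 A2 \<pi>2))"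
    unfolding T_def
    by (rule star_subalgebraD(9)[OF star_subalgebra_spatial_tensor[OF sqA sqB]
          in_spatial[OF D1(5) idB] in_spatial[OF idA D2(5)]])
  obtain V :: "(('h, 'h) htensor, ('k, 'k) htensor) htensor \<Rightarrow>\<^sub>L (('h, 'k) htensor, ('h, 'k) htensor) htensor" where
    V: "unitary_op V" "\<And>x x' y y'. V \<cdot> (tensor_vec (tensor_vec x x') (tensor_vec y y'))
      = tensor_vec (tensor_vec x y) (tensor_vec x' y')"
    using tensor_middle_swap_exists by blast
  define \<rho> where "\<rho> = middle_swap A1 \<pi>1 A2 \<pi>2 T"
  have \<rho>: "\<rho> \<in> carrier (tensor_square ?C ?\<tau>)" "\<rho> = V o\<^sub>L (T o\<^sub>L hadj V)"
    unfolding \<rho>_def by (rule middle_swap_closed[OF A B V T], rule middle_swap_apply[OF A B V T])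
  have cl: "clinear_op \<rho>1" "clinear_op \<rho>2"
    using D1(6) D2(6) selfadjointD(1) by (auto simp: positive_op_def)
  have diag: "\<rho> \<cdot> (tensor_vec (tensor_vec e f) (tensor_vec e' f'))
      = complex_of_real (d1 e e' + d2 f f') *\<^sub>C tensor_vec (tensor_vec e f) (tensor_vec e' f')"
    if ef: "e \<in> E" "f \<in> F" "e' \<in> E" "f' \<in> F" for e f e' f'
  proof -
    let ?x = "tensor_vec (tensor_vec e e') (tensor_vec f f')"
    have "T \<cdot> ?x = complex_of_real (d1 e e') *\<^sub>C ?x + complex_of_real (d2 f f') *\<^sub>C ?x"
      by (simp add: T_def blinfun.add_left tensor_op_apply cl clinear_op_id dm1(1)[OF ef(1,3)] dm2(1)[OF ef(2,4)]
          tensor_vec_scaleC_left tensor_vec_scaleC_right)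
    also have "\<dots> = complex_of_real (d1 e e' + d2 f f') *\<^sub>C ?x"
      by (simp add: scaleC_add_left)
    finally show ?thesis
      by (simp add: \<rho>(2) hadj_unitary_eq[OF V] clinear_opD[OF unitary_opD(1)[OF V(1)]] V(2))
  qed
  define p where "p = inv_into (E \<times> F) (\<lambda>(e, f). tensor_vec e f)"
  have p: "p (tensor_vec e f) = (e, f)" if "e \<in> E" "f \<in> F" for e f
    using inv_into_f_f[OF inj_on_tensor_vec[OF onb], of "(e, f)"] that by (simp add: p_def)
  define d where "d u v = d1 (fst (p u)) (fst (p v)) + d2 (snd (p u)) (snd (p v))" for u v
  have d: "d (tensor_vec e f) (tensor_vec e' f') = d1 e e' + d2 f f'"
    if "e \<in> E" "f \<in> F" "e' \<in> E" "f' \<in> F" for e f e' f'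
    by (simp add: d_def p that)
  have metric: "diagonal_metric {tensor_vec e f |e f. e \<in> E \<and> f \<in> F} d \<rho>"
    unfolding diagonal_metric_def
  proof (intro ballI conjI)
    fix u v assume "u \<in> {tensor_vec e f |e f. e \<in> E \<and> f \<in> F}" "v \<in> {tensor_vec e f |e f. e \<in> E \<and> f \<in> F}"
    then obtain e f e' f' where u: "e \<in> E" "f \<in> F" "u = tensor_vec e f" and v: "e' \<in> E" "f' \<in> F" "v = tensor_vec e' f'"
      by blast
    note uv = d[OF u(1,2) v(1,2)] and vu = d[OF v(1,2) u(1,2)]
    show "\<rho> \<cdot> (tensor_vec u v) = complex_of_real (d u v) *\<^sub>C tensor_vec u v"
      unfolding u(3) v(3) uv by (rule diag[OF u(1,2) v(1,2)])
    show "0 \<le> d u v"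
      unfolding u(3) v(3) uv using dm1(2)[OF u(1) v(1)] dm2(2)[OF u(2) v(2)] by simp
    have "tensor_vec e f = tensor_vec e' f' \<longleftrightarrow> e = e' \<and> f = f'"
      using p[OF u(1,2)] p[OF v(1,2)] by (metis prod.inject)
    then show "d u v = 0 \<longleftrightarrow> u = v"
      unfolding u(3) v(3) uv
      using dm1(2,3)[OF u(1) v(1)] dm2(2,3)[OF u(2) v(2)] by (simp add: add_nonneg_eq_0_iff)
    show "d u v = d v u"
      unfolding u(3) v(3) uv vu using dm1(4)[OF u(1) v(1)] dm2(4)[OF u(2) v(2)] by simp
    fix w assume "w \<in> {tensor_vec e f |e f. e \<in> E \<and> f \<in> F}"
    then obtain e'' f'' where w: "e'' \<in> E" "f'' \<in> F" "w = tensor_vec e'' f''"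
      by blast
    show "d u w \<le> d u v + d v w"
      unfolding u(3) v(3) w(3) uv d[OF u(1,2) w(1,2)] d[OF v(1,2) w(1,2)]
      using tri1[OF u(1) v(1) w(1)] tri2[OF u(2) v(2) w(2)] by simp
  qed
  have "inj_on ?\<tau> (carrier ?C)"
    by (rule inj_onI) (simp add: tensor_rep_apply[OF A B])
  then have "compact_quantum_metric_space ?C \<rho> ?\<tau>"
    by (rule diagonal_imp_compact_quantum_metric_space[OF C _ joint_eigenbasis_tensor[OF A B E F] metric \<rho>(1)])
  then show ?thesis
    unfolding \<rho>_def T_def one .
qed

end
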